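(* Let $\rho_1,\sigma_1$ be density operators on $\mathbb{C}^{d_1}$ and $\rho_2,\sigma_2$ density operators on $\mathbb{C}^{d_2}$, with $\sigma_1,\sigma_2$ of full support. Let $\Delta\in\{T,P\}$. For $n,m\in\mathbb{N}$ and $\varepsilon\in[0,1]$, call $(n,m,\varepsilon)$ achievable if there exists a quantum channel $\mathcal{E}$ with $\mathcal{E}(\sigma_1^{\otimes n})=\sigma_2^{\otimes m}$ and $\Delta(\mathcal{E}(\rho_1^{\otimes n}),\rho_2^{\otimes m})\le\varepsilon$, and define $\hat R^{\varepsilon,\Delta}(n):=\sup\{\frac mn : (n,m,\varepsilon)\text{ achievable}\}$. Then for all $\varepsilon\in(0,1)$, $$\lim_{n\to\infty}\hat R^{\varepsilon,\Delta}(n)=\frac{D(\rho_1\|\sigma_1)}{D(\rho_2\|\sigma_2)},$$ where the right-hand side is interpreted as $+\infty$ when $D(\rho_2\|\sigma_2)=0$.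
   Context: Logarithms are base 2; quantum channels are completely positive trace-preserving maps. $D(\rho\|\sigma)=\mathrm{tr}\,\rho(\log\rho-\log\sigma)$ is the quantum relative entropy. Trace distance $T(\rho,\sigma)=\frac12\|\rho-\sigma\|_1$; purified distance $P(\rho,\sigma)=\sqrt{1-\|\sqrt\rho\sqrt\sigma\|_1^2}$. *)

theory Defs
  imports "Jordan_Normal_Form.Matrix" "HOL-Library.Extended_Real"
begin

definition adj :: "complex mat \<Rightarrow> complex mat" where
  "adj A = mat (dim_col A) (dim_row A) (\<lambda>(i,j). cnj (A $$ (j,i)))"

definition mtrace :: "complex mat \<Rightarrow> complex" where
  "mtrace A = (\<Sum>i<dim_row A. A $$ (i,i))"

definition qform :: "complex mat \<Rightarrow> complex vec \<Rightarrow> complex" where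
  "qform A v = (\<Sum>i<dim_vec v. \<Sum>j<dim_vec v. cnj (v $ i) * A $$ (i,j) * v $ j)"

definition psd :: "nat \<Rightarrow> complex mat \<Rightarrow> bool" where
  "psd n A \<longleftrightarrow> A \<in> carrier_mat n n \<and> adj A = A \<and> (\<forall>v\<in>carrier_vec n. 0 \<le> Re (qform A v))"

definition density :: "nat \<Rightarrow> complex mat \<Rightarrow> bool" where
  "density n \<rho> \<longleftrightarrow> psd n \<rho> \<and> mtrace \<rho> = 1"

(* full support: the support (orthogonal complement of the kernel) is all of C^n *)
definition full_support :: "nat \<Rightarrow> complex mat \<Rightarrow> bool" where
  "full_support n A \<longleftrightarrow> A \<in> carrier_mat n n \<and>
     (\<forall>v\<in>carrier_vec n. A *\<^sub>v v = 0\<^sub>v n \<longrightarrow> v = 0\<^sub>v n)"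

definition unitary :: "nat \<Rightarrow> complex mat \<Rightarrow> bool" where
  "unitary n U \<longleftrightarrow> U \<in> carrier_mat n n \<and> U * adj U = 1\<^sub>m n \<and> adj U * U = 1\<^sub>m n"

(* functional calculus via a spectral decomposition A = U diag(l) U^*
   (meaningful for Hermitian A) *)
definition mat_fun :: "(real \<Rightarrow> real) \<Rightarrow> complex mat \<Rightarrow> complex mat" where
  "mat_fun f A = (let n = dim_row A;
      p = (SOME p. unitary n (fst p) \<and>
             A = fst p * mat_diag n (\<lambda>i. complex_of_real (snd p i)) * adj (fst p))
     in fst p * mat_diag n (\<lambda>i. complex_of_real (f (snd p i))) * adj (fst p))"

definition msqrt :: "complex mat \<Rightarrow> complex mat" where
  "msqrt A = mat_fun sqrt A"

definition mlog :: "complex mat \<Rightarrow> complex mat" where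
  "mlog A = mat_fun (log 2) A"

definition trace_norm :: "complex mat \<Rightarrow> real" where
  "trace_norm A = Re (mtrace (msqrt (adj A * A)))"

definition trace_dist :: "complex mat \<Rightarrow> complex mat \<Rightarrow> real" where
  "trace_dist \<rho> \<sigma> = trace_norm (\<rho> - \<sigma>) / 2"

definition purified_dist :: "complex mat \<Rightarrow> complex mat \<Rightarrow> real" where
  "purified_dist \<rho> \<sigma> = sqrt (1 - (trace_norm (msqrt \<rho> * msqrt \<sigma>))\<^sup>2)"

definition rel_entropy :: "complex mat \<Rightarrow> complex mat \<Rightarrow> real" where
  "rel_entropy \<rho> \<sigma> = Re (mtrace (\<rho> * (mlog \<rho> - mlog \<sigma>)))"

definition kron :: "complex mat \<Rightarrow> complex mat \<Rightarrow> complex mat" where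
  "kron A B = mat (dim_row A * dim_row B) (dim_col A * dim_col B)
     (\<lambda>(i,j). A $$ (i div dim_row B, j div dim_col B) * B $$ (i mod dim_row B, j mod dim_col B))"

fun tpow :: "complex mat \<Rightarrow> nat \<Rightarrow> complex mat" where
  "tpow A 0 = 1\<^sub>m 1"
| "tpow A (Suc n) = kron A (tpow A n)"

definition lin_map :: "nat \<Rightarrow> nat \<Rightarrow> (complex mat \<Rightarrow> complex mat) \<Rightarrow> bool" where
  "lin_map a b E \<longleftrightarrow> (\<forall>X\<in>carrier_mat a a. E X \<in> carrier_mat b b) \<and>
     (\<forall>X\<in>carrier_mat a a. \<forall>Y\<in>carrier_mat a a. \<forall>c. E (c \<cdot>\<^sub>m X + Y) = c \<cdot>\<^sub>m E X + E Y)"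

(* id_k \<otimes> E, acting on operators on C^k \<otimes> C^a (index i*a + r) *)
definition ampl :: "nat \<Rightarrow> nat \<Rightarrow> nat \<Rightarrow> (complex mat \<Rightarrow> complex mat) \<Rightarrow> complex mat \<Rightarrow> complex mat" where
  "ampl k a b E X = mat (k*b) (k*b)
     (\<lambda>(p,q). E (mat a a (\<lambda>(r,s). X $$ ((p div b)*a + r, (q div b)*a + s))) $$ (p mod b, q mod b))"

definition completely_positive :: "nat \<Rightarrow> nat \<Rightarrow> (complex mat \<Rightarrow> complex mat) \<Rightarrow> bool" where
  "completely_positive a b E \<longleftrightarrow> (\<forall>k X. psd (k*a) X \<longrightarrow> psd (k*b) (ampl k a b E X))"

definition trace_preserving :: "nat \<Rightarrow> nat \<Rightarrow> (complex mat \<Rightarrow> complex mat) \<Rightarrow> bool" where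
  "trace_preserving a b E \<longleftrightarrow> (\<forall>X\<in>carrier_mat a a. mtrace (E X) = mtrace X)"

definition quantum_channel :: "nat \<Rightarrow> nat \<Rightarrow> (complex mat \<Rightarrow> complex mat) \<Rightarrow> bool" where
  "quantum_channel a b E \<longleftrightarrow> lin_map a b E \<and> completely_positive a b E \<and> trace_preserving a b E"

definition achievable ::
  "nat \<Rightarrow> nat \<Rightarrow> (complex mat \<Rightarrow> complex mat \<Rightarrow> real) \<Rightarrow> complex mat \<Rightarrow> complex mat \<Rightarrow>
   complex mat \<Rightarrow> complex mat \<Rightarrow> nat \<Rightarrow> nat \<Rightarrow> real \<Rightarrow> bool" where
  "achievable d1 d2 \<Delta> \<rho>1 \<sigma>1 \<rho>2 \<sigma>2 n m \<epsilon> \<longleftrightarrow>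
     (\<exists>E. quantum_channel (d1^n) (d2^m) E \<and> E (tpow \<sigma>1 n) = tpow \<sigma>2 m \<and>
          \<Delta> (E (tpow \<rho>1 n)) (tpow \<rho>2 m) \<le> \<epsilon>)"

definition Rhat ::
  "nat \<Rightarrow> nat \<Rightarrow> (complex mat \<Rightarrow> complex mat \<Rightarrow> real) \<Rightarrow> complex mat \<Rightarrow> complex mat \<Rightarrow>
   complex mat \<Rightarrow> complex mat \<Rightarrow> real \<Rightarrow> nat \<Rightarrow> ereal" where
  "Rhat d1 d2 \<Delta> \<rho>1 \<sigma>1 \<rho>2 \<sigma>2 \<epsilon> n =
     (SUP m\<in>{m. achievable d1 d2 \<Delta> \<rho>1 \<sigma>1 \<rho>2 \<sigma>2 n m \<epsilon>}. ereal (real m / real n))"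

end

theory Submission
  imports Defs "Jordan_Normal_Form.Spectral_Radius" "Jordan_Normal_Form.Schur_Decomposition"
    "HOL-Analysis.L2_Norm" "HOL-Library.Indicator_Function"
begin

text \<open>
  Let \<open>P\<close> and \<open>Q\<close> be the projections onto the eigenvectors of \<open>\<sigma>\<^sup>\<otimes>\<^sup>n\<close> and \<open>\<rho>\<^sup>\<otimes>\<^sup>n\<close> that are typical
  under \<open>\<rho>\<^sup>\<otimes>\<^sup>n\<close>: their eigenvalues are about \<open>2 powr (n tr \<rho> log \<sigma>)\<close> and \<open>2 powr (n tr \<rho> log \<rho>)\<close>.
  By the law of large numbers \<open>\<rho>\<^sup>\<otimes>\<^sup>n\<close> passes both with probability close to one, so both can be
  applied one after the other with little disturbance, although they need not commute.

  The test \<open>P Q P\<close> accepts \<open>\<rho>\<^sup>\<otimes>\<^sup>n\<close> almost surely and \<open>\<sigma>\<^sup>\<otimes>\<^sup>n\<close> with probability at most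
  \<open>\<parallel>P \<sigma>\<^sup>\<otimes>\<^sup>n P\<parallel> tr Q\<close>, about \<open>2 powr (- n D)\<close>. Conversely \<open>P Q \<rho>\<^sup>\<otimes>\<^sup>n Q P\<close>, topped up to trace one by a
  multiple of \<open>\<sigma>\<^sup>\<otimes>\<^sup>n\<close>, is a state close to \<open>\<rho>\<^sup>\<otimes>\<^sup>n\<close> and dominated by about \<open>2 powr (n D) \<sigma>\<^sup>\<otimes>\<^sup>n\<close>.

  Rates below the quotient are achieved by measuring the test of the first pair and preparing the
  dominated state of the second. For rates above the quotient, the test of the second pair, applied
  after the channel, would accept the image of \<open>\<rho>\<^sub>1\<^sup>\<otimes>\<^sup>n\<close> with probability bounded away from zero, and
  the dominated state of the first pair rules this out.
\<close>

section \<open>Complex matrices\<close>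

text \<open>The eigenbases of \<open>\<rho>\<close> and \<open>\<sigma>\<close> may be unrelated, so
  no common spectral picture is available. Instead each edge of a typical window is used as an
  operator inequality: against \<open>P \<sigma> P \<le> c 1\<close> only the trace of
  \<open>Q\<close> matters, and \<open>Q \<rho> Q \<le> a 1\<close> conjugated by \<open>P\<close>
  becomes a bound by \<open>a P\<close>, which is then compared with \<open>\<sigma>\<close>. One
  law of large numbers serves both projections, because measuring a tensor power of
  \<open>\<rho>\<close> in the product eigenbasis of \<open>\<sigma>\<close> also gives independent
  letters. Full support makes every eigenvalue of \<open>\<sigma>\<close> positive, so its logarithm
  is a genuine random variable.

  The image of \<open>\<sigma>\<^sub>1\<close> can be hit exactly because domination of the prepared
  state leaves a positive remainder to prepare on rejection. The limit does not depend on
  \<open>\<epsilon>\<close> because the smoothing error is chosen after \<open>\<epsilon>\<close>,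
  small against the acceptance probability that \<open>\<epsilon>\<close> still guarantees. The
  purified distance needs only two comparisons: with the trace distance from above
  (Powers-Stoermer), and with tests through the fidelity.\<close>

lemma dim_adj [simp]: "dim_row (adj A) = dim_col A" "dim_col (adj A) = dim_row A"
  by (simp_all add: adj_def)

lemma adj_carrier [simp, intro]: "A \<in> carrier_mat n m \<Longrightarrow> adj A \<in> carrier_mat m n"
  by (auto intro: carrier_matI)

lemma index_adj [simp]: "i < dim_col A \<Longrightarrow> j < dim_row A \<Longrightarrow> adj A $$ (i, j) = cnj (A $$ (j, i))"
  by (simp add: adj_def)

lemma adj_adj [simp]: "adj (adj A) = A"
  by (rule eq_matI) auto

lemma index_mult_sum:
  "i < dim_row A \<Longrightarrow> j < dim_col B \<Longrightarrow> dim_col A = dim_row B \<Longrightarrow>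
   (A * B) $$ (i, j) = (\<Sum>k<dim_row B. A $$ (i, k) * B $$ (k, j))"
  by (simp add: scalar_prod_def lessThan_atLeast0)

lemma adj_mult:
  assumes "dim_col A = dim_row B"
  shows "adj (A * B) = adj B * adj A"
proof (rule eq_matI)
  fix i j assume "i < dim_row (adj B * adj A)" "j < dim_col (adj B * adj A)"
  then show "adj (A * B) $$ (i, j) = (adj B * adj A) $$ (i, j)"
    using assms by (simp add: index_mult_sum mult.commute del: index_mult_mat(1))
qed (use assms in auto)

lemma adj_add: "dim_row A = dim_row B \<Longrightarrow> dim_col A = dim_col B \<Longrightarrow> adj (A + B) = adj A + adj B"
  by (rule eq_matI) auto

lemma adj_minus: "dim_row A = dim_row B \<Longrightarrow> dim_col A = dim_col B \<Longrightarrow> adj (A - B) = adj A - adj B"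
  for A B :: "complex mat"
  by (rule eq_matI) auto

lemma adj_smult: "adj (c \<cdot>\<^sub>m A) = cnj c \<cdot>\<^sub>m adj A"
  by (rule eq_matI) auto

lemma adj_one [simp]: "adj (1\<^sub>m n) = 1\<^sub>m n"
  by (rule eq_matI) auto

lemma mult_assoc_mat:
  "dim_col A = dim_row B \<Longrightarrow> dim_col B = dim_row C \<Longrightarrow> A * B * C = A * (B * C)"
  for A B C :: "complex mat"
  by (rule assoc_mult_mat[of _ "dim_row A" "dim_row B" _ "dim_row C" _ "dim_col C"]) auto

lemma mult_add_mat:
  "dim_col A = dim_row B \<Longrightarrow> dim_row B = dim_row C \<Longrightarrow> dim_col B = dim_col C \<Longrightarrow> A * (B + C) = A * B + A * C"
  for A B C :: "complex mat"
  by (rule mult_add_distrib_mat[of _ "dim_row A" "dim_row B" _ "dim_col B"]) auto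

lemma add_mult_mat:
  "dim_col A = dim_row C \<Longrightarrow> dim_row A = dim_row B \<Longrightarrow> dim_col A = dim_col B \<Longrightarrow> (A + B) * C = A * C + B * C"
  for A B C :: "complex mat"
  by (rule add_mult_distrib_mat[of _ "dim_row A" "dim_col A" _ _ "dim_col C"]) auto

lemma mult_minus_mat:
  "dim_col A = dim_row B \<Longrightarrow> dim_row B = dim_row C \<Longrightarrow> dim_col B = dim_col C \<Longrightarrow> A * (B - C) = A * B - A * C"
  for A B C :: "complex mat"
  by (rule mult_minus_distrib_mat[of _ "dim_row A" "dim_row B" _ "dim_col B"]) auto

lemma minus_mult_mat:
  "dim_col A = dim_row C \<Longrightarrow> dim_row A = dim_row B \<Longrightarrow> dim_col A = dim_col B \<Longrightarrow> (A - B) * C = A * C - B * C"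
  for A B C :: "complex mat"
  by (rule minus_mult_distrib_mat[of _ "dim_row A" "dim_col A" _ _ "dim_col C"]) auto

lemma smult_mult_mat: "dim_col A = dim_row B \<Longrightarrow> (c \<cdot>\<^sub>m A) * B = c \<cdot>\<^sub>m (A * B)"
  "dim_col A = dim_row B \<Longrightarrow> A * (c \<cdot>\<^sub>m B) = c \<cdot>\<^sub>m (A * B)"
  for A B :: "complex mat"
  by (auto intro: mult_smult_assoc_mat[of _ "dim_row A" "dim_col A" _ "dim_col B"]
      mult_smult_distrib[of _ "dim_row A" "dim_col A" _ "dim_col B"])

lemma one_mult_mat [simp]: "dim_row A = n \<Longrightarrow> 1\<^sub>m n * A = A" "dim_col A = n \<Longrightarrow> A * 1\<^sub>m n = A"
  for A :: "complex mat"
  by (auto intro: left_mult_one_mat' right_mult_one_mat')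

section \<open>Trace and Frobenius norm\<close>

lemma mtrace_add: "dim_row A = dim_row B \<Longrightarrow> dim_col A = dim_row A \<Longrightarrow> dim_col B = dim_row B \<Longrightarrow>
    mtrace (A + B) = mtrace A + mtrace B"
  by (simp add: mtrace_def sum.distrib)

lemma mtrace_minus: "dim_row A = dim_row B \<Longrightarrow> dim_col A = dim_row A \<Longrightarrow> dim_col B = dim_row B \<Longrightarrow>
    mtrace (A - B) = mtrace A - mtrace B"
  by (simp add: mtrace_def sum_subtractf)

lemma mtrace_smult: "dim_col A = dim_row A \<Longrightarrow> mtrace (c \<cdot>\<^sub>m A) = c * mtrace A"
  by (simp add: mtrace_def sum_distrib_left)

lemma mtrace_mult:
  assumes "dim_row A = dim_col B" "dim_col A = dim_row B"
  shows "mtrace (A * B) = (\<Sum>i<dim_row A. \<Sum>k<dim_row B. A $$ (i, k) * B $$ (k, i))"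
  using assms by (simp add: mtrace_def index_mult_sum del: index_mult_mat(1))

lemma mtrace_comm:
  assumes "dim_row A = dim_col B" "dim_col A = dim_row B"
  shows "mtrace (A * B) = mtrace (B * A)"
  unfolding mtrace_mult[OF assms] mtrace_mult[OF assms(2,1)[symmetric]]
  by (subst sum.swap) (use assms in \<open>simp add: mult.commute\<close>)

lemma mtrace_adj: "dim_col A = dim_row A \<Longrightarrow> mtrace (adj A) = cnj (mtrace A)"
  by (simp add: mtrace_def)

lemma cnj_mult_self: "z * cnj z = of_real ((cmod z)\<^sup>2)" "cnj z * z = of_real ((cmod z)\<^sup>2)"
  using complex_norm_square[of z] by (simp_all add: mult.commute)

text \<open>The Hilbert-Schmidt norm, encoded through \<open>L2_set\<close> over index pairs so that
  Cauchy-Schwarz and the triangle inequality are inherited.\<close>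

definition fro :: "complex mat \<Rightarrow> real" where
  "fro A = L2_set (\<lambda>(i, j). cmod (A $$ (i, j))) ({..<dim_row A} \<times> {..<dim_col A})"

lemma fro_nonneg [simp]: "0 \<le> fro A"
  by (simp add: fro_def)

lemma fro_sum: "(fro A)\<^sup>2 = (\<Sum>i<dim_row A. \<Sum>j<dim_col A. (cmod (A $$ (i, j)))\<^sup>2)"
  by (simp add: fro_def L2_set_def sum_nonneg sum.cartesian_product case_prod_unfold)

lemma fro_sq: "mtrace (adj A * A) = of_real ((fro A)\<^sup>2)"
proof -
  have "mtrace (adj A * A) = (\<Sum>i<dim_col A. \<Sum>k<dim_row A. of_real ((cmod (A $$ (k, i)))\<^sup>2))"
    by (subst mtrace_mult) (auto simp: cnj_mult_self simp del: of_real_power)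
  then show ?thesis
    by (subst fro_sum, subst sum.swap) simp
qed

lemma fro_adj [simp]: "fro (adj A) = fro A"
proof -
  have "(fro (adj A))\<^sup>2 = (fro A)\<^sup>2"
    unfolding fro_sum by (subst sum.swap) simp
  then show ?thesis by simp
qed

lemma fro_sq': "mtrace (A * adj A) = of_real ((fro A)\<^sup>2)"
  using fro_sq[of "adj A"] by simp

lemma fro_cauchy_schwarz:
  assumes "dim_row A = dim_row B" "dim_col A = dim_col B"
  shows "cmod (mtrace (adj A * B)) \<le> fro A * fro B"
proof -
  let ?I = "{..<dim_row A} \<times> {..<dim_col A}"
  have "mtrace (adj A * B) = (\<Sum>(i,j)\<in>?I. cnj (A $$ (i, j)) * B $$ (i, j))"
    using assms by (subst mtrace_mult, simp, simp, subst sum.swap)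
      (simp add: sum.cartesian_product case_prod_unfold)
  also have "cmod \<dots> \<le> (\<Sum>x\<in>?I. \<bar>cmod (A $$ x)\<bar> * \<bar>cmod (B $$ x)\<bar>)"
    by (rule sum_norm_le) (auto simp: norm_mult)
  also have "\<dots> \<le> L2_set (\<lambda>x. cmod (A $$ x)) ?I * L2_set (\<lambda>x. cmod (B $$ x)) ?I"
    by (rule L2_set_mult_ineq)
  finally show ?thesis
    using assms by (simp add: fro_def case_prod_unfold)
qed

lemma fro_triangle:
  assumes "dim_row A = dim_row B" "dim_col A = dim_col B"
  shows "fro (A + B) \<le> fro A + fro B"
proof -
  let ?I = "{..<dim_row A} \<times> {..<dim_col A}"
  have "fro (A + B) \<le> L2_set (\<lambda>x. cmod (A $$ x) + cmod (B $$ x)) ?I"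
    unfolding fro_def using assms by (auto intro!: L2_set_mono norm_triangle_ineq)
  also have "\<dots> \<le> fro A + fro B"
    using L2_set_triangle_ineq[of "\<lambda>x. cmod (A $$ x)" "\<lambda>x. cmod (B $$ x)" ?I] assms
    by (simp add: fro_def case_prod_unfold)
  finally show ?thesis .
qed

section \<open>Spectral theorem\<close>

text \<open>The frame \<open>U\<close> is kept as a parameter: for a fixed unitary \<open>U\<close>,
  products, differences and scalings act pointwise on \<open>l\<close>.\<close>

definition udiag :: "nat \<Rightarrow> complex mat \<Rightarrow> (nat \<Rightarrow> real) \<Rightarrow> complex mat" where
  "udiag n U l = U * mat_diag n (\<lambda>i. complex_of_real (l i)) * adj U"

lemma dim_mat_diag [simp]: "dim_row (mat_diag n f) = n" "dim_col (mat_diag n f) = n"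
  by (simp_all add: mat_diag_def)

lemma adj_mat_diag_real [simp]:
  "adj (mat_diag n (\<lambda>i. complex_of_real (l i))) = mat_diag n (\<lambda>i. complex_of_real (l i))"
  by (rule eq_matI) (auto simp: mat_diag_def)

lemma unitaryD:
  assumes "unitary n U"
  shows "U \<in> carrier_mat n n" "dim_row U = n" "dim_col U = n"
    "U * adj U = 1\<^sub>m n" "adj U * U = 1\<^sub>m n"
  using assms by (auto simp: unitary_def)

lemma unitary_cancel:
  assumes "unitary n U" "dim_row X = n"
  shows "U * (adj U * X) = X" "adj U * (U * X) = X"
  using unitaryD[OF assms(1)] assms(2)
  by (simp_all add: mult_assoc_mat[symmetric])

lemma unitary_one: "unitary n (1\<^sub>m n)"
  by (simp add: unitary_def)

lemma unitary_mult: "unitary n U \<Longrightarrow> unitary n V \<Longrightarrow> unitary n (U * V)"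
  unfolding unitary_def
  by (auto simp: adj_mult mult_assoc_mat intro!: unitary_cancel)
     (simp_all add: mult_assoc_mat[symmetric])

lemma unitary_adj: "unitary n U \<Longrightarrow> unitary n (adj U)"
  by (simp add: unitary_def)

text \<open>Gram-Schmidt leaves the first vector of its input unchanged, so a basis completed from
  \<open>v\<close> still starts with \<open>v\<close> after orthogonalisation; normalising only
  rescales it.\<close>

lemma unitary_with_first_column:
  fixes v :: "complex vec"
  assumes v: "v \<in> carrier_vec n" and v0: "v \<noteq> 0\<^sub>v n"
  obtains U c where "unitary n U" "col U 0 = c \<cdot>\<^sub>v v" 
proof -
  interpret cof_vec_space n "TYPE(complex)" .
  define b where "b = basis_completion v"
  define ws where "ws = gram_schmidt n b"
  from basis_completion[OF v v0, folded b_def]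
  have dist_b: "distinct b" and indep: "\<not> lin_dep (set b)" and b: "set b \<subseteq> carrier_vec n"
    and hdb: "hd b = v" and len_b: "length b = n" by auto
  have n: "n > 0" using v v0 by (cases n) auto
  obtain vs where bv: "b = v # vs" using hdb len_b n by (cases b) auto
  from gram_schmidt_result[OF b dist_b indep refl, folded ws_def]
  have ws: "set ws \<subseteq> carrier_vec n" "corthogonal ws" "length ws = n"
    by (auto simp: len_b)
  have hdws: "hd ws = v" using gram_schmidt_hd[OF v, of vs, folded bv] unfolding ws_def .
  have wsn: "ws ! j \<in> carrier_vec n" if "j < n" for j
    using ws that by (metis nth_mem subsetD)
  \<comment> \<open>Squared lengths: the Gram-Schmidt vectors are orthogonal but not normalised, so
    the columns of \<open>U\<close> are divided by the square roots.\<close>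
  define N where "N j = (\<Sum>k<n. (cmod (ws ! j $ k))\<^sup>2)" for j
  have sp: "(ws ! i) \<bullet>c (ws ! j) = (\<Sum>k<n. ws ! i $ k * cnj (ws ! j $ k))" if "i < n" "j < n" for i j
    using wsn[OF that(1)] wsn[OF that(2)] by (simp add: scalar_prod_def lessThan_atLeast0)
  have NN: "(\<Sum>k<n. ws ! i $ k * cnj (ws ! i $ k)) = of_real (N i)" for i
    by (simp add: N_def cnj_mult_self del: of_real_power)
  have orth: "(\<Sum>k<n. ws ! i $ k * cnj (ws ! j $ k)) = 0" if "i < n" "j < n" "i \<noteq> j" for i j
    using corthogonalD[OF ws(2), of i j] that sp[OF that(1,2)] ws(3) by auto
  have Npos: "N i > 0" if "i < n" for i
  proof -
    have "of_real (N i) \<noteq> (0 :: complex)"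
      using corthogonalD[OF ws(2), of i i] that sp[OF that that] ws(3) NN by auto
    moreover have "N i \<ge> 0" by (simp add: N_def sum_nonneg)
    ultimately show ?thesis by auto
  qed
  define U where "U = mat n n (\<lambda>(i, j). of_real (1 / sqrt (N j)) * (ws ! j $ i))"
  have U: "U \<in> carrier_mat n n" by (simp add: U_def)
  have UU: "adj U * U = 1\<^sub>m n"
  proof (rule eq_matI)
    fix i j assume "i < dim_row (1\<^sub>m n :: complex mat)" "j < dim_col (1\<^sub>m n :: complex mat)"
    then have ij: "i < n" "j < n" by auto
    have "(adj U * U) $$ (i, j) = of_real (1 / sqrt (N i)) * of_real (1 / sqrt (N j)) *
        (\<Sum>k<n. ws ! j $ k * cnj (ws ! i $ k))"
      using ij by (subst index_mult_sum) (auto simp: U_def sum_distrib_left mult_ac)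
    also have "\<dots> = 1\<^sub>m n $$ (i, j)"
    proof (cases "i = j")
      case True
      have "complex_of_real (1 / sqrt (N i)) * of_real (1 / sqrt (N i)) * of_real (N i) = 1"
        using Npos[OF ij(1)] unfolding of_real_mult[symmetric] by simp
      then show ?thesis using True ij by (simp only: NN) simp
    next
      case False
      then show ?thesis using orth[of j i] ij by simp
    qed
    finally show "(adj U * U) $$ (i, j) = 1\<^sub>m n $$ (i, j)" .
  qed (auto simp: U_def)
  have "U * adj U = 1\<^sub>m n"
    by (rule mat_mult_left_right_inverse[OF adj_carrier[OF U] U UU])
  then have "unitary n U" using U UU by (simp add: unitary_def)
  moreover have "col U 0 = of_real (1 / sqrt (N 0)) \<cdot>\<^sub>v v"
  proof -
    have "ws ! 0 = v" using hdws ws(3) n by (cases ws) auto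
    then show ?thesis using n v by (intro eq_vecI) (auto simp: U_def)
  qed
  ultimately show ?thesis by (rule that)
qed

lemma unitary_four_block:
  assumes "unitary n V"
  shows "unitary (Suc n) (four_block_mat (1\<^sub>m 1) (0\<^sub>m 1 n) (0\<^sub>m n 1) V)"
    (is "unitary _ ?W")
proof -
  have V: "V \<in> carrier_mat n n" "adj V \<in> carrier_mat n n" using assms by (auto simp: unitary_def)
  have adjW: "adj ?W = four_block_mat (1\<^sub>m 1) (0\<^sub>m 1 n) (0\<^sub>m n 1) (adj V)"
    using V by (intro eq_matI) auto
  have W: "?W \<in> carrier_mat (Suc n) (Suc n)"
    by (rule carrier_matI) (use V in auto)
  show ?thesis
    unfolding unitary_def adjW
  proof (intro conjI)
    show "?W * four_block_mat (1\<^sub>m 1) (0\<^sub>m 1 n) (0\<^sub>m n 1) (adj V) = 1\<^sub>m (Suc n)"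
      by (subst mult_four_block_mat) (use V assms in \<open>auto simp: unitary_def intro!: eq_matI\<close>)
    show "four_block_mat (1\<^sub>m 1) (0\<^sub>m 1 n) (0\<^sub>m n 1) (adj V) * ?W = 1\<^sub>m (Suc n)"
      by (subst mult_four_block_mat) (use V assms in \<open>auto simp: unitary_def intro!: eq_matI\<close>)
  qed (use W in simp)
qed

text \<open>Induction on the dimension: rotating an eigenvector to the first basis vector splits off
  a one-by-one block, and what remains is again Hermitian.\<close>

theorem spectral_theorem:
  assumes "A \<in> carrier_mat n n" "adj A = A"
  obtains U l where "unitary n U" "A = udiag n U l"
proof -
  have "\<exists>U l. unitary n U \<and> A = udiag n U l" using assms
  proof (induction n arbitrary: A)
    case 0
    have "unitary 0 (1\<^sub>m 0)" by (rule unitary_one)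
    moreover have "A = udiag 0 (1\<^sub>m 0) (\<lambda>_. 0)"
      using 0 by (intro eq_matI) (auto simp: udiag_def)
    ultimately show ?case by blast
  next
    case (Suc n)
    note A = Suc.prems(1)
    obtain e where "eigenvalue A e"
      using spectrum_non_empty[OF A] by (auto simp: spectrum_def)
    then obtain v where v: "v \<in> carrier_vec (Suc n)" "v \<noteq> 0\<^sub>v (Suc n)" and ev: "A *\<^sub>v v = e \<cdot>\<^sub>v v"
      using A by (auto simp: eigenvalue_def eigenvector_def)
    obtain U c where U: "unitary (Suc n) U" and col: "col U 0 = c \<cdot>\<^sub>v v"
      using unitary_with_first_column[OF v] .
    note Ud = unitaryD[OF U]
    define B where "B = adj U * A * U"
    have B: "B \<in> carrier_mat (Suc n) (Suc n)" using A Ud by (auto simp: B_def)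
    have adjB: "adj B = B"
      using A Ud Suc.prems(2) by (simp add: B_def adj_mult mult_assoc_mat)
    have AB: "A = U * B * adj U"
      using A Ud by (simp add: B_def mult_assoc_mat unitary_cancel[OF U])
    have "A *\<^sub>v col U 0 = e \<cdot>\<^sub>v col U 0"
      unfolding col using A v ev
      by (simp add: mult_mat_vec smult_smult_assoc mult.commute)
    moreover have "col (A * U) 0 = A *\<^sub>v col U 0"
      using A Ud by (intro col_mult2) auto
    ultimately have colAU: "col (A * U) 0 = e \<cdot>\<^sub>v col U 0" by simp
    have B0: "B $$ (i, 0) = (if i = 0 then e else 0)" if "i < Suc n" for i
    proof -
      have "B $$ (i, 0) = row (adj U) i \<bullet> col (A * U) 0"
        using that A Ud by (simp add: B_def mult_assoc_mat)
      also have "\<dots> = e * (row (adj U) i \<bullet> col U 0)"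
        unfolding colAU using that Ud by (subst scalar_prod_smult_distrib[of _ "Suc n"]) (auto intro!: carrier_vecI)
      also have "row (adj U) i \<bullet> col U 0 = (adj U * U) $$ (i, 0)"
        using that Ud by (subst index_mult_mat) auto
      also have "e * \<dots> = (if i = 0 then e else 0)"
        unfolding Ud(5) using that by auto
      finally show ?thesis .
    qed
    \<comment> \<open>Hermiticity of \<open>B\<close> does two jobs: it makes the corner entry
      \<open>e\<close> real, and it clears the first row once the first column is known.\<close>
    have sym: "B $$ (i, j) = cnj (B $$ (j, i))" if "i < Suc n" "j < Suc n" for i j
      using index_adj[of i B j] that B unfolding adjB by auto
    have e: "e = of_real (Re e)"
      using sym[of 0 0] B0[of 0] by (auto simp: complex_eq_iff)
    define A' where "A' = mat n n (\<lambda>(i, j). B $$ (Suc i, Suc j))"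
    have A': "A' \<in> carrier_mat n n" by (simp add: A'_def)
    have "adj A' = A'"
      by (rule eq_matI) (auto simp: A'_def intro: sym[symmetric])
    from Suc.IH[OF A' this] obtain V l where V: "unitary n V" and AV: "A' = udiag n V l"
      by blast
    have Bblock: "B = four_block_mat (mat 1 1 (\<lambda>_. e)) (0\<^sub>m 1 n) (0\<^sub>m n 1) A'"
    proof (rule eq_matI)
      fix i j assume "i < dim_row (four_block_mat (mat 1 1 (\<lambda>_. e)) (0\<^sub>m 1 n) (0\<^sub>m n 1) A')"
        "j < dim_col (four_block_mat (mat 1 1 (\<lambda>_. e)) (0\<^sub>m 1 n) (0\<^sub>m n 1) A')"
      then have ij: "i < Suc n" "j < Suc n" by (auto simp: A'_def)
      show "B $$ (i, j) = four_block_mat (mat 1 1 (\<lambda>_. e)) (0\<^sub>m 1 n) (0\<^sub>m n 1) A' $$ (i, j)"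
        using ij B0[OF ij(1)] sym[OF ij] B0[OF ij(2)]
        by (cases i; cases j) (auto simp: A'_def)
    qed (use B in \<open>auto simp: A'_def\<close>)
    define W where "W = four_block_mat (1\<^sub>m 1) (0\<^sub>m 1 n) (0\<^sub>m n 1) V"
    have W: "unitary (Suc n) W" unfolding W_def by (rule unitary_four_block[OF V])
    define l' where "l' i = (case i of 0 \<Rightarrow> Re e | Suc k \<Rightarrow> l k)" for i
    have Vd: "V \<in> carrier_mat n n" "adj V \<in> carrier_mat n n" using V by (auto simp: unitary_def)
    have adjW: "adj W = four_block_mat (1\<^sub>m 1) (0\<^sub>m 1 n) (0\<^sub>m n 1) (adj V)"
      unfolding W_def using Vd by (intro eq_matI) auto
    have D: "mat_diag (Suc n) (\<lambda>i. complex_of_real (l' i)) =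
        four_block_mat (mat 1 1 (\<lambda>_. e)) (0\<^sub>m 1 n) (0\<^sub>m n 1) (mat_diag n (\<lambda>i. complex_of_real (l i)))"
      using e by (intro eq_matI) (auto simp: mat_diag_def l'_def split: nat.splits)
    have "B = udiag (Suc n) W l'"
      unfolding udiag_def adjW unfolding W_def D Bblock AV[unfolded udiag_def]
      using Vd by (subst mult_four_block_mat[of _ 1 1 _ n _ n _ _ 1 _ n],
          auto intro!: mult_carrier_mat[of _ n n])
        (subst mult_four_block_mat[of _ 1 1 _ n _ n _ _ 1 _ n],
          auto intro!: mult_carrier_mat[of _ n n] cong_four_block_mat)
    then have "A = udiag (Suc n) (U * W) l'"
      unfolding AB using Ud unitaryD[OF W] by (simp add: udiag_def adj_mult mult_assoc_mat)
    then show ?case using unitary_mult[OF U W] by blast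
  qed
  then show ?thesis using that by blast
qed

section \<open>Positive semidefinite matrices\<close>

text \<open>Writing a vector as a one-column matrix moves quadratic forms into the calculus of
  traces, where adjoints, associativity and cyclicity do the work.\<close>

lemma qform_eq_mtrace:
  assumes "A \<in> carrier_mat n n" "v \<in> carrier_vec n"
  shows "qform A v = mtrace (adj (mat n 1 (\<lambda>(i, j). v $ i)) * A * mat n 1 (\<lambda>(i, j). v $ i))"
proof -
  let ?V = "mat n 1 (\<lambda>(i, j). v $ i)"
  have "mtrace (adj ?V * A * ?V) = mtrace (adj ?V * (A * ?V))"
    using assms by (simp add: mult_assoc_mat)
  also have "\<dots> = (\<Sum>i<n. cnj (v $ i) * (\<Sum>j<n. A $$ (i, j) * v $ j))"
    using assms by (subst mtrace_mult) (auto simp: index_mult_sum simp del: index_mult_mat(1))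
  finally show ?thesis
    using assms by (simp add: qform_def sum_distrib_left mult.assoc)
qed

lemma psd_iff_mtrace:
  "psd n A \<longleftrightarrow> A \<in> carrier_mat n n \<and> adj A = A \<and>
     (\<forall>V\<in>carrier_mat n 1. 0 \<le> Re (mtrace (adj V * A * V)))"
proof -
  have V: "mat n 1 (\<lambda>(i, j). col V 0 $ i) = V" if "V \<in> carrier_mat n 1" for V :: "complex mat"
    using that by (intro eq_matI) auto
  have col: "col V 0 \<in> carrier_vec n" if "V \<in> carrier_mat n 1" for V :: "complex mat"
    using that by (auto intro: carrier_vecI)
  have "Re (mtrace (adj V * A * V)) = Re (qform A (col V 0))"
    if "V \<in> carrier_mat n 1" "A \<in> carrier_mat n n" for V
    using qform_eq_mtrace[OF that(2) col[OF that(1)]] V[OF that(1)] by simp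
  then have "(\<forall>v\<in>carrier_vec n. 0 \<le> Re (qform A v)) \<longleftrightarrow>
      (\<forall>V\<in>carrier_mat n 1. 0 \<le> Re (mtrace (adj V * A * V)))" if "A \<in> carrier_mat n n"
    using that col qform_eq_mtrace[OF that] mat_carrier[of n 1] by metis
  then show ?thesis unfolding psd_def by blast
qed

lemma psd_carrier [simp]:
  assumes "psd n A"
  shows "A \<in> carrier_mat n n" "dim_row A = n" "dim_col A = n"
  using assms by (auto simp: psd_def)

lemma psd_adj: "psd n A \<Longrightarrow> adj A = A"
  by (simp add: psd_def)

lemma psd_gram: "B \<in> carrier_mat m n \<Longrightarrow> psd n (adj B * B)"
proof (unfold psd_iff_mtrace, intro conjI ballI)
  fix V :: "complex mat" assume B: "B \<in> carrier_mat m n" and V: "V \<in> carrier_mat n 1"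
  have "adj V * (adj B * B) * V = adj (B * V) * (B * V)"
    using B V by (simp add: adj_mult mult_assoc_mat)
  then show "0 \<le> Re (mtrace (adj V * (adj B * B) * V))"
    by (simp add: fro_sq del: of_real_power)
qed (auto simp: adj_mult)

lemma psd_add: "psd n A \<Longrightarrow> psd n B \<Longrightarrow> psd n (A + B)"
  unfolding psd_iff_mtrace
  by (auto simp: adj_add mult_add_mat add_mult_mat mtrace_add)

lemma psd_smult: "psd n A \<Longrightarrow> 0 \<le> c \<Longrightarrow> psd n (complex_of_real c \<cdot>\<^sub>m A)"
  unfolding psd_iff_mtrace
  by (auto simp: adj_smult smult_mult_mat mtrace_smult)

lemma psd_one: "psd n (1\<^sub>m n)"
  using psd_gram[of "1\<^sub>m n" n n] by simp

lemma psd_conj_adj: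
  assumes "psd n A" "C \<in> carrier_mat n m"
  shows "psd m (adj C * A * C)"
  unfolding psd_iff_mtrace
proof (intro conjI ballI)
  have A: "A \<in> carrier_mat n n" "adj A = A" using assms by (auto simp: psd_def)
  fix V :: "complex mat" assume V: "V \<in> carrier_mat m 1"
  have "adj V * (adj C * A * C) * V = adj (C * V) * A * (C * V)"
    using A V assms by (simp add: adj_mult mult_assoc_mat)
  moreover have "C * V \<in> carrier_mat n 1" using assms V by simp
  ultimately show "0 \<le> Re (mtrace (adj V * (adj C * A * C) * V))"
    using assms(1) unfolding psd_iff_mtrace by metis
qed (use assms in \<open>auto simp: adj_mult mult_assoc_mat psd_adj\<close>)

lemma index_gram_diag:
  "i < dim_col Q \<Longrightarrow> (adj Q * Q) $$ (i, i) = of_real (\<Sum>k<dim_row Q. (cmod (Q $$ (k, i)))\<^sup>2)"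
  by (simp add: index_mult_sum cnj_mult_self del: of_real_power index_mult_mat(1))

section \<open>Matrices diagonal in a fixed orthonormal basis\<close>

lemma dim_udiag [simp]: "dim_row (udiag n U l) = dim_row U" "dim_col (udiag n U l) = dim_row U"
  by (simp_all add: udiag_def)

lemma udiag_carrier [simp]: "unitary n U \<Longrightarrow> udiag n U l \<in> carrier_mat n n"
  by (rule carrier_matI) (simp_all add: unitaryD)

lemma adj_udiag [simp]: "unitary n U \<Longrightarrow> adj (udiag n U l) = udiag n U l"
  by (simp add: udiag_def adj_mult mult_assoc_mat unitaryD)

lemma udiag_cong: "(\<And>i. i < n \<Longrightarrow> l i = k i) \<Longrightarrow> udiag n U l = udiag n U k"
  unfolding udiag_def mat_diag_def by (rule arg_cong2[where f = "(*)"], rule arg_cong2[where f = "(*)"]) auto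

lemma udiag_mult:
  assumes "unitary n U"
  shows "udiag n U l * udiag n U k = udiag n U (\<lambda>i. l i * k i)"
proof -
  have "udiag n U l * udiag n U k =
      U * ((mat_diag n (\<lambda>i. complex_of_real (l i)) * mat_diag n (\<lambda>i. complex_of_real (k i))) * adj U)"
    using unitaryD[OF assms]
    by (simp add: udiag_def mult_assoc_mat unitary_cancel[OF assms] del: mat_diag_diag)
  then show ?thesis
    using unitaryD[OF assms] by (simp add: udiag_def mult_assoc_mat)
qed

lemma udiag_one: "unitary n U \<Longrightarrow> udiag n U (\<lambda>_. 1) = 1\<^sub>m n"
  by (simp add: udiag_def unitaryD)

lemma udiag_minus:
  assumes "unitary n U"
  shows "udiag n U l - udiag n U k = udiag n U (\<lambda>i. l i - k i)"
proof -
  have "mat_diag n (\<lambda>i. complex_of_real (l i - k i)) =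
      mat_diag n (\<lambda>i. complex_of_real (l i)) - mat_diag n (\<lambda>i. complex_of_real (k i))"
    by (rule eq_matI) (auto simp: mat_diag_def)
  then show ?thesis
    using unitaryD[OF assms] by (simp add: udiag_def mult_minus_mat minus_mult_mat)
qed

lemma udiag_smult:
  assumes "unitary n U"
  shows "complex_of_real c \<cdot>\<^sub>m udiag n U l = udiag n U (\<lambda>i. c * l i)"
proof -
  have "mat_diag n (\<lambda>i. complex_of_real (c * l i)) =
      complex_of_real c \<cdot>\<^sub>m mat_diag n (\<lambda>i. complex_of_real (l i))"
    by (rule eq_matI) (auto simp: mat_diag_def)
  then show ?thesis
    using unitaryD[OF assms] by (simp add: udiag_def smult_mult_mat)
qed

lemma index_mat_diag_mult:
  "i < n \<Longrightarrow> j < dim_col X \<Longrightarrow> dim_row X = n \<Longrightarrow> (mat_diag n f * X) $$ (i, j) = f i * X $$ (i, j)"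
  by (subst mat_diag_mult_left[of _ _ "dim_col X"]) auto

text \<open>Only the diagonal of \<open>X\<close> in the basis \<open>U\<close> survives. For a
  density \<open>X\<close> these entries are the outcome probabilities of measuring in that
  basis.\<close>

lemma mtrace_udiag_mult:
  assumes "unitary n U" "X \<in> carrier_mat n n"
  shows "mtrace (udiag n U l * X) = (\<Sum>i<n. of_real (l i) * (adj U * X * U) $$ (i, i))"
proof -
  note U = unitaryD[OF assms(1)]
  have "mtrace (udiag n U l * X) = mtrace (U * (mat_diag n (\<lambda>i. complex_of_real (l i)) * (adj U * X)))"
    using U assms(2) by (simp add: udiag_def mult_assoc_mat)
  also have "\<dots> = mtrace (mat_diag n (\<lambda>i. complex_of_real (l i)) * (adj U * X * U))"
    using U assms(2) by (subst mtrace_comm) (auto simp: mult_assoc_mat)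
  also have "\<dots> = (\<Sum>i<n. of_real (l i) * (adj U * X * U) $$ (i, i))"
    unfolding mtrace_def using U assms(2)
    by (auto simp: index_mat_diag_mult simp del: index_mult_mat(1) intro!: sum.cong)
  finally show ?thesis .
qed

lemma mtrace_udiag:
  assumes "unitary n U"
  shows "mtrace (udiag n U l) = of_real (\<Sum>i<n. l i)"
  using mtrace_udiag_mult[OF assms, of "1\<^sub>m n" l] unitaryD[OF assms]
  by (simp add: assms)

lemma psd_udiag:
  assumes "unitary n U" "\<And>i. i < n \<Longrightarrow> 0 \<le> l i"
  shows "psd n (udiag n U l)"
proof -
  have "udiag n U l = adj (udiag n U (\<lambda>i. sqrt (l i))) * udiag n U (\<lambda>i. sqrt (l i))"
    using assms by (simp add: udiag_mult cong: udiag_cong)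
  also have "psd n \<dots>" using assms by (intro psd_gram[of _ n]) auto
  finally show ?thesis .
qed

lemma psd_diag_nonneg:
  assumes "psd n A" "i < n"
  shows "0 \<le> Re (A $$ (i, i))"
proof -
  define V :: "complex mat" where "V = mat n 1 (\<lambda>(k, j). if k = i then 1 else 0)"
  have V: "V \<in> carrier_mat n 1" by (simp add: V_def)
  have "mtrace (adj V * A * V) = mtrace (adj V * (A * V))"
    using V assms by (simp add: mult_assoc_mat)
  also have "\<dots> = (\<Sum>k<n. cnj (V $$ (k, 0)) * (\<Sum>j<n. A $$ (k, j) * V $$ (j, 0)))"
    using assms V by (subst mtrace_mult) (auto simp: index_mult_sum simp del: index_mult_mat(1))
  also have "\<dots> = (\<Sum>k<n. if k = i then (\<Sum>j<n. if j = i then A $$ (i, i) else 0) else 0)"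
    by (intro sum.cong refl) (auto simp: V_def if_distrib[of "\<lambda>x. _ * x"] cong: if_cong)
  also have "\<dots> = A $$ (i, i)" using assms(2) by simp
  finally show ?thesis using assms(1) V unfolding psd_iff_mtrace by metis
qed

lemma adj_udiag_cancel:
  assumes "unitary n U"
  shows "adj U * udiag n U l * U = mat_diag n (\<lambda>i. complex_of_real (l i))"
  using unitaryD[OF assms] by (simp add: udiag_def mult_assoc_mat unitary_cancel[OF assms])

lemma psd_udiag_nonneg:
  assumes "unitary n U" "psd n (udiag n U l)" "i < n"
  shows "0 \<le> l i"
  using psd_diag_nonneg[OF psd_conj_adj[OF assms(2) unitaryD(1)[OF assms(1)]] assms(3)] assms(3)
  unfolding adj_udiag_cancel[OF assms(1)] by (simp add: mat_diag_def)

text \<open>The spectral theorem shows that the choice inside \<open>mat_fun\<close> picks a genuine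
  decomposition. The choice does not mention \<open>f\<close>, so one pair \<open>U\<close>,
  \<open>l\<close> serves all functions of \<open>A\<close> at once.\<close>

lemma mat_fun_spectral:
  assumes "A \<in> carrier_mat n n" "adj A = A"
  obtains U l where "unitary n U" "A = udiag n U l" "\<And>f. mat_fun f A = udiag n U (\<lambda>i. f (l i))"
proof -
  let ?P = "\<lambda>p. unitary n (fst p) \<and>
     A = fst p * mat_diag n (\<lambda>i. complex_of_real (snd p i)) * adj (fst p)"
  obtain U l where "unitary n U" "A = udiag n U l" using spectral_theorem[OF assms] .
  then have "?P (U, l)" by (simp add: udiag_def)
  then have "?P (Eps ?P)" by (rule someI)
  moreover have "mat_fun f A = udiag n (fst (Eps ?P)) (\<lambda>i. f (snd (Eps ?P) i))" for f
    using assms(1) unfolding mat_fun_def Let_def udiag_def by simp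
  ultimately show ?thesis using that unfolding udiag_def by blast
qed

lemma msqrt_psd:
  assumes "psd n A"
  shows "psd n (msqrt A)" "msqrt A * msqrt A = A"
proof -
  obtain U l where U: "unitary n U" and A: "A = udiag n U l"
    and f: "\<And>f. mat_fun f A = udiag n U (\<lambda>i. f (l i))"
    by (rule mat_fun_spectral[OF psd_carrier(1)[OF assms] psd_adj[OF assms]]) blast
  have l: "0 \<le> l i" if "i < n" for i using psd_udiag_nonneg[OF U] assms A that by auto
  show "psd n (msqrt A)" unfolding msqrt_def f using l by (intro psd_udiag U) auto
  show "msqrt A * msqrt A = A"
    unfolding msqrt_def f unfolding A by (simp add: udiag_mult U l cong: udiag_cong)
qed

lemma psd_gramE:
  assumes "psd n A"
  obtains B where "B \<in> carrier_mat n n" "A = adj B * B"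
  using msqrt_psd[OF assms] psd_adj[OF msqrt_psd(1)[OF assms]] by (metis psd_carrier(1))

text \<open>With Gram factors \<open>C\<close> of \<open>A\<close> and \<open>E\<close> of
  \<open>B\<close>, cyclicity turns the trace into the squared Hilbert-Schmidt norm of
  \<open>C * adj E\<close>.\<close>

lemma psd_trace_mult_nonneg:
  assumes "psd n A" "psd n B"
  shows "0 \<le> Re (mtrace (A * B))"
proof -
  obtain C where C: "C \<in> carrier_mat n n" "A = adj C * C" using psd_gramE[OF assms(1)] .
  obtain E where E: "E \<in> carrier_mat n n" "B = adj E * E" using psd_gramE[OF assms(2)] .
  have "mtrace (A * B) = mtrace (adj C * ((C * adj E) * E))"
    using C E by (simp add: mult_assoc_mat)
  also have "\<dots> = mtrace ((C * adj E) * adj (C * adj E))"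
    using C E by (subst mtrace_comm) (auto simp: adj_mult mult_assoc_mat)
  finally show ?thesis by (simp add: fro_sq' del: of_real_power)
qed

lemma psd_trace_nonneg: "psd n A \<Longrightarrow> 0 \<le> Re (mtrace A)"
  using psd_trace_mult_nonneg[OF psd_one, of n A] by simp

lemma psd_trace_mono:
  assumes "psd n A" "B \<in> carrier_mat n n" "C \<in> carrier_mat n n" "psd n (C - B)"
  shows "Re (mtrace (A * B)) \<le> Re (mtrace (A * C))"
  using psd_trace_mult_nonneg[OF assms(1,4)] assms
  by (simp add: mult_minus_mat mtrace_minus)

lemma hermitian_trace_mult_real:
  assumes "A \<in> carrier_mat n n" "B \<in> carrier_mat n n" "adj A = A" "adj B = B"
  shows "mtrace (A * B) = of_real (Re (mtrace (A * B)))"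
proof -
  have "cnj (mtrace (A * B)) = mtrace (adj (A * B))" using assms by (subst mtrace_adj) auto
  also have "\<dots> = mtrace (B * A)" using assms by (simp add: adj_mult)
  also have "\<dots> = mtrace (A * B)" using assms by (subst mtrace_comm) auto
  finally show ?thesis by (simp add: complex_eq_iff)
qed

section \<open>The trace norm\<close>

text \<open>Operator norm at most one. The order \<open>W * adj W\<close> suits multiplication from
  the right, as in \<open>X * W\<close>.\<close>

definition contraction :: "nat \<Rightarrow> complex mat \<Rightarrow> bool" where
  "contraction n W \<longleftrightarrow> W \<in> carrier_mat n n \<and> psd n (1\<^sub>m n - W * adj W)"

lemma contraction_carrier [simp]:
  assumes "contraction n W"
  shows "W \<in> carrier_mat n n" "dim_row W = n" "dim_col W = n"
  using assms by (auto simp: contraction_def)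

lemma contraction_mult:
  assumes "contraction n V" "contraction n W"
  shows "contraction n (V * W)"
  unfolding contraction_def
proof
  have eq: "1\<^sub>m n - (V * W) * adj (V * W) =
      (1\<^sub>m n - V * adj V) + adj (adj V) * (1\<^sub>m n - W * adj W) * adj V"
    using assms
    by (simp add: adj_mult mult_assoc_mat mult_minus_mat minus_mult_mat) (rule eq_matI, auto)
  show "psd n (1\<^sub>m n - (V * W) * adj (V * W))"
    unfolding eq using assms by (intro psd_add psd_conj_adj) (auto simp: contraction_def)
qed (use assms in \<open>auto simp: contraction_def\<close>)

lemma unitary_contraction: "unitary n U \<Longrightarrow> contraction n U"
  by (auto simp: contraction_def unitary_def psd_udiag[of n "1\<^sub>m n" "\<lambda>_. 0", OF unitary_one]
      minus_r_inv_mat[of "1\<^sub>m n" n n] intro!: psd_gram[of "0\<^sub>m n n" n n, simplified])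

lemma contraction_udiag:
  assumes "unitary n U" "\<And>i. i < n \<Longrightarrow> \<bar>l i\<bar> \<le> 1"
  shows "contraction n (udiag n U l)"
proof -
  have "1\<^sub>m n - udiag n U l * adj (udiag n U l) = udiag n U (\<lambda>i. 1 - l i * l i)"
    using assms(1) by (simp add: udiag_mult udiag_minus udiag_one[symmetric])
  moreover have "0 \<le> 1 - l i * l i" if "i < n" for i
    using assms(2)[OF that] by (metis abs_le_square_iff abs_one diff_ge_0_iff_ge one_power2 power2_eq_square)
  ultimately show ?thesis
    using assms unfolding contraction_def by (auto intro: psd_udiag)
qed

lemma fro_mult_contraction:
  assumes "contraction n W" "X \<in> carrier_mat m n"
  shows "fro (X * W) \<le> fro X"
proof -
  have "adj (adj X) * (1\<^sub>m n - W * adj W) * adj X = X * adj X - (X * W) * adj (X * W)"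
    using assms by (simp add: adj_mult mult_assoc_mat mult_minus_mat minus_mult_mat)
  moreover have "psd m (adj (adj X) * (1\<^sub>m n - W * adj W) * adj X)"
    using assms by (intro psd_conj_adj) (auto simp: contraction_def)
  ultimately have "0 \<le> Re (mtrace (X * adj X - (X * W) * adj (X * W)))"
    using psd_trace_nonneg by metis
  then have "(fro (X * W))\<^sup>2 \<le> (fro X)\<^sup>2"
    using assms by (subst (asm) mtrace_minus) (auto simp: fro_sq' simp del: of_real_power)
  then show ?thesis by (rule power2_le_imp_le) simp
qed

lemma trace_norm_spectral:
  assumes "M \<in> carrier_mat n n"
  obtains V s where "unitary n V" "adj M * M = udiag n V s" "\<And>i. i < n \<Longrightarrow> 0 \<le> s i"
    "trace_norm M = (\<Sum>i<n. sqrt (s i))"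
proof -
  have psd: "psd n (adj M * M)" using assms by (rule psd_gram)
  obtain V s where V: "unitary n V" and A: "adj M * M = udiag n V s"
    and f: "\<And>f. mat_fun f (adj M * M) = udiag n V (\<lambda>i. f (s i))"
    by (rule mat_fun_spectral[OF psd_carrier(1)[OF psd] psd_adj[OF psd]]) blast
  have "0 \<le> s i" if "i < n" for i using psd_udiag_nonneg[OF V] psd A that by auto
  moreover have "trace_norm M = (\<Sum>i<n. sqrt (s i))"
    unfolding trace_norm_def msqrt_def f mtrace_udiag[OF V] by simp
  ultimately show ?thesis using that V A by blast
qed

lemma trace_norm_nonneg: "M \<in> carrier_mat n n \<Longrightarrow> 0 \<le> trace_norm M"
  by (metis (no_types, lifting) trace_norm_spectral lessThan_iff real_sqrt_ge_zero sum_nonneg)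

text \<open>Working only with this dual characterisation of the trace norm spares a proof that the
  functional calculus does not depend on the chosen spectral decomposition.\<close>

lemma trace_norm_attained:
  assumes M: "M \<in> carrier_mat n n"
  obtains W where "contraction n W" "mtrace (M * W) = of_real (trace_norm M)"
proof -
  obtain V s where V: "unitary n V" and MM: "adj M * M = udiag n V s"
    and s: "\<And>i. i < n \<Longrightarrow> 0 \<le> s i" and tn: "trace_norm M = (\<Sum>i<n. sqrt (s i))"
    by (rule trace_norm_spectral[OF M]) blast
  \<comment> \<open>The pseudo-inverse of the absolute value of \<open>M\<close>: vanishing singular
    values are sent to zero, so \<open>W\<close> is a partial isometry and \<open>M * W\<close> has
    the trace of that absolute value.\<close>
  define d where "d i = (if s i = 0 then 0 else 1 / sqrt (s i))" for i
  define W where "W = udiag n V d * adj M"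
  have W: "W \<in> carrier_mat n n" using M V by (auto simp: W_def intro!: mult_carrier_mat[of _ n n])
  have "W * adj W = udiag n V d * (adj M * M) * udiag n V d"
    using M V by (simp add: W_def adj_mult mult_assoc_mat unitaryD[OF V])
  also have "\<dots> = udiag n V (\<lambda>i. if s i = 0 then 0 else 1)"
    unfolding MM using s by (auto simp: udiag_mult V d_def intro!: udiag_cong)
  finally have "1\<^sub>m n - W * adj W = udiag n V (\<lambda>i. 1 - (if s i = 0 then 0 else 1))"
    by (simp add: udiag_minus V udiag_one[OF V, symmetric])
  then have "contraction n W"
    unfolding contraction_def using W by (auto intro!: psd_udiag V)
  moreover have "mtrace (M * W) = mtrace (udiag n V d * (adj M * M))"
    using M unitaryD[OF V] by (subst mtrace_comm) (auto simp: W_def mult_assoc_mat)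
  moreover have "\<dots> = of_real (\<Sum>i<n. d i * s i)"
    unfolding MM by (simp add: udiag_mult V mtrace_udiag)
  moreover have "(\<Sum>i<n. d i * s i) = trace_norm M"
    unfolding tn d_def using s by (intro sum.cong) (auto simp: real_div_sqrt)
  ultimately show ?thesis using that by metis
qed

text \<open>In the eigenbasis \<open>V\<close> of \<open>adj M * M\<close> the columns of
  \<open>M * V\<close> have squared lengths \<open>s i\<close>, while the rows of
  \<open>adj V * Z\<close> have length at most one; Cauchy-Schwarz is applied for each
  \<open>i\<close> separately.\<close>

lemma trace_norm_ge:
  assumes M: "M \<in> carrier_mat n n" and Z: "contraction n Z"
  shows "cmod (mtrace (M * Z)) \<le> trace_norm M"
proof -
  obtain V s where V: "unitary n V" and MM: "adj M * M = udiag n V s"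
    and s: "\<And>i. i < n \<Longrightarrow> 0 \<le> s i" and tn: "trace_norm M = (\<Sum>i<n. sqrt (s i))"
    by (rule trace_norm_spectral[OF M]) blast
  note Vd = unitaryD[OF V]
  define P where "P = adj V * Z"
  define Q where "Q = M * V"
  have P: "contraction n P" unfolding P_def by (intro contraction_mult unitary_contraction unitary_adj V Z)
  have Q: "Q \<in> carrier_mat n n" using M Vd by (simp add: Q_def)
  have rowP: "(\<Sum>k<n. (cmod (P $$ (i, k)))\<^sup>2) \<le> 1" if "i < n" for i
  proof -
    have "0 \<le> Re ((1\<^sub>m n - P * adj P) $$ (i, i))"
      using P that by (intro psd_diag_nonneg) (auto simp: contraction_def)
    moreover have "(P * adj P) $$ (i, i) = of_real (\<Sum>k<n. (cmod (P $$ (i, k)))\<^sup>2)"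
      using index_gram_diag[of i "adj P"] P that by (simp del: of_real_power of_real_sum)
    ultimately show ?thesis
      using P that by (simp del: of_real_power of_real_sum index_mult_mat(1))
  qed
  have "adj Q * Q = adj V * (adj M * M) * V"
    using M Vd by (simp add: Q_def adj_mult mult_assoc_mat)
  then have QQ: "adj Q * Q = mat_diag n (\<lambda>i. complex_of_real (s i))"
    unfolding MM adj_udiag_cancel[OF V] .
  have colQ: "(\<Sum>k<n. (cmod (Q $$ (k, i)))\<^sup>2) = s i" if "i < n" for i
    using index_gram_diag[of i Q] Q that unfolding QQ
    by (simp add: mat_diag_def del: of_real_power of_real_sum)
  have "mtrace (M * Z) = mtrace (Q * P)"
    using M Vd Z by (simp add: P_def Q_def mult_assoc_mat unitary_cancel[OF V])
  also have "\<dots> = mtrace (P * Q)" using P Q by (subst mtrace_comm) auto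
  also have "\<dots> = (\<Sum>i<n. \<Sum>k<n. P $$ (i, k) * Q $$ (k, i))"
    using P Q by (subst mtrace_mult) auto
  also have "cmod \<dots> \<le> (\<Sum>i<n. sqrt (s i))"
  proof (rule sum_norm_le)
    fix i assume "i \<in> {..<n}"
    then have i: "i < n" by simp
    have "cmod (\<Sum>k<n. P $$ (i, k) * Q $$ (k, i)) \<le> (\<Sum>k<n. \<bar>cmod (P $$ (i, k))\<bar> * \<bar>cmod (Q $$ (k, i))\<bar>)"
      by (rule sum_norm_le) (simp add: norm_mult)
    also have "\<dots> \<le> L2_set (\<lambda>k. cmod (P $$ (i, k))) {..<n} * L2_set (\<lambda>k. cmod (Q $$ (k, i))) {..<n}"
      by (rule L2_set_mult_ineq)
    also have "\<dots> \<le> 1 * sqrt (s i)"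
      unfolding L2_set_def using rowP[OF i] colQ[OF i] s[OF i] by (intro mult_mono) (auto simp: sum_nonneg)
    finally show "cmod (\<Sum>k<n. P $$ (i, k) * Q $$ (k, i)) \<le> sqrt (s i)" by simp
  qed
  finally show ?thesis unfolding tn .
qed

text \<open>Positive and negative parts. The sign of \<open>H\<close> is a contraction whose trace
  against \<open>H\<close> is the sum of the absolute eigenvalues, so the dual bound applies and
  \<open>msqrt (adj H * H)\<close> is never computed.\<close>

lemma hermitian_decomposition:
  assumes "H \<in> carrier_mat n n" "adj H = H"
  obtains P N where "psd n P" "psd n N" "H = P - N" "Re (mtrace P) + Re (mtrace N) \<le> trace_norm H"
proof -
  obtain U l where U: "unitary n U" and H: "H = udiag n U l" using spectral_theorem[OF assms] .
  define Z where "Z = udiag n U (\<lambda>i. if 0 \<le> l i then 1 else -1)"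
  have Z: "contraction n Z" unfolding Z_def by (rule contraction_udiag[OF U]) auto
  let ?P = "udiag n U (\<lambda>i. max (l i) 0)" and ?N = "udiag n U (\<lambda>i. max (- l i) 0)"
  have "Re (mtrace ?P) + Re (mtrace ?N) = Re (mtrace (H * Z))"
  proof -
    have "(\<Sum>i<n. max (l i) 0) + (\<Sum>i<n. max (- l i) 0) = (\<Sum>i<n. l i * (if 0 \<le> l i then 1 else -1))"
      unfolding sum.distrib[symmetric] by (intro sum.cong) auto
    then show ?thesis unfolding H Z_def by (simp only: udiag_mult[OF U] mtrace_udiag[OF U] Re_complex_of_real)
  qed
  also have "\<dots> \<le> trace_norm H"
    using trace_norm_ge[OF assms(1) Z] complex_Re_le_cmod order_trans by blast
  finally have "Re (mtrace ?P) + Re (mtrace ?N) \<le> trace_norm H" .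
  moreover have "H = ?P - ?N" unfolding H by (auto simp: udiag_minus U intro!: udiag_cong)
  moreover have "psd n ?P" "psd n ?N" by (auto intro: psd_udiag[OF U])
  ultimately show ?thesis using that by blast
qed

text \<open>Powers--Stoermer inequality: with \<open>S = \<surd>A - \<surd>B\<close> and \<open>T = \<surd>A + \<surd>B\<close> one has
  \<open>A - B = (S T + T S) / 2\<close>, and the sign of \<open>S\<close> is the contraction to test against,
  because \<open>-T \<le> S \<le> T\<close>.\<close>

lemma powers_stoermer:
  assumes A: "psd n A" and B: "psd n B"
  shows "(fro (msqrt A - msqrt B))\<^sup>2 \<le> trace_norm (A - B)"
proof -
  note a = msqrt_psd[OF A] and b = msqrt_psd[OF B]
  define S where "S = msqrt A - msqrt B"
  define T where "T = msqrt A + msqrt B"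
  have S: "S \<in> carrier_mat n n" "adj S = S" and T: "T \<in> carrier_mat n n"
    using a b by (auto simp: S_def T_def adj_minus psd_adj)
  obtain U s where U: "unitary n U" and SU: "S = udiag n U s" using spectral_theorem[OF S] .
  note Ud = unitaryD[OF U]
  define Z where "Z = udiag n U (\<lambda>i. sgn (s i))"
  have Zd: "Z \<in> carrier_mat n n" by (simp add: Z_def U)
  have Z: "contraction n Z" unfolding Z_def by (rule contraction_udiag[OF U]) (auto simp: sgn_if)
  \<comment> \<open>Adding both orders cancels the cross terms of the two roots, which need not
    commute; doubling avoids a factor one half.\<close>
  have AB: "(A - B) + (A - B) = S * T + T * S"
  proof -
    have "S * T + T * S = (msqrt A * msqrt A - msqrt B * msqrt B) + (msqrt A * msqrt A - msqrt B * msqrt B)"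
      unfolding S_def T_def using psd_carrier[OF a(1)] psd_carrier[OF b(1)]
      by (simp add: mult_add_mat mult_minus_mat minus_mult_mat add_mult_mat)
        (rule eq_matI, auto simp del: index_mult_mat(1))
    then show ?thesis using a b by simp
  qed
  define Tii where "Tii i = (adj U * T * U) $$ (i, i)" for i
  have abs: "S * Z = udiag n U (\<lambda>i. \<bar>s i\<bar>)" "Z * S = udiag n U (\<lambda>i. \<bar>s i\<bar>)"
    unfolding SU Z_def by (auto simp: udiag_mult U abs_sgn mult.commute intro!: udiag_cong)
  have "mtrace ((A - B) * Z) + mtrace ((A - B) * Z) = mtrace (((A - B) + (A - B)) * Z)"
    using A B Zd by (subst add_mult_mat) (auto simp: mtrace_add)
  also have "\<dots> = mtrace (S * T * Z) + mtrace (T * S * Z)"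
    unfolding AB using S T Zd by (subst add_mult_mat) (auto simp: mtrace_add)
  also have "mtrace (S * T * Z) = mtrace (udiag n U (\<lambda>i. \<bar>s i\<bar>) * T)"
    unfolding abs(2)[symmetric] using S T Zd
    by (subst mtrace_comm[of "S * T"]) (auto simp: mult_assoc_mat)
  also have "mtrace (T * S * Z) = mtrace (udiag n U (\<lambda>i. \<bar>s i\<bar>) * T)"
    unfolding abs(1)[symmetric] using S(1) T Zd
    by (subst mult_assoc_mat[of T S Z], simp, simp, intro mtrace_comm) auto
  finally have "Re (mtrace ((A - B) * Z)) = (\<Sum>i<n. \<bar>s i\<bar> * Re (Tii i))"
    unfolding mtrace_udiag_mult[OF U T] Tii_def by simp
  \<comment> \<open>\<open>T + S\<close> and \<open>T - S\<close> are twice the square roots of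
    \<open>A\<close> and \<open>B\<close>, so both have nonnegative diagonals in the eigenbasis of
    \<open>S\<close>, where \<open>S\<close> itself contributes \<open>s i\<close>.\<close>
  moreover have "\<bar>s i\<bar> \<le> Re (Tii i)" if "i < n" for i
  proof -
    have "psd n (adj U * (msqrt A + msqrt A) * U)" "psd n (adj U * (msqrt B + msqrt B) * U)"
      using a b Ud by (auto intro!: psd_conj_adj psd_add)
    moreover have "msqrt A + msqrt A = T + S" "msqrt B + msqrt B = T - S"
      unfolding S_def T_def using a b by (auto intro!: eq_matI simp: psd_carrier)
    ultimately have "psd n (adj U * (T + S) * U)" "psd n (adj U * (T - S) * U)" by auto
    moreover have "adj U * (T + S) * U = adj U * T * U + adj U * S * U"
      "adj U * (T - S) * U = adj U * T * U - adj U * S * U"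
      using T S Ud by (simp_all add: mult_add_mat mult_minus_mat minus_mult_mat add_mult_mat)
    ultimately have p: "psd n (adj U * T * U + mat_diag n (\<lambda>i. complex_of_real (s i)))"
      "psd n (adj U * T * U - mat_diag n (\<lambda>i. complex_of_real (s i)))"
      unfolding SU adj_udiag_cancel[OF U] by auto
    show ?thesis
      using psd_diag_nonneg[OF p(1) that] psd_diag_nonneg[OF p(2) that] that Ud T
      by (simp add: Tii_def mat_diag_def del: index_mult_mat(1))
  qed
  then have "(\<Sum>i<n. \<bar>s i\<bar> * \<bar>s i\<bar>) \<le> (\<Sum>i<n. \<bar>s i\<bar> * Re (Tii i))"
    by (intro sum_mono mult_left_mono) auto
  moreover have "(fro S)\<^sup>2 = (\<Sum>i<n. \<bar>s i\<bar> * \<bar>s i\<bar>)"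
    using fro_sq[of S] unfolding S(2) unfolding SU udiag_mult[OF U] mtrace_udiag[OF U]
    by (simp del: of_real_power of_real_sum)
  moreover have "Re (mtrace ((A - B) * Z)) \<le> trace_norm (A - B)"
    using A B by (intro order_trans[OF complex_Re_le_cmod] trace_norm_ge[OF _ Z]) (auto simp: minus_carrier_mat)
  ultimately show ?thesis unfolding S_def by simp
qed

section \<open>Tests, trace distance and fidelity\<close>

text \<open>An effect: the accepting element of a two-outcome measurement.\<close>

definition test :: "nat \<Rightarrow> complex mat \<Rightarrow> bool" where
  "test n Q \<longleftrightarrow> psd n Q \<and> psd n (1\<^sub>m n - Q)"

lemma densityD:
  assumes "density n \<rho>"
  shows "psd n \<rho>" "mtrace \<rho> = 1" "\<rho> \<in> carrier_mat n n" "dim_row \<rho> = n" "dim_col \<rho> = n" "adj \<rho> = \<rho>"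
  using assms by (auto simp: density_def psd_def)

lemma testD:
  assumes "test n Q"
  shows "psd n Q" "psd n (1\<^sub>m n - Q)" "Q \<in> carrier_mat n n" "dim_row Q = n" "dim_col Q = n" "adj Q = Q"
  using assms by (auto simp: test_def psd_def)

lemma test_compl: "test n Q \<Longrightarrow> test n (1\<^sub>m n - Q)"
proof -
  assume Q: "test n Q"
  have "1\<^sub>m n - (1\<^sub>m n - Q) = Q" using testD[OF Q] by (intro eq_matI) auto
  then show ?thesis using Q by (simp add: test_def)
qed

lemma test_trace_le:
  assumes "psd n A" "test n Q"
  shows "Re (mtrace (A * Q)) \<le> Re (mtrace A)" "0 \<le> Re (mtrace (A * Q))"
proof -
  show "Re (mtrace (A * Q)) \<le> Re (mtrace A)"
    using psd_trace_mono[OF assms(1), of Q "1\<^sub>m n"] assms testD[OF assms(2)] by simp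
  show "0 \<le> Re (mtrace (A * Q))"
    using psd_trace_mult_nonneg assms testD(1) by blast
qed

text \<open>Both states have trace one, so the positive and negative parts of their difference have
  equal traces, each at most half the trace norm; a test gains at most the trace of the negative
  part.\<close>

lemma trace_dist_test:
  assumes \<alpha>: "density n \<alpha>" and \<beta>: "density n \<beta>" and Q: "test n Q"
  shows "Re (mtrace (\<beta> * Q)) - Re (mtrace (\<alpha> * Q)) \<le> trace_dist \<alpha> \<beta>"
proof -
  note a = densityD[OF \<alpha>] and b = densityD[OF \<beta>] and q = testD[OF Q]
  obtain P N where P: "psd n P" and N: "psd n N" and H: "\<alpha> - \<beta> = P - N"
    and tn: "Re (mtrace P) + Re (mtrace N) \<le> trace_norm (\<alpha> - \<beta>)"
  proof (rule hermitian_decomposition)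
    show "\<alpha> - \<beta> \<in> carrier_mat n n" "adj (\<alpha> - \<beta>) = \<alpha> - \<beta>"
      using a b by (auto simp: adj_minus minus_carrier_mat)
  qed blast
  have "mtrace P - mtrace N = mtrace (\<alpha> - \<beta>)"
    unfolding H using P N by (subst mtrace_minus) auto
  then have tr: "mtrace P = mtrace N" using a b by (subst (asm) mtrace_minus) auto
  have "mtrace (\<alpha> * Q) - mtrace (\<beta> * Q) = mtrace ((\<alpha> - \<beta>) * Q)"
    using a b q by (simp add: minus_mult_mat mtrace_minus)
  also have "\<dots> = mtrace (P * Q) - mtrace (N * Q)"
    unfolding H using P N q by (simp add: minus_mult_mat mtrace_minus)
  finally have "Re (mtrace (\<beta> * Q)) - Re (mtrace (\<alpha> * Q)) = Re (mtrace (N * Q)) - Re (mtrace (P * Q))"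
    by (metis minus_complex.simps(1) minus_diff_eq)
  also have "\<dots> \<le> Re (mtrace N)"
    using test_trace_le[OF N Q] test_trace_le[OF P Q] by linarith
  finally show ?thesis using tn tr by (simp add: trace_dist_def)
qed

lemma trace_mult_le_fro:
  assumes "X \<in> carrier_mat n m" "Y \<in> carrier_mat m n"
  shows "cmod (mtrace (X * Y)) \<le> fro X * fro Y"
  using fro_cauchy_schwarz[of "adj X" Y] assms by auto

lemma fro_contraction_mult:
  assumes "contraction n W" "adj W = W" "X \<in> carrier_mat n m"
  shows "fro (W * X) \<le> fro X"
proof -
  have "fro (W * X) = fro (adj X * W)"
    using assms by (metis adj_mult carrier_matD contraction_carrier(3) fro_adj)
  also have "\<dots> \<le> fro (adj X)" using assms by (intro fro_mult_contraction) auto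
  finally show ?thesis by simp
qed

text \<open>The square root acts as a purification: acceptance probabilities become squared
  Hilbert-Schmidt norms, for which a triangle inequality is available.\<close>

lemma fro_msqrt_mult:
  assumes "psd n A" "C \<in> carrier_mat m n"
  shows "(fro (C * msqrt A))\<^sup>2 = Re (mtrace (A * (adj C * C)))"
proof -
  note a = msqrt_psd[OF assms(1)]
  have "of_real ((fro (C * msqrt A))\<^sup>2) = mtrace (adj (C * msqrt A) * (C * msqrt A))"
    by (rule fro_sq[symmetric])
  also have "\<dots> = mtrace (msqrt A * ((adj C * C) * msqrt A))"
    using assms a by (simp add: adj_mult mult_assoc_mat psd_adj)
  also have "\<dots> = mtrace ((adj C * C) * (msqrt A * msqrt A))"
    using assms psd_carrier[OF a(1)] by (subst mtrace_comm) (auto simp: mult_assoc_mat)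
  also have "\<dots> = mtrace (A * (adj C * C))"
    unfolding a(2) using assms by (subst mtrace_comm) auto
  finally show ?thesis by (metis Re_complex_of_real)
qed

lemma fro_msqrt_density:
  assumes "density n \<rho>"
  shows "fro (msqrt \<rho>) = 1"
  using fro_msqrt_mult[of n \<rho> "1\<^sub>m n" n] densityD[OF assms] psd_carrier[OF msqrt_psd(1)[of n \<rho>]]
    fro_nonneg[of "msqrt \<rho>"]
  by (simp add: power2_eq_1_iff)

text \<open>Insert \<open>Q + (1 - Q)\<close> between the two square roots and apply Cauchy-Schwarz
  to each part. Of the two factors in each part the larger is bounded by one, leaving the acceptance
  of \<open>\<alpha>\<close> and the rejection of \<open>\<beta>\<close>.\<close>

lemma fidelity_le_test:
  assumes \<alpha>: "density n \<alpha>" and \<beta>: "density n \<beta>" and Q: "test n Q"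
  shows "trace_norm (msqrt \<alpha> * msqrt \<beta>) \<le>
    sqrt (Re (mtrace (\<alpha> * Q))) + sqrt (Re (mtrace (\<beta> * (1\<^sub>m n - Q))))"
proof -
  note a = densityD[OF \<alpha>] and b = densityD[OF \<beta>] and q = testD[OF Q]
  note ra = msqrt_psd[OF a(1)] and rb = msqrt_psd[OF b(1)]
  have M: "msqrt \<alpha> * msqrt \<beta> \<in> carrier_mat n n" using ra rb by auto
  obtain W where W: "contraction n W"
    and tn: "mtrace (msqrt \<alpha> * msqrt \<beta> * W) = of_real (trace_norm (msqrt \<alpha> * msqrt \<beta>))"
    using trace_norm_attained[OF M] .
  have part: "cmod (mtrace (msqrt \<alpha> * X * (msqrt \<beta> * W))) \<le>
      sqrt (Re (mtrace (\<alpha> * X))) * sqrt (Re (mtrace (\<beta> * X)))" if X: "test n X" for X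
  proof -
    obtain C where C: "C \<in> carrier_mat n n" "X = adj C * C" using psd_gramE[OF testD(1)[OF X]] .
    have "msqrt \<alpha> * X * (msqrt \<beta> * W) = adj (C * msqrt \<alpha>) * (C * msqrt \<beta> * W)"
      using C ra(1) rb(1) W by (simp add: mult_assoc_mat adj_mult psd_adj)
    then have "cmod (mtrace (msqrt \<alpha> * X * (msqrt \<beta> * W))) \<le> fro (C * msqrt \<alpha>) * fro (C * msqrt \<beta> * W)"
      using C ra(1) rb(1) W by (simp add: fro_cauchy_schwarz)
    also have "\<dots> \<le> fro (C * msqrt \<alpha>) * fro (C * msqrt \<beta>)"
      using C rb(1) W by (intro mult_left_mono fro_mult_contraction) auto
    also have "\<dots> = sqrt (Re (mtrace (\<alpha> * X))) * sqrt (Re (mtrace (\<beta> * X)))"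
      using fro_msqrt_mult[OF a(1) C(1)] fro_msqrt_mult[OF b(1) C(1)] C(2)
      by (metis fro_nonneg real_sqrt_unique)
    finally show ?thesis .
  qed
  have "msqrt \<alpha> * msqrt \<beta> * W = msqrt \<alpha> * Q * (msqrt \<beta> * W) + msqrt \<alpha> * (1\<^sub>m n - Q) * (msqrt \<beta> * W)"
  proof -
    have "msqrt \<alpha> * Q * (msqrt \<beta> * W) + msqrt \<alpha> * (1\<^sub>m n - Q) * (msqrt \<beta> * W)
        = (msqrt \<alpha> * (Q + (1\<^sub>m n - Q))) * (msqrt \<beta> * W)"
      using ra(1) rb(1) q W by (simp add: mult_add_mat add_mult_mat)
    also have "Q + (1\<^sub>m n - Q) = 1\<^sub>m n" using q by (intro eq_matI) auto
    finally show ?thesis using ra(1) rb(1) W by (simp add: mult_assoc_mat)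
  qed
  then have "mtrace (msqrt \<alpha> * msqrt \<beta> * W) =
      mtrace (msqrt \<alpha> * Q * (msqrt \<beta> * W)) + mtrace (msqrt \<alpha> * (1\<^sub>m n - Q) * (msqrt \<beta> * W))"
    using ra(1) rb(1) q W by (simp add: mtrace_add)
  then have "cmod (of_real (trace_norm (msqrt \<alpha> * msqrt \<beta>))) \<le>
      cmod (mtrace (msqrt \<alpha> * Q * (msqrt \<beta> * W))) + cmod (mtrace (msqrt \<alpha> * (1\<^sub>m n - Q) * (msqrt \<beta> * W)))"
    unfolding tn by (metis norm_triangle_ineq)
  also have "\<dots> \<le> sqrt (Re (mtrace (\<alpha> * Q))) * 1 + 1 * sqrt (Re (mtrace (\<beta> * (1\<^sub>m n - Q))))"
    using test_trace_le[OF a(1) test_compl[OF Q]] test_trace_le[OF b(1) Q] test_trace_le[OF a(1) Q]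
      test_trace_le[OF b(1) test_compl[OF Q]] a(2) b(2)
    by (intro add_mono order_trans[OF part] mult_left_mono mult_right_mono Q test_compl) auto
  finally show ?thesis by simp
qed

text \<open>For the fidelity \<open>F\<close>, the squared distance of the roots is at least
  \<open>2 - 2 * F\<close>, since the identity is a contraction. Powers-Stoermer then gives
  \<open>1 - F \<le> trace_dist \<alpha> \<beta>\<close>, and 1 minus the square of \<open>F\<close>
  is at most \<open>2 * (1 - F)\<close>.\<close>

lemma purified_dist_le:
  assumes \<alpha>: "density n \<alpha>" and \<beta>: "density n \<beta>"
  shows "purified_dist \<alpha> \<beta> \<le> sqrt (2 * trace_dist \<alpha> \<beta>)"
proof -
  note a = densityD[OF \<alpha>] and b = densityD[OF \<beta>]
  note ra = msqrt_psd[OF a(1)] and rb = msqrt_psd[OF b(1)]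
  note rac = psd_carrier[OF ra(1)] and rbc = psd_carrier[OF rb(1)]
  let ?F = "trace_norm (msqrt \<alpha> * msqrt \<beta>)"
  let ?D = "msqrt \<alpha> - msqrt \<beta>"
  have M: "msqrt \<alpha> * msqrt \<beta> \<in> carrier_mat n n" using ra rb by auto
  have F: "0 \<le> ?F" by (rule trace_norm_nonneg[OF M])
  have "Re (mtrace (msqrt \<alpha> * msqrt \<beta>)) \<le> ?F"
    using trace_norm_ge[OF M unitary_contraction[OF unitary_one]]
      complex_Re_le_cmod[of "mtrace (msqrt \<alpha> * msqrt \<beta>)"] rbc by simp
  moreover have "(fro ?D)\<^sup>2 = 2 - 2 * Re (mtrace (msqrt \<alpha> * msqrt \<beta>))"
  proof -
    have "adj ?D * ?D = (\<alpha> - msqrt \<beta> * msqrt \<alpha>) - (msqrt \<alpha> * msqrt \<beta> - \<beta>)"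
      using rac rbc ra rb by (simp add: adj_minus psd_adj mult_minus_mat minus_mult_mat)
    then have "mtrace (adj ?D * ?D) = (mtrace \<alpha> - mtrace (msqrt \<beta> * msqrt \<alpha>)) - (mtrace (msqrt \<alpha> * msqrt \<beta>) - mtrace \<beta>)"
      using rac rbc a b by (simp add: mtrace_minus)
    also have "mtrace (msqrt \<beta> * msqrt \<alpha>) = mtrace (msqrt \<alpha> * msqrt \<beta>)"
      using rac rbc by (intro mtrace_comm) auto
    finally have "complex_of_real ((fro ?D)\<^sup>2) = 2 - 2 * mtrace (msqrt \<alpha> * msqrt \<beta>)"
      unfolding fro_sq a(2) b(2) by simp
    from arg_cong[OF this, of Re] show ?thesis by (simp del: of_real_power)
  qed
  ultimately have le: "1 - ?F \<le> trace_dist \<alpha> \<beta>"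
    using powers_stoermer[OF a(1) b(1)] by (simp add: trace_dist_def)
  have "1 - x\<^sup>2 \<le> 2 * t" if "1 - x \<le> t" for x t :: real
    using that zero_le_power2[of "1 - x"] by (simp add: power2_eq_square algebra_simps)
  then show ?thesis unfolding purified_dist_def using le by (intro real_sqrt_le_mono)
qed

text \<open>Closeness up to any error below one still prevents a reliable test for
  \<open>\<beta>\<close> from rejecting \<open>\<alpha>\<close> almost surely. The factor 4 leaves
  \<open>2 * \<delta>\<close> for smoothing and \<open>2 * \<delta>\<close> for the contradiction in
  the converse.\<close>

lemma dist_test_robust:
  assumes "\<Delta> \<in> {trace_dist, purified_dist}" "\<epsilon> < 1"
  obtains \<delta> :: real where "0 < \<delta>" "\<And>n \<alpha> \<beta> Q. density n \<alpha> \<Longrightarrow> density n \<beta> \<Longrightarrow> test n Q \<Longrightarrow>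
    \<Delta> \<alpha> \<beta> \<le> \<epsilon> \<Longrightarrow> 1 - \<delta> \<le> Re (mtrace (\<beta> * Q)) \<Longrightarrow> 4 * \<delta> \<le> Re (mtrace (\<alpha> * Q))"
proof (cases "\<Delta> = trace_dist")
  case True
  have lin: "y - x \<le> T \<Longrightarrow> T \<le> \<epsilon> \<Longrightarrow> 1 - (1 - \<epsilon>) / 5 \<le> y \<Longrightarrow> 4 * ((1 - \<epsilon>) / 5) \<le> x" for x y T :: real
    by (simp add: field_simps)
  show ?thesis
  \<comment> \<open>Here \<open>1 - \<epsilon> = 5 * \<delta>\<close>; the imperfect test loses one
    \<open>\<delta>\<close> and four remain.\<close>
  proof (rule that[of "(1 - \<epsilon>) / 5"])
    fix n \<alpha> \<beta> Q
    assume "density n \<alpha>" "density n \<beta>" "test n Q" "\<Delta> \<alpha> \<beta> \<le> \<epsilon>" "1 - (1 - \<epsilon>) / 5 \<le> Re (mtrace (\<beta> * Q))"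
    then show "4 * ((1 - \<epsilon>) / 5) \<le> Re (mtrace (\<alpha> * Q))"
      using trace_dist_test[of n \<alpha> \<beta> Q] lin[of "Re (mtrace (\<beta> * Q))"] unfolding True by blast
  qed (use assms in simp)
next
  case False
  then have P: "\<Delta> = purified_dist" using assms by auto
  \<comment> \<open>Only \<open>\<epsilon> < 1\<close> is assumed; a negative
    \<open>\<epsilon>\<close> must not be squared.\<close>
  define e where "e = max \<epsilon> 0"
  have e: "0 \<le> e" "e < 1" "\<epsilon> \<le> e" using assms by (auto simp: e_def)
  then have e2: "e\<^sup>2 < 1" by (simp add: power_less_one_iff abs_square_less_1)
  define f where "f = sqrt (1 - e\<^sup>2)"
  have f: "0 < f" using e2 by (simp add: f_def)
  show ?thesis
  \<comment> \<open>The fidelity is at least \<open>f\<close>, and rejection of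
    \<open>\<beta>\<close> uses up at most \<open>f / 3\<close> of it; the remaining
    \<open>2 * (f / 3)\<close> squares to \<open>4 * \<delta>\<close>.\<close>
  proof (rule that[of "(f / 3)\<^sup>2"])
    fix n \<alpha> \<beta> Q
    assume \<alpha>: "density n \<alpha>" and \<beta>: "density n \<beta>" and Q: "test n Q" and le: "\<Delta> \<alpha> \<beta> \<le> \<epsilon>"
      and acc: "1 - (f / 3)\<^sup>2 \<le> Re (mtrace (\<beta> * Q))"
    note a = densityD[OF \<alpha>] and b = densityD[OF \<beta>] and q = testD[OF Q]
    let ?F = "trace_norm (msqrt \<alpha> * msqrt \<beta>)"
    have "msqrt \<alpha> * msqrt \<beta> \<in> carrier_mat n n" using msqrt_psd(1)[OF a(1)] msqrt_psd(1)[OF b(1)] by auto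
    then have F: "0 \<le> ?F" by (rule trace_norm_nonneg)
    have "sqrt (1 - ?F\<^sup>2) \<le> e" using le e P by (simp add: purified_dist_def)
    then have "1 - ?F\<^sup>2 \<le> e\<^sup>2" by (rule sqrt_le_D)
    then have "f \<le> ?F" unfolding f_def using F by (intro real_le_lsqrt) auto
    moreover have "Re (mtrace (\<beta> * (1\<^sub>m n - Q))) \<le> (f / 3)\<^sup>2"
      using acc b q by (simp add: mult_minus_mat mtrace_minus)
    then have "sqrt (Re (mtrace (\<beta> * (1\<^sub>m n - Q)))) \<le> f / 3"
      using f by (metis real_sqrt_abs real_sqrt_le_mono abs_of_nonneg less_imp_le divide_nonneg_pos zero_less_numeral)
    ultimately have "2 * (f / 3) \<le> sqrt (Re (mtrace (\<alpha> * Q)))"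
      using fidelity_le_test[OF \<alpha> \<beta> Q] by linarith
    then have "(2 * (f / 3))\<^sup>2 \<le> (sqrt (Re (mtrace (\<alpha> * Q))))\<^sup>2"
      using f by (intro power_mono) auto
    then show "4 * (f / 3)\<^sup>2 \<le> Re (mtrace (\<alpha> * Q))"
      using test_trace_le(2)[OF a(1) Q] by (simp add: power_mult_distrib power_divide)
  qed (use f in simp)
qed

section \<open>Gentle measurement\<close>

definition proj :: "nat \<Rightarrow> complex mat \<Rightarrow> bool" where
  "proj n P \<longleftrightarrow> P \<in> carrier_mat n n \<and> adj P = P \<and> P * P = P"

lemma projD:
  assumes "proj n P"
  shows "P \<in> carrier_mat n n" "dim_row P = n" "dim_col P = n" "adj P = P" "P * P = P"
  using assms by (auto simp: proj_def)

lemma proj_compl: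
  assumes "proj n P"
  shows "proj n (1\<^sub>m n - P)"
proof -
  note p = projD[OF assms]
  have "(1\<^sub>m n - P) * (1\<^sub>m n - P) = (1\<^sub>m n - P) - (P - P)"
    using p by (simp add: mult_minus_mat minus_mult_mat)
  also have "\<dots> = 1\<^sub>m n - P" using p by (intro eq_matI) auto
  finally show ?thesis using p by (auto simp: proj_def adj_minus)
qed

lemma proj_psd: "proj n P \<Longrightarrow> psd n P"
  using psd_gram[of P n n] projD[of n P] by simp

lemma proj_contraction: "proj n P \<Longrightarrow> contraction n P"
  using proj_psd[OF proj_compl] projD[of n P] by (simp add: contraction_def)

lemma mult_assoc_mat': "P * P = P \<Longrightarrow> dim_row P = dim_col P \<Longrightarrow> dim_row X = dim_col P \<Longrightarrow> P * (P * X) = P * X"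
  for P X :: "complex mat"
  by (metis mult_assoc_mat)

lemma fro_proj_defect:
  assumes "density n \<rho>" "proj n P" "1 - \<delta> \<le> Re (mtrace (\<rho> * P))"
  shows "fro (msqrt \<rho> - P * msqrt \<rho>) \<le> sqrt \<delta>"
proof -
  note r = densityD[OF assms(1)] and p = projD[OF assms(2)]
  note s = psd_carrier[OF msqrt_psd(1)[OF r(1)]]
  have "(fro ((1\<^sub>m n - P) * msqrt \<rho>))\<^sup>2 = Re (mtrace (\<rho> * (1\<^sub>m n - P)))"
    using fro_msqrt_mult[OF r(1), of "1\<^sub>m n - P" n] projD[OF proj_compl[OF assms(2)]] by simp
  also have "\<dots> \<le> \<delta>" using assms(3) r p by (simp add: mult_minus_mat mtrace_minus)
  finally show ?thesis using s p by (simp add: minus_mult_mat real_le_rsqrt)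
qed

text \<open>The defect telescopes as \<open>(1 - P)\<close> plus \<open>P (1 - Q)\<close> applied to
  the root. Each term costs \<open>sqrt \<delta>\<close>, because a projection does not increase the
  norm; commutation plays no part.\<close>

lemma fro_two_proj_defect:
  assumes "density n \<rho>" "proj n P" "1 - \<delta> \<le> Re (mtrace (\<rho> * P))"
    "proj n Q" "1 - \<delta> \<le> Re (mtrace (\<rho> * Q))"
  shows "fro (msqrt \<rho> - P * Q * msqrt \<rho>) \<le> 2 * sqrt \<delta>" "1 - 2 * sqrt \<delta> \<le> fro (P * Q * msqrt \<rho>)"
    "fro (P * Q * msqrt \<rho>) \<le> 1"
proof -
  let ?B = "msqrt \<rho>"
  note p = projD[OF assms(2)] and q = projD[OF assms(4)]
  note s = psd_carrier[OF msqrt_psd(1)[OF densityD(1)[OF assms(1)]]]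
  have eq: "?B - P * Q * ?B = (?B - P * ?B) + P * (?B - Q * ?B)"
    using p q s by (simp add: mult_minus_mat mult_assoc_mat) (intro eq_matI, auto)
  have "fro (?B - P * Q * ?B) \<le> fro (?B - P * ?B) + fro (P * (?B - Q * ?B))"
    unfolding eq using p q s by (intro fro_triangle) auto
  also have "fro (P * (?B - Q * ?B)) \<le> fro (?B - Q * ?B)"
    using p q s by (intro fro_contraction_mult[OF proj_contraction[OF assms(2)], of _ n]) auto
  finally show 1: "fro (?B - P * Q * ?B) \<le> 2 * sqrt \<delta>"
    using fro_proj_defect[OF assms(1,2,3)] fro_proj_defect[OF assms(1,4,5)] by simp
  have "?B = P * Q * ?B + (?B - P * Q * ?B)"
    using p q s by (intro eq_matI) auto
  then have "fro ?B \<le> fro (P * Q * ?B) + fro (?B - P * Q * ?B)"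
    using fro_triangle[of "P * Q * ?B" "?B - P * Q * ?B"] p q s by simp
  then show "1 - 2 * sqrt \<delta> \<le> fro (P * Q * ?B)"
    using 1 fro_msqrt_density[OF assms(1)] by simp
  have "fro (P * (Q * ?B)) \<le> fro (Q * ?B)"
    using p q s by (intro fro_contraction_mult[OF proj_contraction[OF assms(2)], of _ n]) auto
  also have "\<dots> \<le> fro ?B"
    using p q s by (intro fro_contraction_mult[OF proj_contraction[OF assms(4)], of _ n]) auto
  finally show "fro (P * Q * msqrt \<rho>) \<le> 1"
    using fro_msqrt_density[OF assms(1)] p q s by (simp add: mult_assoc_mat)
qed

lemma density_trace_contraction_le:
  assumes "density n \<rho>" "contraction n W"
  shows "cmod (mtrace (\<rho> * W)) \<le> 1"
proof -
  note r = densityD[OF assms(1)]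
  note s = psd_carrier[OF msqrt_psd(1)[OF r(1)]]
  have "\<rho> * W = msqrt \<rho> * (msqrt \<rho> * W)"
    using msqrt_psd(2)[OF r(1)] s assms(2) by (simp add: mult_assoc_mat[symmetric])
  then have "cmod (mtrace (\<rho> * W)) \<le> fro (msqrt \<rho>) * fro (msqrt \<rho> * W)"
    using trace_mult_le_fro[of "msqrt \<rho>" n n "msqrt \<rho> * W"] s assms(2) by auto
  also have "\<dots> \<le> 1 * 1"
    using fro_mult_contraction[OF assms(2) s(1)] fro_msqrt_density[OF assms(1)] by (intro mult_mono) auto
  finally show ?thesis by simp
qed

lemma sandwich_test_accepts:
  assumes "density n \<rho>" "proj n P" "1 - \<delta> \<le> Re (mtrace (\<rho> * P))"
    "proj n Q" "1 - \<delta> \<le> Re (mtrace (\<rho> * Q))"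
  shows "test n (P * Q * P)" "1 - 4 * sqrt \<delta> \<le> Re (mtrace (\<rho> * (P * Q * P)))"
proof -
  note p = projD[OF assms(2)] and q = projD[OF assms(4)]
  have eq: "P * Q * P = adj (Q * P) * (Q * P)"
    using p q by (simp add: adj_mult mult_assoc_mat mult_assoc_mat')
  have eq': "P * Q * P = adj (adj (P * Q)) * adj (P * Q)"
    unfolding eq using p q by (simp add: adj_mult mult_assoc_mat mult_assoc_mat')
  have "contraction n (P * Q)" by (intro contraction_mult proj_contraction assms)
  then have "psd n (1\<^sub>m n - P * Q * P)" unfolding eq' by (simp add: contraction_def)
  moreover have "psd n (P * Q * P)" unfolding eq using p q by (intro psd_gram[of _ n]) auto
  ultimately show "test n (P * Q * P)" by (simp add: test_def)
  have "Re (mtrace (\<rho> * (P * Q * P))) = (fro (Q * P * msqrt \<rho>))\<^sup>2"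
    unfolding eq using p q by (subst fro_msqrt_mult[OF densityD(1)[OF assms(1)], of _ n]) auto
  moreover have "1 - 2 * sqrt \<delta> \<le> fro (Q * P * msqrt \<rho>)"
    by (rule fro_two_proj_defect(2)[OF assms(1,4,5,2,3)])
  \<comment> \<open>From \<open>2 * x - 1 \<le> x\<^sup>2\<close>, which holds whatever the sign of
    \<open>1 - 2 * sqrt \<delta>\<close>.\<close>
  moreover have "1 - 4 * sqrt \<delta> \<le> x\<^sup>2" if "1 - 2 * sqrt \<delta> \<le> x" for x
    using that zero_le_power2[of "x - 1"] by (simp add: power2_eq_square algebra_simps)
  ultimately show "1 - 4 * sqrt \<delta> \<le> Re (mtrace (\<rho> * (P * Q * P)))" by simp
qed

text \<open>Cutting first by \<open>Q\<close> and then by \<open>P\<close> gives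
  \<open>P Q \<rho> Q P \<le> a P \<le> a b \<sigma>\<close>. The lost weight is refilled with
  \<open>\<sigma>\<close> itself, so domination survives; this is the summand 1 in
  \<open>a * b + 1\<close>.\<close>

lemma sandwich_smoothing:
  assumes \<rho>: "density n \<rho>" and P: "proj n P" "1 - \<delta> \<le> Re (mtrace (\<rho> * P))"
    and Q: "proj n Q" "1 - \<delta> \<le> Re (mtrace (\<rho> * Q))" and \<sigma>: "density n \<sigma>"
    and c1: "psd n (complex_of_real a \<cdot>\<^sub>m 1\<^sub>m n - Q * \<rho> * Q)" "0 \<le> a"
    and c2: "psd n (complex_of_real b \<cdot>\<^sub>m \<sigma> - P)"
  obtains \<omega> where "density n \<omega>" "trace_dist \<omega> \<rho> \<le> 4 * sqrt \<delta>"
    "psd n (complex_of_real (a * b + 1) \<cdot>\<^sub>m \<sigma> - \<omega>)"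
proof -
  let ?B = "msqrt \<rho>"
  note r = densityD[OF \<rho>] and s = densityD[OF \<sigma>]
  note p = projD[OF P(1)] and q = projD[OF Q(1)]
  note B = psd_carrier[OF msqrt_psd(1)[OF r(1)]] psd_adj[OF msqrt_psd(1)[OF r(1)]]
  note d = fro_two_proj_defect[OF \<rho> P Q]
  define X where "X = P * Q * ?B"
  have X: "X \<in> carrier_mat n n" "dim_row X = n" "dim_col X = n" using p q B by (auto simp: X_def)
  define t where "t = (fro X)\<^sup>2"
  have t1: "t \<le> 1" unfolding t_def using d(3) by (simp add: X_def power_le_one)
  have t2: "1 - t \<le> 4 * sqrt \<delta>"
    using d(2)[folded X_def] zero_le_power2[of "fro X - 1"]
    unfolding t_def by (simp add: power2_eq_square algebra_simps)
  have t0: "0 \<le> t" by (simp add: t_def)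
  define \<omega> where "\<omega> = X * adj X + complex_of_real (1 - t) \<cdot>\<^sub>m \<sigma>"
  have XX: "psd n (X * adj X)" using psd_gram[of "adj X" n n] X by simp
  have trXX: "mtrace (X * adj X) = of_real t" by (simp add: fro_sq' t_def)
  have \<omega>: "density n \<omega>"
    unfolding density_def \<omega>_def using XX psd_smult[OF s(1), of "1 - t"] t1 X s
    by (auto intro!: psd_add simp: mtrace_add mtrace_smult trXX)
  have XXeq: "X * adj X = adj P * (Q * \<rho> * Q) * P"
  proof -
    have "X * adj X = P * (Q * (?B * ?B) * Q) * P"
      using p q B by (simp add: X_def adj_mult mult_assoc_mat)
    then show ?thesis unfolding msqrt_psd(2)[OF r(1)] p(4) .
  qed
  have "trace_dist \<omega> \<rho> \<le> 4 * sqrt \<delta>"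
  proof -
    have M: "\<omega> - \<rho> \<in> carrier_mat n n" using r densityD[OF \<omega>] by auto
    obtain W where W: "contraction n W" and tn: "mtrace ((\<omega> - \<rho>) * W) = of_real (trace_norm (\<omega> - \<rho>))"
      using trace_norm_attained[OF M] .
    note w = contraction_carrier[OF W]
    let ?D = "?B - X"
    \<comment> \<open>The difference of the Gram products telescopes into two terms, each containing
      the small factor \<open>?D\<close>, so Cauchy-Schwarz bounds each by
      \<open>2 * sqrt \<delta>\<close>.\<close>
    have "?D * (adj X * W) + ?B * (adj ?D * W) = \<rho> * W - X * adj X * W"
    proof -
      have "?D * (adj X * W) + ?B * (adj ?D * W) = (?B * (adj X * W) - X * (adj X * W)) + (?B * (?B * W) - ?B * (adj X * W))"
        using X B w by (simp add: mult_minus_mat minus_mult_mat adj_minus)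
      also have "\<dots> = ?B * (?B * W) - X * (adj X * W)"
        using X B w by (intro eq_matI) (auto simp del: index_mult_mat(1))
      also have "?B * (?B * W) = \<rho> * W"
        using B w msqrt_psd(2)[OF r(1)] by (simp add: mult_assoc_mat[symmetric])
      finally show ?thesis using X B w by (simp add: mult_assoc_mat)
    qed
    then have "mtrace (?D * (adj X * W)) + mtrace (?B * (adj ?D * W)) = mtrace (\<rho> * W) - mtrace (X * adj X * W)"
      using X B w r by (subst mtrace_add[symmetric]) (auto simp: mtrace_minus)
    moreover have "mtrace ((\<omega> - \<rho>) * W) =
        mtrace (X * adj X * W) + of_real (1 - t) * mtrace (\<sigma> * W) - mtrace (\<rho> * W)"
      unfolding \<omega>_def using X B w r s
      by (simp add: minus_mult_mat add_mult_mat smult_mult_mat mtrace_add mtrace_minus mtrace_smult)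
    moreover have "z = k + u - r \<Longrightarrow> x + y = r - k \<Longrightarrow> z = u - (x + y)" for z k u r x y :: complex
      by simp
    ultimately have eq: "mtrace ((\<omega> - \<rho>) * W) =
        of_real (1 - t) * mtrace (\<sigma> * W) - (mtrace (?D * (adj X * W)) + mtrace (?B * (adj ?D * W)))"
      by blast
    have b1: "cmod (of_real (1 - t) * mtrace (\<sigma> * W)) \<le> 4 * sqrt \<delta>"
    proof -
      have "cmod (of_real (1 - t) * mtrace (\<sigma> * W)) = (1 - t) * cmod (mtrace (\<sigma> * W))"
        using t1 by (simp add: norm_mult del: of_real_diff)
      also have "\<dots> \<le> (1 - t) * 1"
        using density_trace_contraction_le[OF \<sigma> W] t1 by (intro mult_left_mono) auto
      finally show ?thesis using t2 by simp
    qed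
    have b2: "cmod (mtrace (?D * (adj X * W))) \<le> 2 * sqrt \<delta>"
    proof -
      have "cmod (mtrace (?D * (adj X * W))) \<le> fro ?D * fro (adj X * W)"
        using X B w by (intro trace_mult_le_fro[of _ n n]) auto
      also have "\<dots> \<le> fro ?D * 1"
        using fro_mult_contraction[OF W, of "adj X" n] X d(3)[folded X_def]
        by (intro mult_left_mono) auto
      finally show ?thesis using d(1)[folded X_def] by simp
    qed
    have b3: "cmod (mtrace (?B * (adj ?D * W))) \<le> 2 * sqrt \<delta>"
    proof -
      have "cmod (mtrace (?B * (adj ?D * W))) \<le> fro ?B * fro (adj ?D * W)"
        using X B w by (intro trace_mult_le_fro[of _ n n]) auto
      also have "\<dots> \<le> 1 * fro ?D"
        using fro_mult_contraction[OF W adj_carrier[OF minus_carrier_mat[OF X(1)]], of ?B]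
          fro_msqrt_density[OF \<rho>] by (intro mult_mono) (auto simp del: adj_carrier)
      finally show ?thesis using d(1)[folded X_def] by simp
    qed
    have "trace_norm (\<omega> - \<rho>) \<le> cmod (mtrace ((\<omega> - \<rho>) * W))"
      unfolding tn by simp
    \<comment> \<open>Four units from the refilled weight, two from each telescoped term; the trace
      distance halves the sum.\<close>
    also have "\<dots> \<le> 8 * sqrt \<delta>"
      unfolding eq using b1 b2 b3
      by (smt (verit) norm_triangle_ineq norm_triangle_ineq4)
    finally show ?thesis by (simp add: trace_dist_def)
  qed
  moreover have "psd n (complex_of_real (a * b + 1) \<cdot>\<^sub>m \<sigma> - \<omega>)"
  proof -
    have e1: "psd n (adj P * (complex_of_real a \<cdot>\<^sub>m 1\<^sub>m n - Q * \<rho> * Q) * P)"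
      by (rule psd_conj_adj[OF c1(1) p(1)])
    have e2: "psd n (complex_of_real a \<cdot>\<^sub>m (complex_of_real b \<cdot>\<^sub>m \<sigma> - P))"
      by (rule psd_smult[OF c2 c1(2)])
    have e3: "psd n (complex_of_real t \<cdot>\<^sub>m \<sigma>)" by (rule psd_smult[OF s(1) t0])
    have eq1: "adj P * (complex_of_real a \<cdot>\<^sub>m 1\<^sub>m n - Q * \<rho> * Q) * P = complex_of_real a \<cdot>\<^sub>m P - X * adj X"
      unfolding XXeq using p q r by (simp add: mult_minus_mat minus_mult_mat smult_mult_mat)
    have "complex_of_real (a * b + 1) \<cdot>\<^sub>m \<sigma> - \<omega> =
        adj P * (complex_of_real a \<cdot>\<^sub>m 1\<^sub>m n - Q * \<rho> * Q) * P
        + complex_of_real a \<cdot>\<^sub>m (complex_of_real b \<cdot>\<^sub>m \<sigma> - P) + complex_of_real t \<cdot>\<^sub>m \<sigma>"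
      unfolding eq1 \<omega>_def using p X s
      by (intro eq_matI) (auto simp: algebra_simps simp del: index_mult_mat(1))
    then show ?thesis using psd_add[OF psd_add[OF e1 e2] e3] by simp
  qed
  ultimately show ?thesis using that \<omega> by blast
qed

section \<open>Tensor powers\<close>

lemma div_mod_less:
  fixes i a b :: nat
  assumes "i < a * b"
  shows "i div b < a" "i mod b < b"
  using assms by (auto simp: less_mult_imp_div_less intro!: mod_less_divisor gr0I)

lemma div_mod_eqD:
  fixes i j b :: nat
  shows "i div b = j div b \<Longrightarrow> i mod b = j mod b \<Longrightarrow> i = j"
  by (metis div_mult_mod_eq)

lemma mult_add_less:
  fixes i j a b :: nat
  assumes "i < a" "j < b"
  shows "i * b + j < a * b"
proof -
  have "i * b + j < Suc i * b" using assms by simp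
  also have "\<dots> \<le> a * b" using assms by (intro mult_le_mono1) simp
  finally show ?thesis .
qed

lemma sum_div_mod:
  fixes f :: "nat \<Rightarrow> nat \<Rightarrow> 'a :: comm_monoid_add"
  shows "(\<Sum>i<a * b. f (i div b) (i mod b)) = (\<Sum>i<a. \<Sum>j<b. f i j)"
  unfolding sum.cartesian_product
  by (rule sum.reindex_bij_witness[where i = "\<lambda>(x, y). x * b + y" and j = "\<lambda>k. (k div b, k mod b)"])
    (auto simp: div_mod_less mult_add_less)

lemma dim_kron [simp]: "dim_row (kron A B) = dim_row A * dim_row B" "dim_col (kron A B) = dim_col A * dim_col B"
  by (simp_all add: kron_def)

lemma index_kron [simp]:
  "i < dim_row A * dim_row B \<Longrightarrow> j < dim_col A * dim_col B \<Longrightarrow>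
   kron A B $$ (i, j) = A $$ (i div dim_row B, j div dim_col B) * B $$ (i mod dim_row B, j mod dim_col B)"
  by (simp add: kron_def)

lemma kron_mult:
  assumes "dim_col A = dim_row C" "dim_col B = dim_row D"
  shows "kron A B * kron C D = kron (A * C) (B * D)"
proof (rule eq_matI)
  fix i j assume "i < dim_row (kron (A * C) (B * D))" "j < dim_col (kron (A * C) (B * D))"
  then have i: "i < dim_row A * dim_row B" and j: "j < dim_col C * dim_col D" by auto
  note im = div_mod_less[OF i] and jm = div_mod_less[OF j]
  have "(kron A B * kron C D) $$ (i, j) =
      (\<Sum>k<dim_row C * dim_row D. (A $$ (i div dim_row B, k div dim_row D) * B $$ (i mod dim_row B, k mod dim_row D)) *
        (C $$ (k div dim_row D, j div dim_col D) * D $$ (k mod dim_row D, j mod dim_col D)))"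
    using i j assms by (subst index_mult_sum) auto
  also have "\<dots> = (\<Sum>x<dim_row C. \<Sum>y<dim_row D. (A $$ (i div dim_row B, x) * C $$ (x, j div dim_col D)) *
        (B $$ (i mod dim_row B, y) * D $$ (y, j mod dim_col D)))"
    by (subst sum_div_mod) (simp add: mult_ac)
  also have "\<dots> = kron (A * C) (B * D) $$ (i, j)"
    using i j im jm assms by (simp add: index_mult_sum sum_product del: index_mult_mat(1))
  finally show "(kron A B * kron C D) $$ (i, j) = kron (A * C) (B * D) $$ (i, j)" .
qed (use assms in auto)

lemma adj_kron: "adj (kron A B) = kron (adj A) (adj B)"
  by (rule eq_matI) (auto simp: div_mod_less)

lemma kron_one: "kron (1\<^sub>m a) (1\<^sub>m b) = 1\<^sub>m (a * b)"
proof (rule eq_matI)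
  fix i j assume "i < dim_row (1\<^sub>m (a * b) :: complex mat)" "j < dim_col (1\<^sub>m (a * b) :: complex mat)"
  then show "kron (1\<^sub>m a) (1\<^sub>m b) $$ (i, j) = 1\<^sub>m (a * b) $$ (i, j)"
    by (auto simp: div_mod_less dest: div_mod_eqD)
qed auto

lemma kron_mat_diag: "kron (mat_diag a f) (mat_diag b g) = mat_diag (a * b) (\<lambda>i. f (i div b) * g (i mod b))"
proof (rule eq_matI)
  fix i j assume "i < dim_row (mat_diag (a * b) (\<lambda>i. f (i div b) * g (i mod b)))"
    "j < dim_col (mat_diag (a * b) (\<lambda>i. f (i div b) * g (i mod b)))"
  then show "kron (mat_diag a f) (mat_diag b g) $$ (i, j) = mat_diag (a * b) (\<lambda>i. f (i div b) * g (i mod b)) $$ (i, j)"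
    by (auto simp: div_mod_less mat_diag_def dest: div_mod_eqD)
qed auto

lemma unitary_kron: "unitary a U \<Longrightarrow> unitary b V \<Longrightarrow> unitary (a * b) (kron U V)"
  unfolding unitary_def by (auto simp: adj_kron kron_mult kron_one intro!: carrier_matI)

lemma kron_udiag:
  assumes "unitary a U" "unitary b V"
  shows "kron (udiag a U l) (udiag b V k) = udiag (a * b) (kron U V) (\<lambda>i. l (i div b) * k (i mod b))"
  using unitaryD[OF assms(1)] unitaryD[OF assms(2)]
  by (simp add: udiag_def kron_mult[symmetric] adj_kron kron_mat_diag)

text \<open>A flat index below \<open>d ^ n\<close> is read as a string of \<open>n\<close> digits
  in base \<open>d\<close>: \<open>dprod\<close> is the weight of a string of independent letters,
  and \<open>dsum\<close> adds a letter function along it.\<close>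

fun dprod :: "nat \<Rightarrow> (nat \<Rightarrow> real) \<Rightarrow> nat \<Rightarrow> nat \<Rightarrow> real" where
  "dprod d f 0 i = 1"
| "dprod d f (Suc n) i = f (i div d ^ n) * dprod d f n (i mod d ^ n)"

fun dsum :: "nat \<Rightarrow> (nat \<Rightarrow> real) \<Rightarrow> nat \<Rightarrow> nat \<Rightarrow> real" where
  "dsum d f 0 i = 0"
| "dsum d f (Suc n) i = f (i div d ^ n) + dsum d f n (i mod d ^ n)"

lemma dim_tpow [simp]: "dim_row (tpow A n) = dim_row A ^ n" "dim_col (tpow A n) = dim_col A ^ n"
  by (induction n) auto

lemma tpow_carrier [simp]: "A \<in> carrier_mat a b \<Longrightarrow> tpow A n \<in> carrier_mat (a ^ n) (b ^ n)"
  by (auto intro: carrier_matI)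

lemma tpow_mult: "dim_col A = dim_row B \<Longrightarrow> tpow (A * B) n = tpow A n * tpow B n"
  by (induction n) (auto simp: kron_mult)

lemma adj_tpow: "adj (tpow A n) = tpow (adj A) n"
  by (induction n) (auto simp: adj_kron)

lemma unitary_tpow: "unitary d U \<Longrightarrow> unitary (d ^ n) (tpow U n)"
  by (induction n) (auto simp: unitary_one unitary_kron)

lemma tpow_udiag: "unitary d U \<Longrightarrow> tpow (udiag d U l) n = udiag (d ^ n) (tpow U n) (dprod d l n)"
proof (induction n)
  case 0
  show ?case using udiag_one[OF unitary_one[of 1]] by simp
next
  case (Suc n)
  then show ?case by (simp add: kron_udiag unitary_tpow)
qed

text \<open>\<open>X\<close> itself need not be diagonal. This is why measuring copies of
  \<open>\<rho>\<close> in the product eigenbasis of \<open>\<sigma>\<close> yields independent,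
  identically distributed outcomes.\<close>

lemma index_tpow_diag:
  assumes "X \<in> carrier_mat d d" "\<And>i. i < d \<Longrightarrow> X $$ (i, i) = complex_of_real (q i)" "i < d ^ n"
  shows "tpow X n $$ (i, i) = complex_of_real (dprod d q n i)"
  using assms(3)
proof (induction n arbitrary: i)
  case (Suc n)
  then have "i < d * d ^ n" by simp
  from div_mod_less[OF this] this show ?case
    using assms(1,2) Suc.IH[of "i mod d ^ n"] by simp
qed simp

lemma dprod_nonneg:
  assumes "\<And>i. i < d \<Longrightarrow> 0 \<le> p i" "i < d ^ n"
  shows "0 \<le> dprod d p n i"
  using assms(2)
proof (induction n arbitrary: i)
  case (Suc n)
  then have "i < d * d ^ n" by simp
  from div_mod_less[OF this] show ?case using Suc.IH assms(1) by simp
qed simp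

lemma sum_dprod: "(\<Sum>i<d ^ n. dprod d p n i) = (\<Sum>i<d. p i) ^ n"
  by (induction n) (simp_all add: sum_div_mod[of "\<lambda>x y. p x * dprod d p _ y"] sum_product[symmetric])

lemma density_tpow:
  assumes "density d \<rho>"
  shows "density (d ^ n) (tpow \<rho> n)"
proof -
  note r = densityD[OF assms]
  obtain U l where U: "unitary d U" and \<rho>: "\<rho> = udiag d U l" using spectral_theorem[OF r(3,6)] .
  have l: "0 \<le> l i" if "i < d" for i using psd_udiag_nonneg[OF U] r(1) \<rho> that by auto
  have "complex_of_real (\<Sum>i<d. l i) = 1" using r(2) unfolding \<rho> mtrace_udiag[OF U] .
  then have "(\<Sum>i<d. l i) = 1" unfolding of_real_eq_1_iff .
  then show ?thesis
    unfolding density_def \<rho> tpow_udiag[OF U] mtrace_udiag[OF unitary_tpow[OF U]] sum_dprod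
    by (auto intro!: psd_udiag unitary_tpow U dprod_nonneg l)
qed

section \<open>The weak law of large numbers for product weights\<close>

lemma sum_dprod_dsum:
  assumes "(\<Sum>i<d. p i) = 1" "(\<Sum>i<d. p i * h i) = 0"
  shows "(\<Sum>i<d ^ n. dprod d p n i * dsum d h n i) = 0"
proof (induction n)
  case (Suc n)
  have "(\<Sum>i<d ^ Suc n. dprod d p (Suc n) i * dsum d h (Suc n) i) =
      (\<Sum>x<d. \<Sum>y<d ^ n. p x * dprod d p n y * (h x + dsum d h n y))"
    by (simp add: sum_div_mod[of "\<lambda>x y. p x * dprod d p n y * (h x + dsum d h n y)"])
  also have "\<dots> = (\<Sum>x<d. \<Sum>y<d ^ n. (p x * h x) * dprod d p n y + p x * (dprod d p n y * dsum d h n y))"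
    by (intro sum.cong refl) (simp add: algebra_simps)
  also have "\<dots> = (\<Sum>x<d. p x * h x) * (\<Sum>y<d ^ n. dprod d p n y) +
      (\<Sum>x<d. p x) * (\<Sum>y<d ^ n. dprod d p n y * dsum d h n y)"
    by (simp add: sum.distrib sum_product)
  finally show ?case using Suc assms by simp
qed simp

text \<open>Variances of independent letters add: in the expanded square the cross term carries the
  mean of \<open>h\<close>, which is zero.\<close>

lemma sum_dprod_dsum_sq:
  assumes "(\<Sum>i<d. p i) = 1" "(\<Sum>i<d. p i * h i) = 0"
  shows "(\<Sum>i<d ^ n. dprod d p n i * (dsum d h n i)\<^sup>2) = n * (\<Sum>i<d. p i * (h i)\<^sup>2)"
proof (induction n)
  case (Suc n)
  have "(\<Sum>i<d ^ Suc n. dprod d p (Suc n) i * (dsum d h (Suc n) i)\<^sup>2) =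
      (\<Sum>x<d. \<Sum>y<d ^ n. p x * dprod d p n y * (h x + dsum d h n y)\<^sup>2)"
    by (simp add: sum_div_mod[of "\<lambda>x y. p x * dprod d p n y * (h x + dsum d h n y)\<^sup>2"])
  also have "\<dots> = (\<Sum>x<d. \<Sum>y<d ^ n. (p x * (h x)\<^sup>2) * dprod d p n y + ((2 * (p x * h x)) * (dprod d p n y * dsum d h n y)
        + p x * (dprod d p n y * (dsum d h n y)\<^sup>2)))"
    by (intro sum.cong refl) (simp add: algebra_simps power2_eq_square)
  also have "\<dots> = (\<Sum>x<d. p x * (h x)\<^sup>2) * (\<Sum>y<d ^ n. dprod d p n y) +
      ((\<Sum>x<d. 2 * (p x * h x)) * (\<Sum>y<d ^ n. dprod d p n y * dsum d h n y) +
      (\<Sum>x<d. p x) * (\<Sum>y<d ^ n. dprod d p n y * (dsum d h n y)\<^sup>2))"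
    by (simp only: sum.distrib sum_product)
  finally show ?case using Suc assms by (simp add: sum_dprod sum_dprod_dsum algebra_simps)
qed simp

lemma dsum_shift: "dsum d (\<lambda>i. g i - m) n i = dsum d g n i - n * m"
  by (induction n arbitrary: i) (auto simp: algebra_simps)

text \<open>Eigenvalues of \<open>\<rho>\<close> may vanish, so the logarithm is taken only on
  strings of positive weight: all their letters have positive \<open>p\<close>, hence positive
  \<open>l\<close>.\<close>

lemma dprod_eq_powr_dsum:
  assumes p: "\<And>i. i < d \<Longrightarrow> 0 \<le> p i" and l: "\<And>i. i < d \<Longrightarrow> 0 < p i \<Longrightarrow> 0 < l i"
    and "i < d ^ n" "0 < dprod d p n i"
  shows "dprod d l n i = 2 powr dsum d (\<lambda>j. log 2 (l j)) n i"
  using assms(3,4)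
proof (induction n arbitrary: i)
  case (Suc n)
  then have "i < d * d ^ n" by simp
  note dm = div_mod_less[OF this]
  have "0 < p (i div d ^ n)" "0 < dprod d p n (i mod d ^ n)"
    using Suc.prems(2) p[OF dm(1)] dprod_nonneg[OF p dm(2)] by (auto simp: zero_less_mult_iff)
  with Suc.IH[OF dm(2)] l[OF dm(1)] show ?case by (simp add: powr_add)
qed simp

text \<open>Typicality constrains the eigenvalue rather than the letter frequencies, so the operator
  bounds on both sides of the window can be read off directly.\<close>

definition typical :: "nat \<Rightarrow> (nat \<Rightarrow> real) \<Rightarrow> real \<Rightarrow> real \<Rightarrow> nat \<Rightarrow> nat set" where
  "typical d l m \<eta> n = {i. 2 powr (n * (m - \<eta>)) \<le> dprod d l n i \<and> dprod d l n i \<le> 2 powr (n * (m + \<eta>))}"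

text \<open>Chebyshev's inequality. Weights \<open>p\<close> and eigenvalues \<open>l\<close> are
  separate because for \<open>\<sigma>\<close> the strings are weighted by the measured
  probabilities of \<open>\<rho>\<close>, not by the eigenvalues of \<open>\<sigma>\<close>.\<close>

lemma typical_weight:
  assumes p: "\<And>i. i < d \<Longrightarrow> 0 \<le> p i" "(\<Sum>i<d. p i) = 1" and l: "\<And>i. i < d \<Longrightarrow> 0 < p i \<Longrightarrow> 0 < l i"
    and m: "m = (\<Sum>i<d. p i * log 2 (l i))" and "0 < \<eta>" "0 < \<delta>"
  shows "\<forall>\<^sub>F n in sequentially. 1 - \<delta> \<le> (\<Sum>i<d ^ n. dprod d p n i * indicator (typical d l m \<eta> n) i)"
proof -
  define h where "h i = log 2 (l i) - m" for i
  have h0: "(\<Sum>i<d. p i * h i) = 0"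
    by (simp add: h_def right_diff_distrib sum_subtractf sum_distrib_right[symmetric] p(2) m[symmetric])
  define V where "V = (\<Sum>i<d. p i * (h i)\<^sup>2)"
  have V: "0 \<le> V" unfolding V_def using p by (intro sum_nonneg) auto
  show ?thesis
  \<comment> \<open>The Chebyshev bound is \<open>V / (n * \<eta>\<^sup>2)\<close>, at most
    \<open>\<delta>\<close> from this threshold on; \<open>Suc\<close> keeps \<open>n\<close>
    positive.\<close>
  proof (rule eventually_sequentiallyI[of "Suc (nat \<lceil>V / (\<eta>\<^sup>2 * \<delta>)\<rceil>)"])
    fix n assume "Suc (nat \<lceil>V / (\<eta>\<^sup>2 * \<delta>)\<rceil>) \<le> n"
    then have n: "0 < n" "V / (\<eta>\<^sup>2 * \<delta>) \<le> n" by linarith+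
    let ?e = "(n * \<eta>)\<^sup>2"
    have e: "0 < ?e" using n assms by simp
    have "dprod d p n i - dprod d p n i * indicator (typical d l m \<eta> n) i \<le> dprod d p n i * (dsum d h n i)\<^sup>2 / ?e"
      if i: "i < d ^ n" for i
    proof (cases "i \<in> typical d l m \<eta> n \<or> dprod d p n i = 0")
      case True
      moreover have "0 \<le> dprod d p n i" by (rule dprod_nonneg) (use p i in auto)
      ultimately show ?thesis by auto
    next
      case False
      moreover have "0 \<le> dprod d p n i" by (rule dprod_nonneg) (use p i in auto)
      ultimately have pos: "0 < dprod d p n i" by simp
      have "dprod d l n i = 2 powr (n * m + dsum d h n i)"
      proof -
        have "dprod d l n i = 2 powr dsum d (\<lambda>j. log 2 (l j)) n i"
          by (rule dprod_eq_powr_dsum[of d p]) (use p l i pos in auto)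
        then show ?thesis by (simp add: h_def[abs_def] dsum_shift)
      qed
      then have "\<not> (n * (m - \<eta>) \<le> n * m + dsum d h n i \<and> n * m + dsum d h n i \<le> n * (m + \<eta>))"
        using False by (simp add: typical_def)
      then have "n * \<eta> \<le> \<bar>dsum d h n i\<bar>" by (auto simp: algebra_simps)
      then have "?e \<le> (dsum d h n i)\<^sup>2"
        using n assms by (metis abs_le_square_iff abs_of_nonneg mult_nonneg_nonneg of_nat_0_le_iff less_imp_le)
      then have "dprod d p n i * 1 \<le> dprod d p n i * ((dsum d h n i)\<^sup>2 / ?e)"
        using e pos by (intro mult_left_mono) auto
      then show ?thesis using False by simp
    qed
    then have "(\<Sum>i<d ^ n. dprod d p n i - dprod d p n i * indicator (typical d l m \<eta> n) i) \<le>
        (\<Sum>i<d ^ n. dprod d p n i * (dsum d h n i)\<^sup>2 / ?e)"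
      by (intro sum_mono) auto
    also have "\<dots> = n * V / ?e"
      by (simp only: sum_divide_distrib[symmetric] sum_dprod_dsum_sq[OF p(2) h0] V_def)
    also have "\<dots> \<le> \<delta>"
      using n assms by (simp add: field_simps power2_eq_square)
    finally show "1 - \<delta> \<le> (\<Sum>i<d ^ n. dprod d p n i * indicator (typical d l m \<eta> n) i)"
      by (simp add: sum_subtractf sum_dprod p(2))
  qed
qed

section \<open>Relative entropy\<close>

text \<open>This is \<open>ln z \<le> z - 1\<close> at \<open>z = y / x\<close>, with its equality
  case. At \<open>x = 0\<close> the factor \<open>x\<close> removes the logarithms.\<close>

lemma mult_ln_diff_ge:
  fixes x y :: real
  assumes "0 \<le> x" "0 < y"
  shows "x - y \<le> x * (ln x - ln y)" "x - y = x * (ln x - ln y) \<Longrightarrow> x = y"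
proof -
  have "x - y \<le> x * (ln x - ln y) \<and> (x - y = x * (ln x - ln y) \<longrightarrow> x = y)"
  proof (cases "x = 0")
    case False
    then have x: "0 < x" using assms by simp
    have le: "ln (y / x) \<le> y / x - 1" using x assms by (intro ln_le_minus_one) auto
    have eq: "x * (ln x - ln y) = - (x * ln (y / x))" "x - y = - (x * (y / x - 1))"
      using x assms by (simp_all add: ln_div field_simps)
    show ?thesis
      unfolding eq using le x assms ln_eq_minus_one[of "y / x"] by auto
  qed (use assms in auto)
  then show "x - y \<le> x * (ln x - ln y)" "x - y = x * (ln x - ln y) \<Longrightarrow> x = y" by auto
qed

text \<open>Klein's inequality with its equality case. The squared overlaps of the two eigenbases
  form a doubly stochastic matrix \<open>c\<close>, which turns the relative entropy into a
  \<open>c\<close>-average of scalar terms; \<open>q\<close> is the outcome distribution of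
  \<open>\<rho>\<close> in the eigenbasis of \<open>\<sigma>\<close>.\<close>

lemma relative_entropy_spectral:
  assumes \<rho>: "density d \<rho>" and \<sigma>: "density d \<sigma>" and fs: "full_support d \<sigma>"
  obtains U l V k q where
    "unitary d U" "\<rho> = udiag d U l" "unitary d V" "\<sigma> = udiag d V k"
    "\<And>i. i < d \<Longrightarrow> 0 \<le> l i" "(\<Sum>i<d. l i) = 1" "\<And>i. i < d \<Longrightarrow> 0 < k i"
    "\<And>i. i < d \<Longrightarrow> (adj V * \<rho> * V) $$ (i, i) = complex_of_real (q i)"
    "\<And>i. i < d \<Longrightarrow> 0 \<le> q i" "(\<Sum>i<d. q i) = 1"
    "rel_entropy \<rho> \<sigma> = (\<Sum>i<d. l i * log 2 (l i)) - (\<Sum>i<d. q i * log 2 (k i))"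
    "0 \<le> rel_entropy \<rho> \<sigma>" "rel_entropy \<rho> \<sigma> = 0 \<Longrightarrow> \<rho> = \<sigma>"
proof -
  note r = densityD[OF \<rho>] and s = densityD[OF \<sigma>]
  obtain U l where U: "unitary d U" and \<rho>U: "\<rho> = udiag d U l"
    and fU: "\<And>f. mat_fun f \<rho> = udiag d U (\<lambda>i. f (l i))"
    by (rule mat_fun_spectral[OF r(3,6)]) blast
  obtain V k where V: "unitary d V" and \<sigma>V: "\<sigma> = udiag d V k"
    and fV: "\<And>f. mat_fun f \<sigma> = udiag d V (\<lambda>i. f (k i))"
    by (rule mat_fun_spectral[OF s(3,6)]) blast
  note Ud = unitaryD[OF U] and Vd = unitaryD[OF V]
  have l0: "0 \<le> l i" if "i < d" for i using psd_udiag_nonneg[OF U] r(1) \<rho>U that by auto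
  have "complex_of_real (\<Sum>i<d. l i) = 1" using r(2) unfolding \<rho>U mtrace_udiag[OF U] .
  then have l1: "(\<Sum>i<d. l i) = 1" unfolding of_real_eq_1_iff .
  have "complex_of_real (\<Sum>i<d. k i) = 1" using s(2) unfolding \<sigma>V mtrace_udiag[OF V] .
  then have k1: "(\<Sum>i<d. k i) = 1" unfolding of_real_eq_1_iff .
  have k0: "0 < k i" if i: "i < d" for i
  proof -
    have "0 \<le> k i" using psd_udiag_nonneg[OF V] s(1) \<sigma>V that by auto
    \<comment> \<open>Otherwise column \<open>i\<close> of \<open>V\<close> lies in the kernel of
      \<open>\<sigma>\<close> and vanishes, contradicting its unit length.\<close>
    moreover have "k i \<noteq> 0"
    proof
      assume ki: "k i = 0"
      have "col (\<sigma> * V) i = \<sigma> *\<^sub>v col V i" using s Vd i by (intro col_mult2) auto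
      moreover have "\<sigma> * V = V * mat_diag d (\<lambda>i. complex_of_real (k i))"
        unfolding \<sigma>V udiag_def using Vd by (simp add: mult_assoc_mat)
      then have "col (\<sigma> * V) i = 0\<^sub>v d"
        using Vd i ki by (intro eq_vecI) (auto simp: mat_diag_mult_right[of V d d])
      ultimately have "col V i = 0\<^sub>v d"
        using fs Vd i unfolding full_support_def by (metis col_carrier_vec carrier_matD)
      moreover have "(adj V * V) $$ (i, i) = row (adj V) i \<bullet> col V i"
        using Vd i by (intro index_mult_mat(1)) auto
      ultimately have "(adj V * V) $$ (i, i) = 0"
        using Vd i by (simp add: scalar_prod_right_zero[of _ d] carrier_vecI)
      then show False using Vd(5) i by simp
    qed
    ultimately show ?thesis by simp
  qed
  define W where "W = adj U * V"
  have W: "unitary d W" unfolding W_def by (intro unitary_mult unitary_adj U V)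
  note Wd = unitaryD[OF W]
  define c where "c i j = (cmod (W $$ (i, j)))\<^sup>2" for i j
  have c0: "0 \<le> c i j" for i j by (simp add: c_def)
  have cc: "(\<Sum>i<d. c i j) = 1" if "j < d" for j
    using index_gram_diag[of j W] that Wd unfolding c_def
    by (simp del: of_real_sum of_real_power)
  have cr: "(\<Sum>j<d. c i j) = 1" if "i < d" for i
    using index_gram_diag[of i "adj W"] that Wd unfolding c_def
    by (simp del: of_real_sum of_real_power)
  define q where "q j = (\<Sum>i<d. c i j * l i)" for j
  have q: "(adj V * \<rho> * V) $$ (j, j) = complex_of_real (q j)" if "j < d" for j
  proof -
    have "adj V * \<rho> * V = adj W * (mat_diag d (\<lambda>i. complex_of_real (l i)) * W)"
      unfolding \<rho>U udiag_def W_def using Ud Vd by (simp add: adj_mult mult_assoc_mat)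
    also have "\<dots> $$ (j, j) = (\<Sum>i<d. cnj (W $$ (i, j)) * (complex_of_real (l i) * W $$ (i, j)))"
      using that Wd by (simp add: index_mult_sum[of _ "adj W"] index_mat_diag_mult del: index_mult_mat(1))
    also have "\<dots> = (\<Sum>i<d. complex_of_real (c i j * l i))"
      by (intro sum.cong) (auto simp: c_def cnj_mult_self[symmetric] mult_ac simp del: of_real_power)
    finally show ?thesis by (simp add: q_def)
  qed
  have q0: "0 \<le> q j" for j unfolding q_def using c0 l0 by (intro sum_nonneg) auto
  have q1: "(\<Sum>j<d. q j) = 1"
    unfolding q_def by (subst sum.swap) (simp add: sum_distrib_right[symmetric] cr l1)
  have D: "rel_entropy \<rho> \<sigma> = (\<Sum>i<d. l i * log 2 (l i)) - (\<Sum>j<d. q j * log 2 (k j))"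
  proof -
    have "mtrace (\<rho> * (mlog \<rho> - mlog \<sigma>)) = mtrace (\<rho> * mlog \<rho>) - mtrace (mlog \<sigma> * \<rho>)"
      unfolding mlog_def fU fV using r Ud Vd
      by (simp add: mult_minus_mat mtrace_minus mtrace_comm[of \<rho> "udiag d V (\<lambda>i. log 2 (k i))"])
    also have "mtrace (\<rho> * mlog \<rho>) = complex_of_real (\<Sum>i<d. l i * log 2 (l i))"
      unfolding mlog_def fU unfolding \<rho>U udiag_mult[OF U] mtrace_udiag[OF U] ..
    also have "mtrace (mlog \<sigma> * \<rho>) = complex_of_real (\<Sum>j<d. q j * log 2 (k j))"
      unfolding mlog_def fV mtrace_udiag_mult[OF V r(3)] by (simp add: q mult.commute)
    finally show ?thesis unfolding rel_entropy_def by simp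
  qed
  \<comment> \<open>The subtracted differences sum to zero, since both traces are one; including
    them makes every summand nonnegative.\<close>
  define g where "g i j = c i j * (l i * (ln (l i) - ln (k j)) - (l i - k j))" for i j
  have g0: "0 \<le> g i j" if "i < d" "j < d" for i j
    unfolding g_def using c0 mult_ln_diff_ge(1)[OF l0[OF that(1)] k0[OF that(2)]] by simp
  have Dg: "rel_entropy \<rho> \<sigma> * ln 2 = (\<Sum>i<d. \<Sum>j<d. g i j)"
  proof -
    have "(\<Sum>i<d. \<Sum>j<d. g i j) =
        (\<Sum>i<d. \<Sum>j<d. c i j * (l i * ln (l i))) - (\<Sum>i<d. \<Sum>j<d. c i j * l i * ln (k j))
        - ((\<Sum>i<d. \<Sum>j<d. c i j * l i) - (\<Sum>i<d. \<Sum>j<d. c i j * k j))"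
      unfolding g_def by (simp add: sum_subtractf[symmetric] algebra_simps)
    also have "(\<Sum>i<d. \<Sum>j<d. c i j * (l i * ln (l i))) = (\<Sum>i<d. l i * ln (l i))"
      by (simp add: sum_distrib_right[symmetric] cr)
    also have "(\<Sum>i<d. \<Sum>j<d. c i j * l i * ln (k j)) = (\<Sum>j<d. q j * ln (k j))"
      unfolding q_def sum_distrib_right by (rule sum.swap)
    also have "(\<Sum>i<d. \<Sum>j<d. c i j * l i) = 1"
      by (simp add: sum_distrib_right[symmetric] cr l1)
    also have "(\<Sum>i<d. \<Sum>j<d. c i j * k j) = 1"
      by (subst sum.swap) (simp add: sum_distrib_right[symmetric] cc k1)
    finally show ?thesis
      unfolding D log_def by (simp add: left_diff_distrib sum_distrib_right)
  qed
  have Dnn: "0 \<le> rel_entropy \<rho> \<sigma>"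
  proof -
    have "0 \<le> rel_entropy \<rho> \<sigma> * ln 2" unfolding Dg using g0 by (intro sum_nonneg) auto
    then show ?thesis by (simp add: zero_le_mult_iff)
  qed
  have "\<rho> = \<sigma>" if "rel_entropy \<rho> \<sigma> = 0"
  proof -
    have "(\<Sum>i<d. \<Sum>j<d. g i j) = 0" using Dg that by simp
    then have "\<forall>i<d. (\<Sum>j<d. g i j) = 0"
      using g0 by (subst (asm) sum_nonneg_eq_0_iff) (auto intro: sum_nonneg)
    then have gz: "g i j = 0" if "i < d" "j < d" for i j
      using g0 that sum_nonneg_eq_0_iff[of "{..<d}" "g i"] by auto
    \<comment> \<open>A vanishing summand means a zero overlap or equal eigenvalues; either way
      \<open>W\<close> intertwines the two diagonal matrices.\<close>
    have "complex_of_real (l i) * W $$ (i, j) = W $$ (i, j) * complex_of_real (k j)" if "i < d" "j < d" for i j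
      using gz[OF that] mult_ln_diff_ge(2)[OF l0[OF that(1)] k0[OF that(2)]]
      by (auto simp: g_def c_def)
    then have comm: "mat_diag d (\<lambda>i. complex_of_real (l i)) * W = W * mat_diag d (\<lambda>i. complex_of_real (k i))"
      using Wd by (intro eq_matI) (auto simp: mat_diag_mult_left[of W d d] mat_diag_mult_right[of W d d])
    have "\<rho> = U * (mat_diag d (\<lambda>i. complex_of_real (l i)) * W) * adj V"
      unfolding \<rho>U udiag_def W_def using Ud Vd by (simp add: mult_assoc_mat)
    also have "\<dots> = \<sigma>"
      unfolding comm unfolding \<sigma>V udiag_def W_def using Ud Vd by (simp add: mult_assoc_mat unitary_cancel[OF U])
    finally show ?thesis .
  qed
  with that[OF U \<rho>U V \<sigma>V l0 l1 k0 q q0 q1 D Dnn] show ?thesis by blast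
qed

section \<open>Stein's lemma: tests and smoothing\<close>

lemma proj_udiag_indicator: "unitary n U \<Longrightarrow> proj n (udiag n U (indicator S))"
  by (simp add: proj_def udiag_mult indicator_def) (rule udiag_cong, simp)

text \<open>Here \<open>s\<close> and \<open>t\<close> are the traces of
  \<open>\<rho> log \<rho>\<close> and \<open>\<rho> log \<sigma>\<close>. The upper edge of each
  window bounds the cut-down operator; the lower edge bounds the projection, by counting for
  \<open>Q\<close> and by \<open>\<sigma>\<close> itself for \<open>P\<close>.\<close>

lemma stein_projections:
  fixes \<eta> \<delta> :: real
  assumes \<rho>: "density d \<rho>" and \<sigma>: "density d \<sigma>" and fs: "full_support d \<sigma>" and "0 < \<eta>" "0 < \<delta>"
  obtains s t :: real where "rel_entropy \<rho> \<sigma> = s - t"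
    "\<forall>\<^sub>F n in sequentially. \<exists>P Q. proj (d ^ n) P \<and> proj (d ^ n) Q \<and>
      1 - \<delta> \<le> Re (mtrace (tpow \<rho> n * P)) \<and> 1 - \<delta> \<le> Re (mtrace (tpow \<rho> n * Q)) \<and>
      psd (d ^ n) (complex_of_real (2 powr (n * (t + \<eta>))) \<cdot>\<^sub>m 1\<^sub>m (d ^ n) - P * tpow \<sigma> n * P) \<and>
      Re (mtrace Q) \<le> 2 powr - (n * (s - \<eta>)) \<and>
      psd (d ^ n) (complex_of_real (2 powr (n * (s + \<eta>))) \<cdot>\<^sub>m 1\<^sub>m (d ^ n) - Q * tpow \<rho> n * Q) \<and>
      psd (d ^ n) (complex_of_real (2 powr - (n * (t - \<eta>))) \<cdot>\<^sub>m tpow \<sigma> n - P)"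
proof -
  obtain U l V k q where U: "unitary d U" and \<rho>U: "\<rho> = udiag d U l" and V: "unitary d V" and \<sigma>V: "\<sigma> = udiag d V k"
    and l: "\<And>i. i < d \<Longrightarrow> 0 \<le> l i" "(\<Sum>i<d. l i) = 1" and k: "\<And>i. i < d \<Longrightarrow> 0 < k i"
    and qd: "\<And>i. i < d \<Longrightarrow> (adj V * \<rho> * V) $$ (i, i) = complex_of_real (q i)"
    and q: "\<And>i. i < d \<Longrightarrow> 0 \<le> q i" "(\<Sum>i<d. q i) = 1"
    and D: "rel_entropy \<rho> \<sigma> = (\<Sum>i<d. l i * log 2 (l i)) - (\<Sum>i<d. q i * log 2 (k i))"
    by (rule relative_entropy_spectral[OF \<rho> \<sigma> fs]) blast
  define s where "s = (\<Sum>i<d. l i * log 2 (l i))"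
  define t where "t = (\<Sum>i<d. q i * log 2 (k i))"
  note r = densityD[OF \<rho>]
  show ?thesis
  proof (rule that[of s t])
    show "rel_entropy \<rho> \<sigma> = s - t" by (simp add: D s_def t_def)
    have e1: "\<forall>\<^sub>F n in sequentially. 1 - \<delta> \<le> (\<Sum>i<d ^ n. dprod d l n i * indicator (typical d l s \<eta> n) i)"
      by (rule typical_weight[OF l _ s_def assms(4,5)])
    have e2: "\<forall>\<^sub>F n in sequentially. 1 - \<delta> \<le> (\<Sum>i<d ^ n. dprod d q n i * indicator (typical d k t \<eta> n) i)"
      by (rule typical_weight[OF q k t_def assms(4,5)])
    show "\<forall>\<^sub>F n in sequentially. \<exists>P Q. proj (d ^ n) P \<and> proj (d ^ n) Q \<and>
      1 - \<delta> \<le> Re (mtrace (tpow \<rho> n * P)) \<and> 1 - \<delta> \<le> Re (mtrace (tpow \<rho> n * Q)) \<and>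
      psd (d ^ n) (complex_of_real (2 powr (n * (t + \<eta>))) \<cdot>\<^sub>m 1\<^sub>m (d ^ n) - P * tpow \<sigma> n * P) \<and>
      Re (mtrace Q) \<le> 2 powr - (n * (s - \<eta>)) \<and>
      psd (d ^ n) (complex_of_real (2 powr (n * (s + \<eta>))) \<cdot>\<^sub>m 1\<^sub>m (d ^ n) - Q * tpow \<rho> n * Q) \<and>
      psd (d ^ n) (complex_of_real (2 powr - (n * (t - \<eta>))) \<cdot>\<^sub>m tpow \<sigma> n - P)"
      using e1 e2
    proof eventually_elim
      case (elim n)
      let ?N = "d ^ n"
      have Un: "unitary ?N (tpow U n)" and Vn: "unitary ?N (tpow V n)" by (intro unitary_tpow U V)+
      have \<rho>n: "tpow \<rho> n = udiag ?N (tpow U n) (dprod d l n)" and \<sigma>n: "tpow \<sigma> n = udiag ?N (tpow V n) (dprod d k n)"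
        unfolding \<rho>U \<sigma>V by (intro tpow_udiag U V)+
      let ?T = "typical d k t \<eta> n" and ?S = "typical d l s \<eta> n"
      define P where "P = udiag ?N (tpow V n) (indicator ?T)"
      define Q where "Q = udiag ?N (tpow U n) (indicator ?S)"
      have P: "proj ?N P" and Q: "proj ?N Q" unfolding P_def Q_def by (intro proj_udiag_indicator Un Vn)+
      have ln: "0 \<le> dprod d l n i" and kn: "0 \<le> dprod d k n i" if "i < ?N" for i
        by (rule dprod_nonneg[OF _ that]; use l k in \<open>auto intro: less_imp_le\<close>)+
      \<comment> \<open>The trace against \<open>P\<close> sees only the diagonal of this tensor
        power, whose entries are products of \<open>q\<close>.\<close>
      have diag: "adj (tpow V n) * tpow \<rho> n * tpow V n = tpow (adj V * \<rho> * V) n"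
        using unitaryD[OF V] r by (simp add: tpow_mult adj_tpow)
      have "mtrace (tpow \<rho> n * P) = mtrace (P * tpow \<rho> n)"
        using r unitaryD[OF Vn] by (intro mtrace_comm) (auto simp: P_def)
      also have "\<dots> = (\<Sum>i<?N. complex_of_real (indicator ?T i) * complex_of_real (dprod d q n i))"
        unfolding P_def mtrace_udiag_mult[OF Vn tpow_carrier[OF r(3)]] diag
        using unitaryD[OF V] r qd
        by (intro sum.cong refl arg_cong2[where f = "(*)"] index_tpow_diag[of _ d]) auto
      finally have t1: "1 - \<delta> \<le> Re (mtrace (tpow \<rho> n * P))"
        using elim(2) by (simp add: mult.commute)
      have t2: "1 - \<delta> \<le> Re (mtrace (tpow \<rho> n * Q))"
        unfolding \<rho>n Q_def udiag_mult[OF Un] mtrace_udiag[OF Un] using elim(1) by simp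
      have p1: "psd ?N (complex_of_real (2 powr (n * (t + \<eta>))) \<cdot>\<^sub>m 1\<^sub>m ?N - P * tpow \<sigma> n * P)"
        unfolding P_def \<sigma>n udiag_one[OF Vn, symmetric] udiag_mult[OF Vn] udiag_smult[OF Vn] udiag_minus[OF Vn]
        by (rule psd_udiag[OF Vn]) (auto simp: indicator_def typical_def)
      have p3: "psd ?N (complex_of_real (2 powr (n * (s + \<eta>))) \<cdot>\<^sub>m 1\<^sub>m ?N - Q * tpow \<rho> n * Q)"
        unfolding Q_def \<rho>n udiag_one[OF Un, symmetric] udiag_mult[OF Un] udiag_smult[OF Un] udiag_minus[OF Un]
        by (rule psd_udiag[OF Un]) (auto simp: indicator_def typical_def)
      have p4: "psd ?N (complex_of_real (2 powr - (n * (t - \<eta>))) \<cdot>\<^sub>m tpow \<sigma> n - P)"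
        unfolding P_def \<sigma>n udiag_smult[OF Vn] udiag_minus[OF Vn]
      proof (rule psd_udiag[OF Vn])
        fix i assume "i < ?N"
        have "1 \<le> 2 powr - (n * (t - \<eta>)) * dprod d k n i" if "i \<in> ?T"
        proof -
          have "2 powr - (n * (t - \<eta>)) * 2 powr (n * (t - \<eta>)) \<le> 2 powr - (n * (t - \<eta>)) * dprod d k n i"
            using that by (intro mult_left_mono) (auto simp: typical_def)
          then show ?thesis by (simp add: powr_add[symmetric])
        qed
        then show "0 \<le> 2 powr - (n * (t - \<eta>)) * dprod d k n i - indicator ?T i"
          using kn[OF \<open>i < ?N\<close>] by (auto simp: indicator_def)
      qed
      have p2: "Re (mtrace Q) \<le> 2 powr - (n * (s - \<eta>))"
      proof -
        have "Re (mtrace Q) = (\<Sum>i<?N. indicator ?S i)"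
          unfolding Q_def mtrace_udiag[OF Un] by simp
        \<comment> \<open>Each typical eigenvalue takes at least
          \<open>2 powr (n * (s - \<eta>))\<close> of a total weight of one, which limits their
          number.\<close>
        also have "\<dots> \<le> (\<Sum>i<?N. 2 powr - (n * (s - \<eta>)) * dprod d l n i)"
        proof (rule sum_mono)
          fix i assume "i \<in> {..<?N}"
          then have "0 \<le> dprod d l n i" using ln by simp
          moreover have "1 \<le> 2 powr - (n * (s - \<eta>)) * dprod d l n i" if "i \<in> ?S"
          proof -
            have "2 powr - (n * (s - \<eta>)) * 2 powr (n * (s - \<eta>)) \<le> 2 powr - (n * (s - \<eta>)) * dprod d l n i"
              using that by (intro mult_left_mono) (auto simp: typical_def)
            then show ?thesis by (simp add: powr_add[symmetric])
          qed
          ultimately show "indicator ?S i \<le> 2 powr - (n * (s - \<eta>)) * dprod d l n i"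
            by (auto simp: indicator_def)
        qed
        also have "\<dots> = 2 powr - (n * (s - \<eta>))"
          by (simp add: sum_distrib_left[symmetric] sum_dprod l(2))
        finally show ?thesis .
      qed
      show ?case using P Q t1 t2 p1 p2 p3 p4 by blast
    qed
  qed
qed

lemma stein_direct:
  fixes a \<delta> :: real
  assumes \<rho>: "density d \<rho>" and \<sigma>: "density d \<sigma>" and fs: "full_support d \<sigma>"
    and a: "a < rel_entropy \<rho> \<sigma>" and \<delta>: "0 < \<delta>"
  shows "\<forall>\<^sub>F n in sequentially. \<exists>Q. test (d ^ n) Q \<and> 1 - \<delta> \<le> Re (mtrace (tpow \<rho> n * Q)) \<and>
    Re (mtrace (tpow \<sigma> n * Q)) \<le> 2 powr - (n * a)"
proof -
  \<comment> \<open>The two windows cost \<open>\<eta>\<close> each in the exponent, which lowers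
    the relative entropy exactly to \<open>a\<close>. The projection defect below is the square of
    \<open>\<delta> / 4\<close> because the sandwich loses four times its root.\<close>
  define \<eta> where "\<eta> = (rel_entropy \<rho> \<sigma> - a) / 2"
  have \<eta>: "0 < \<eta>" using a by (simp add: \<eta>_def)
  have \<delta>': "0 < (\<delta> / 4)\<^sup>2" using \<delta> by simp
  obtain s t where D: "rel_entropy \<rho> \<sigma> = s - t" and ev: "\<forall>\<^sub>F n in sequentially. \<exists>P Q. proj (d ^ n) P \<and> proj (d ^ n) Q \<and>
      1 - (\<delta> / 4)\<^sup>2 \<le> Re (mtrace (tpow \<rho> n * P)) \<and> 1 - (\<delta> / 4)\<^sup>2 \<le> Re (mtrace (tpow \<rho> n * Q)) \<and>
      psd (d ^ n) (complex_of_real (2 powr (n * (t + \<eta>))) \<cdot>\<^sub>m 1\<^sub>m (d ^ n) - P * tpow \<sigma> n * P) \<and>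
      Re (mtrace Q) \<le> 2 powr - (n * (s - \<eta>)) \<and>
      psd (d ^ n) (complex_of_real (2 powr (n * (s + \<eta>))) \<cdot>\<^sub>m 1\<^sub>m (d ^ n) - Q * tpow \<rho> n * Q) \<and>
      psd (d ^ n) (complex_of_real (2 powr - (n * (t - \<eta>))) \<cdot>\<^sub>m tpow \<sigma> n - P)"
    using stein_projections[OF \<rho> \<sigma> fs \<eta> \<delta>'] .
  show ?thesis using ev
  proof eventually_elim
    case (elim n)
    then obtain P Q where P: "proj (d ^ n) P" and Q: "proj (d ^ n) Q"
      and aP: "1 - (\<delta> / 4)\<^sup>2 \<le> Re (mtrace (tpow \<rho> n * P))" and aQ: "1 - (\<delta> / 4)\<^sup>2 \<le> Re (mtrace (tpow \<rho> n * Q))"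
      and ps: "psd (d ^ n) (complex_of_real (2 powr (n * (t + \<eta>))) \<cdot>\<^sub>m 1\<^sub>m (d ^ n) - P * tpow \<sigma> n * P)"
      and trQ: "Re (mtrace Q) \<le> 2 powr - (n * (s - \<eta>))" by blast
    note p = projD[OF P] and q = projD[OF Q] and sn = densityD[OF density_tpow[OF \<sigma>, of n]]
    note sw = sandwich_test_accepts[OF density_tpow[OF \<rho>] P aP Q aQ]
    \<comment> \<open>Cyclicity places both copies of \<open>P\<close> around
      \<open>\<sigma>\<close>, so the cut-down operator can be replaced by a multiple of the
      identity against \<open>Q\<close>.\<close>
    have "mtrace (tpow \<sigma> n * (P * Q * P)) = mtrace ((tpow \<sigma> n * P * Q) * P)"
      using p q sn by (simp add: mult_assoc_mat)
    also have "\<dots> = mtrace ((P * tpow \<sigma> n * P) * Q)"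
      using p q sn by (subst mtrace_comm) (auto simp: mult_assoc_mat)
    also have "\<dots> = mtrace (Q * (P * tpow \<sigma> n * P))"
      using p q sn by (intro mtrace_comm) auto
    also have "Re \<dots> \<le> Re (mtrace (Q * (complex_of_real (2 powr (n * (t + \<eta>))) \<cdot>\<^sub>m 1\<^sub>m (d ^ n))))"
      using p sn by (intro psd_trace_mono[OF proj_psd[OF Q] _ _ ps]) (auto intro!: mult_carrier_mat[of _ "d ^ n" "d ^ n"])
    also have "\<dots> = 2 powr (n * (t + \<eta>)) * Re (mtrace Q)"
      using q by (simp add: smult_mult_mat mtrace_smult)
    also have "\<dots> \<le> 2 powr (n * (t + \<eta>)) * 2 powr - (n * (s - \<eta>))"
      using trQ by (intro mult_left_mono) auto
    also have "\<dots> = 2 powr - (n * a)"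
    proof -
      have "n * (t + \<eta>) + - (n * (s - \<eta>)) = - (n * a)" unfolding \<eta>_def D by (simp add: field_simps)
      then show ?thesis by (simp only: powr_add[symmetric])
    qed
    finally have "Re (mtrace (tpow \<sigma> n * (P * Q * P))) \<le> 2 powr - (n * a)" .
    moreover have "sqrt ((\<delta> / 4)\<^sup>2) = \<delta> / 4" using \<delta> by simp
    ultimately show ?case using sw by auto
  qed
qed

lemma eventually_real_gt: "\<forall>\<^sub>F n in sequentially. c < real n"
  by (rule eventually_sequentiallyI[of "Suc (nat \<lceil>c\<rceil>)"]) linarith

lemma psd_smult_mono:
  assumes "psd n (complex_of_real c \<cdot>\<^sub>m \<sigma> - \<omega>)" "psd n \<sigma>" "\<omega> \<in> carrier_mat n n" "c \<le> c'"
  shows "psd n (complex_of_real c' \<cdot>\<^sub>m \<sigma> - \<omega>)"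
proof -
  have "complex_of_real c' \<cdot>\<^sub>m \<sigma> - \<omega> = (complex_of_real c \<cdot>\<^sub>m \<sigma> - \<omega>) + complex_of_real (c' - c) \<cdot>\<^sub>m \<sigma>"
    using assms by (intro eq_matI) (auto simp: algebra_simps)
  then show ?thesis using psd_add[OF assms(1) psd_smult[OF assms(2), of "c' - c"]] assms(4) by simp
qed

lemma rel_entropy_nonneg: "density d \<rho> \<Longrightarrow> density d \<sigma> \<Longrightarrow> full_support d \<sigma> \<Longrightarrow> 0 \<le> rel_entropy \<rho> \<sigma>"
  by (rule relative_entropy_spectral)

lemma rel_entropy_eq_0D:
  "density d \<rho> \<Longrightarrow> density d \<sigma> \<Longrightarrow> full_support d \<sigma> \<Longrightarrow> rel_entropy \<rho> \<sigma> = 0 \<Longrightarrow> \<rho> = \<sigma>"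
  by (rule relative_entropy_spectral)

lemma stein_smoothing:
  fixes b \<delta> :: real
  assumes \<rho>: "density d \<rho>" and \<sigma>: "density d \<sigma>" and fs: "full_support d \<sigma>"
    and b: "rel_entropy \<rho> \<sigma> < b" and \<delta>: "0 < \<delta>"
  shows "\<forall>\<^sub>F n in sequentially. \<exists>\<omega>. density (d ^ n) \<omega> \<and> trace_dist \<omega> (tpow \<rho> n) \<le> \<delta> \<and>
    psd (d ^ n) (complex_of_real (2 powr (n * b)) \<cdot>\<^sub>m tpow \<sigma> n - \<omega>)"
proof -
  \<comment> \<open>Two of the four parts pay for the windows. The other two give a factor
    \<open>2 powr (n * (2 * \<eta>))\<close>, at least 2 for large \<open>n\<close>, which absorbs
    the summand 1 of the smoothing bound.\<close>
  define \<eta> where "\<eta> = (b - rel_entropy \<rho> \<sigma>) / 4"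
  have \<eta>: "0 < \<eta>" using b by (simp add: \<eta>_def)
  have \<delta>': "0 < (\<delta> / 4)\<^sup>2" using \<delta> by simp
  obtain s t where D: "rel_entropy \<rho> \<sigma> = s - t" and ev: "\<forall>\<^sub>F n in sequentially. \<exists>P Q. proj (d ^ n) P \<and> proj (d ^ n) Q \<and>
      1 - (\<delta> / 4)\<^sup>2 \<le> Re (mtrace (tpow \<rho> n * P)) \<and> 1 - (\<delta> / 4)\<^sup>2 \<le> Re (mtrace (tpow \<rho> n * Q)) \<and>
      psd (d ^ n) (complex_of_real (2 powr (n * (t + \<eta>))) \<cdot>\<^sub>m 1\<^sub>m (d ^ n) - P * tpow \<sigma> n * P) \<and>
      Re (mtrace Q) \<le> 2 powr - (n * (s - \<eta>)) \<and>
      psd (d ^ n) (complex_of_real (2 powr (n * (s + \<eta>))) \<cdot>\<^sub>m 1\<^sub>m (d ^ n) - Q * tpow \<rho> n * Q) \<and>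
      psd (d ^ n) (complex_of_real (2 powr - (n * (t - \<eta>))) \<cdot>\<^sub>m tpow \<sigma> n - P)"
    using stein_projections[OF \<rho> \<sigma> fs \<eta> \<delta>'] .
  show ?thesis using ev eventually_real_gt[of "1 / (2 * \<eta>)"]
  proof eventually_elim
    case (elim n)
    then obtain P Q where P: "proj (d ^ n) P" and Q: "proj (d ^ n) Q"
      and aP: "1 - (\<delta> / 4)\<^sup>2 \<le> Re (mtrace (tpow \<rho> n * P))" and aQ: "1 - (\<delta> / 4)\<^sup>2 \<le> Re (mtrace (tpow \<rho> n * Q))"
      and p1: "psd (d ^ n) (complex_of_real (2 powr (n * (s + \<eta>))) \<cdot>\<^sub>m 1\<^sub>m (d ^ n) - Q * tpow \<rho> n * Q)"
      and p2: "psd (d ^ n) (complex_of_real (2 powr - (n * (t - \<eta>))) \<cdot>\<^sub>m tpow \<sigma> n - P)" by blast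
    obtain \<omega> where \<omega>: "density (d ^ n) \<omega>" "trace_dist \<omega> (tpow \<rho> n) \<le> 4 * sqrt ((\<delta> / 4)\<^sup>2)"
      "psd (d ^ n) (complex_of_real (2 powr (n * (s + \<eta>)) * 2 powr - (n * (t - \<eta>)) + 1) \<cdot>\<^sub>m tpow \<sigma> n - \<omega>)"
      using sandwich_smoothing[OF density_tpow[OF \<rho>] P aP Q aQ density_tpow[OF \<sigma>] p1 _ p2] by auto
    have "4 * sqrt ((\<delta> / 4)\<^sup>2) = \<delta>" using \<delta> by simp
    moreover have "2 powr (n * (s + \<eta>)) * 2 powr - (n * (t - \<eta>)) + 1 \<le> 2 powr (n * b)"
    proof -
      define b' where "b' = rel_entropy \<rho> \<sigma> + 2 * \<eta>"
      \<comment> \<open>A nonnegative exponent gives \<open>1 \<le> 2 powr (n * b')\<close>, so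
        adding 1 at most doubles the constant.\<close>
      have b': "0 \<le> b'" using rel_entropy_nonneg[OF \<rho> \<sigma> fs] \<eta> by (simp add: b'_def)
      have "2 powr (n * (s + \<eta>)) * 2 powr - (n * (t - \<eta>)) = 2 powr (n * b')"
      proof -
        have "n * (s + \<eta>) + - (n * (t - \<eta>)) = n * b'" unfolding b'_def D by (simp add: field_simps)
        then show ?thesis by (simp only: powr_add[symmetric])
      qed
      moreover have "1 \<le> 2 powr (n * b')" using b' by (intro ge_one_powr_ge_zero) auto
      moreover have "2 powr (n * b) = 2 powr (n * b') * 2 powr (n * (2 * \<eta>))"
        by (simp add: powr_add[symmetric] b'_def \<eta>_def field_simps)
      moreover have "2 powr 1 \<le> 2 powr (n * (2 * \<eta>))"
        using elim(2) \<eta> by (intro powr_mono) (auto simp: field_simps)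
      then have "2 powr (n * b') * 2 \<le> 2 powr (n * b') * 2 powr (n * (2 * \<eta>))"
        by (intro mult_left_mono) auto
      ultimately show ?thesis by linarith
    qed
    then have "psd (d ^ n) (complex_of_real (2 powr (n * b)) \<cdot>\<^sub>m tpow \<sigma> n - \<omega>)"
      by (intro psd_smult_mono[OF \<omega>(3)] densityD[OF density_tpow[OF \<sigma>]] densityD[OF \<omega>(1)])
    ultimately show ?case using \<omega>(1,2) by auto
  qed
qed

section \<open>Measure-and-prepare channels\<close>

lemma psd_kron:
  assumes "psd a A" "psd b B"
  shows "psd (a * b) (kron A B)"
proof -
  obtain C where C: "C \<in> carrier_mat a a" "A = adj C * C" using psd_gramE[OF assms(1)] .
  obtain E where E: "E \<in> carrier_mat b b" "B = adj E * E" using psd_gramE[OF assms(2)] .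
  have "kron A B = adj (kron C E) * kron C E" using C E by (simp add: adj_kron kron_mult)
  moreover have "kron C E \<in> carrier_mat (a * b) (a * b)" using C E by (intro carrier_matI) auto
  ultimately show ?thesis using psd_gram by metis
qed

lemma sum_rearrange4:
  fixes c d e f :: "nat \<Rightarrow> nat \<Rightarrow> complex"
  shows "(\<Sum>s\<in>A. \<Sum>r\<in>A. (\<Sum>u\<in>A. c u s * d u r) * (\<Sum>w\<in>W. e w r * f w s)) =
    (\<Sum>w\<in>W. \<Sum>u\<in>A. (\<Sum>r\<in>A. d u r * e w r) * (\<Sum>s\<in>A. c u s * f w s))"
  unfolding sum_product sum.cartesian_product
  by (rule sum.reindex_bij_witness[where i = "\<lambda>(w, u, r, s). (s, r, u, w)" and j = "\<lambda>(s, r, u, w). (w, u, r, s)"])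
    (auto simp: mult_ac)

text \<open>The partial trace of \<open>X\<close> weighted by \<open>Q\<close> on the second factor.
  Gram factors \<open>C\<close> of \<open>Q\<close> and \<open>G\<close> of \<open>X\<close> combine
  into one factor \<open>H\<close>, whose row index encodes a pair of row indices of
  \<open>G\<close> and \<open>C\<close>; \<open>C\<close> is conjugated because the trace transposes
  the indices of \<open>Q\<close>.\<close>

lemma psd_block_trace:
  assumes "psd a Q" "psd (k * a) X"
  shows "psd k (mat k k (\<lambda>(p, q). mtrace (Q * mat a a (\<lambda>(r, s). X $$ (p * a + r, q * a + s)))))"
    (is "psd k ?Y")
proof -
  obtain C where C: "C \<in> carrier_mat a a" "Q = adj C * C" using psd_gramE[OF assms(1)] .
  obtain G where G: "G \<in> carrier_mat (k * a) (k * a)" "X = adj G * G" using psd_gramE[OF assms(2)] .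
  define H where "H = mat ((k * a) * a) k (\<lambda>(x, q). \<Sum>s<a. cnj (C $$ (x mod a, s)) * G $$ (x div a, q * a + s))"
  have "?Y = adj H * H"
  proof (rule eq_matI)
    fix p q assume "p < dim_row (adj H * H)" "q < dim_col (adj H * H)"
    then have pq: "p < k" "q < k" by (auto simp: H_def)
    have "?Y $$ (p, q) = (\<Sum>s<a. \<Sum>r<a. Q $$ (s, r) * X $$ (p * a + r, q * a + s))"
      using pq C by (simp add: mtrace_mult)
    also have "\<dots> = (\<Sum>s<a. \<Sum>r<a. (\<Sum>u<a. cnj (C $$ (u, s)) * C $$ (u, r)) *
        (\<Sum>w<k * a. cnj (G $$ (w, p * a + r)) * G $$ (w, q * a + s)))"
      using C G pq by (auto simp: index_mult_sum mult_add_less simp del: index_mult_mat(1) intro!: sum.cong)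
    also have "\<dots> = (\<Sum>w<k * a. \<Sum>u<a. (\<Sum>r<a. C $$ (u, r) * cnj (G $$ (w, p * a + r))) *
        (\<Sum>s<a. cnj (C $$ (u, s)) * G $$ (w, q * a + s)))"
      by (rule sum_rearrange4)
    also have "\<dots> = (\<Sum>x<(k * a) * a. cnj (H $$ (x, p)) * H $$ (x, q))"
      using pq by (subst sum_div_mod[symmetric]) (auto simp: H_def intro!: sum.cong)
    also have "\<dots> = (adj H * H) $$ (p, q)"
      using pq by (simp add: index_mult_sum H_def del: index_mult_mat(1))
    finally show "?Y $$ (p, q) = (adj H * H) $$ (p, q)" .
  qed (auto simp: H_def)
  then show ?thesis using psd_gram[of H "(k * a) * a" k] by (simp add: H_def)
qed

text \<open>The output is independent of the input apart from a scalar, so the amplified map factors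
  as a partial trace on the ancilla tensored with \<open>\<omega>\<close>.\<close>

lemma completely_positive_measure_prepare:
  assumes Q: "psd a Q" and \<omega>: "psd b \<omega>"
  shows "completely_positive a b (\<lambda>X. mtrace (Q * X) \<cdot>\<^sub>m \<omega>)"
  unfolding completely_positive_def
proof (intro allI impI)
  fix k X assume X: "psd (k * a) X"
  let ?Y = "mat k k (\<lambda>(p, q). mtrace (Q * mat a a (\<lambda>(r, s). X $$ (p * a + r, q * a + s))))"
  have "ampl k a b (\<lambda>X. mtrace (Q * X) \<cdot>\<^sub>m \<omega>) X = kron ?Y \<omega>"
    using psd_carrier[OF \<omega>] by (intro eq_matI) (auto simp: ampl_def div_mod_less)
  then show "psd (k * b) (ampl k a b (\<lambda>X. mtrace (Q * X) \<cdot>\<^sub>m \<omega>) X)"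
    using psd_kron[OF psd_block_trace[OF Q X] \<omega>] by simp
qed

lemma completely_positive_add:
  assumes "completely_positive a b E" "completely_positive a b F"
    "\<And>X. X \<in> carrier_mat a a \<Longrightarrow> E X \<in> carrier_mat b b" "\<And>X. X \<in> carrier_mat a a \<Longrightarrow> F X \<in> carrier_mat b b"
  shows "completely_positive a b (\<lambda>X. E X + F X)"
  unfolding completely_positive_def
proof (intro allI impI)
  fix k X assume X: "psd (k * a) X"
  have c: "dim_row (E (mat a a f)) = b" "dim_col (E (mat a a f)) = b"
    "dim_row (F (mat a a f)) = b" "dim_col (F (mat a a f)) = b" for f
    using assms(3)[of "mat a a f"] assms(4)[of "mat a a f"] by auto
  have "ampl k a b (\<lambda>X. E X + F X) X = ampl k a b E X + ampl k a b F X"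
    by (intro eq_matI) (auto simp: ampl_def div_mod_less c)
  then show "psd (k * b) (ampl k a b (\<lambda>X. E X + F X) X)"
    using X assms(1,2) by (auto simp: completely_positive_def intro: psd_add)
qed

lemma measure_prepare_channel:
  assumes Q: "test a Q" and \<omega>1: "density b \<omega>1" and \<omega>2: "density b \<omega>2"
  shows "quantum_channel a b (\<lambda>X. mtrace (Q * X) \<cdot>\<^sub>m \<omega>1 + mtrace ((1\<^sub>m a - Q) * X) \<cdot>\<^sub>m \<omega>2)"
  unfolding quantum_channel_def
proof (intro conjI)
  note q = testD[OF Q] and w1 = densityD[OF \<omega>1] and w2 = densityD[OF \<omega>2]
  show "lin_map a b (\<lambda>X. mtrace (Q * X) \<cdot>\<^sub>m \<omega>1 + mtrace ((1\<^sub>m a - Q) * X) \<cdot>\<^sub>m \<omega>2)"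
    unfolding lin_map_def
  proof (intro conjI ballI allI)
    fix X Y :: "complex mat" and c assume X: "X \<in> carrier_mat a a" and Y: "Y \<in> carrier_mat a a"
    have lin: "mtrace (R * (c \<cdot>\<^sub>m X + Y)) = c * mtrace (R * X) + mtrace (R * Y)" if "R \<in> carrier_mat a a" for R
      using that X Y by (simp add: mult_add_mat smult_mult_mat mtrace_add mtrace_smult)
    have R: "1\<^sub>m a - Q \<in> carrier_mat a a" using q by (simp add: minus_carrier_mat)
    show "mtrace (Q * (c \<cdot>\<^sub>m X + Y)) \<cdot>\<^sub>m \<omega>1 + mtrace ((1\<^sub>m a - Q) * (c \<cdot>\<^sub>m X + Y)) \<cdot>\<^sub>m \<omega>2 =
        c \<cdot>\<^sub>m (mtrace (Q * X) \<cdot>\<^sub>m \<omega>1 + mtrace ((1\<^sub>m a - Q) * X) \<cdot>\<^sub>m \<omega>2)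
        + (mtrace (Q * Y) \<cdot>\<^sub>m \<omega>1 + mtrace ((1\<^sub>m a - Q) * Y) \<cdot>\<^sub>m \<omega>2)"
      unfolding lin[OF q(3)] lin[OF R] using w1 w2
      by (intro eq_matI) (auto simp: algebra_simps)
  qed (use w1 w2 in auto)
  show "completely_positive a b (\<lambda>X. mtrace (Q * X) \<cdot>\<^sub>m \<omega>1 + mtrace ((1\<^sub>m a - Q) * X) \<cdot>\<^sub>m \<omega>2)"
    using q w1 w2 by (intro completely_positive_add completely_positive_measure_prepare) auto
  show "trace_preserving a b (\<lambda>X. mtrace (Q * X) \<cdot>\<^sub>m \<omega>1 + mtrace ((1\<^sub>m a - Q) * X) \<cdot>\<^sub>m \<omega>2)"
    unfolding trace_preserving_def
  proof
    fix X :: "complex mat" assume "X \<in> carrier_mat a a"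
    then show "mtrace (mtrace (Q * X) \<cdot>\<^sub>m \<omega>1 + mtrace ((1\<^sub>m a - Q) * X) \<cdot>\<^sub>m \<omega>2) = mtrace X"
      using q w1 w2 by (simp add: mtrace_add mtrace_smult minus_mult_mat mtrace_minus)
  qed
qed

text \<open>Complete positivity with a one-dimensional ancilla.\<close>

lemma channel_psd:
  assumes "quantum_channel a b E" "psd a X"
  shows "psd b (E X)"
proof -
  have X: "X \<in> carrier_mat a a" using assms(2) by simp
  then have EX: "E X \<in> carrier_mat b b" using assms(1) by (auto simp: quantum_channel_def lin_map_def)
  have "mat a a (\<lambda>(r, s). X $$ (r, s)) = X" using X by (intro eq_matI) auto
  then have "ampl 1 a b E X = E X"
    using EX by (intro eq_matI) (auto simp: ampl_def)
  moreover have "psd (1 * b) (ampl 1 a b E X)"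
    using assms unfolding quantum_channel_def completely_positive_def by (metis mult_1)
  ultimately show ?thesis by simp
qed

lemma channel_carrier: "quantum_channel a b E \<Longrightarrow> X \<in> carrier_mat a a \<Longrightarrow> E X \<in> carrier_mat b b"
  by (auto simp: quantum_channel_def lin_map_def)

lemma channel_density: "quantum_channel a b E \<Longrightarrow> density a \<rho> \<Longrightarrow> density b (E \<rho>)"
  using channel_psd[of a b E \<rho>] by (auto simp: density_def quantum_channel_def trace_preserving_def)

lemma channel_linear:
  assumes E: "quantum_channel a b E" and X: "X \<in> carrier_mat a a" and Y: "Y \<in> carrier_mat a a"
  shows "E (c \<cdot>\<^sub>m X - Y) = c \<cdot>\<^sub>m E X - E Y"
proof -
  note lin = E[unfolded quantum_channel_def lin_map_def, THEN conjunct1, THEN conjunct2, rule_format]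
  note EX = channel_carrier[OF E X] and EY = channel_carrier[OF E Y]
  have Z: "0\<^sub>m a a \<in> carrier_mat a a" by simp
  note EZ = channel_carrier[OF E Z]
  \<comment> \<open>\<open>lin_map\<close> speaks only of combinations
    \<open>c \<cdot>\<^sub>m X + Y\<close>, so the value at zero comes first; it follows from
    \<open>c = - 1\<close> with \<open>X\<close> and \<open>Y\<close> zero.\<close>
  have "- 1 \<cdot>\<^sub>m 0\<^sub>m a a + 0\<^sub>m a a = (0\<^sub>m a a :: complex mat)" by (intro eq_matI) auto
  then have "E (0\<^sub>m a a) = - 1 \<cdot>\<^sub>m E (0\<^sub>m a a) + E (0\<^sub>m a a)"
    using lin[OF Z Z, of "- 1"] by metis
  also have "\<dots> = 0\<^sub>m b b" using EZ by (intro eq_matI) auto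
  finally have E0: "E (0\<^sub>m a a) = 0\<^sub>m b b" .
  have "E (c \<cdot>\<^sub>m X) = E (c \<cdot>\<^sub>m X + 0\<^sub>m a a)" using X by simp
  also have "\<dots> = c \<cdot>\<^sub>m E X" unfolding lin[OF X Z] E0 using EX by simp
  finally have Ec: "E (c \<cdot>\<^sub>m X) = c \<cdot>\<^sub>m E X" .
  have "c \<cdot>\<^sub>m X - Y = - 1 \<cdot>\<^sub>m Y + c \<cdot>\<^sub>m X" using X Y by (intro eq_matI) auto
  then have "E (c \<cdot>\<^sub>m X - Y) = - 1 \<cdot>\<^sub>m E Y + E (c \<cdot>\<^sub>m X)"
    using lin[OF Y, of "c \<cdot>\<^sub>m X" "- 1"] X by simp
  then show ?thesis unfolding Ec using EX EY by (intro eq_matI) auto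
qed

text \<open>Positivity carries the domination of \<open>\<omega>\<close> by \<open>\<sigma>\<close>
  through the channel. Passing from \<open>\<rho>\<close> to \<open>\<omega>\<close> loses at most
  the trace of the negative part of \<open>\<omega> - \<rho>\<close>, which the channel
  preserves.\<close>

lemma channel_test_bound:
  assumes E: "quantum_channel a b E" and \<rho>: "density a \<rho>" and \<sigma>: "density a \<sigma>" and \<omega>: "density a \<omega>"
    and dist: "trace_dist \<omega> \<rho> \<le> \<delta>" and le: "psd a (complex_of_real c \<cdot>\<^sub>m \<sigma> - \<omega>)" and Q: "test b Q"
  shows "Re (mtrace (E \<rho> * Q)) \<le> c * Re (mtrace (E \<sigma> * Q)) + 2 * \<delta>"
proof -
  note r = densityD[OF \<rho>] and s = densityD[OF \<sigma>] and w = densityD[OF \<omega>] and q = testD[OF Q]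
  obtain P N where P: "psd a P" and N: "psd a N" and H: "\<omega> - \<rho> = P - N"
    and tn: "Re (mtrace P) + Re (mtrace N) \<le> trace_norm (\<omega> - \<rho>)"
  proof (rule hermitian_decomposition)
    show "\<omega> - \<rho> \<in> carrier_mat a a" "adj (\<omega> - \<rho>) = \<omega> - \<rho>"
      using r w by (auto simp: adj_minus minus_carrier_mat)
  qed blast
  have eP: "psd b (E P)" and eN: "psd b (E N)" by (intro channel_psd[OF E] P N)+
  have one: "1 \<cdot>\<^sub>m X = X" for X :: "complex mat" by (intro eq_matI) auto
  note Er = psd_carrier[OF densityD(1)[OF channel_density[OF E \<rho>]]]
    and Es = psd_carrier[OF densityD(1)[OF channel_density[OF E \<sigma>]]]
    and Ew = psd_carrier[OF densityD(1)[OF channel_density[OF E \<omega>]]]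
  have "E \<omega> - E \<rho> = E P - E N"
    using channel_linear[OF E w(3) r(3), of 1] channel_linear[OF E psd_carrier(1)[OF P] psd_carrier(1)[OF N], of 1] H
    by (simp add: one)
  then have "mtrace ((E \<omega> - E \<rho>) * Q) = mtrace ((E P - E N) * Q)" by simp
  then have "mtrace (E \<omega> * Q) - mtrace (E \<rho> * Q) = mtrace (E P * Q) - mtrace (E N * Q)"
    using Er Ew q psd_carrier[OF eP] psd_carrier[OF eN] by (simp add: minus_mult_mat mtrace_minus)
  from arg_cong[OF this, of Re]
  have 1: "Re (mtrace (E \<omega> * Q)) - Re (mtrace (E \<rho> * Q)) = Re (mtrace (E P * Q)) - Re (mtrace (E N * Q))"
    by simp
  have "psd b (complex_of_real c \<cdot>\<^sub>m E \<sigma> - E \<omega>)"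
    using channel_psd[OF E le] unfolding channel_linear[OF E s(3) w(3)] .
  from test_trace_le(2)[OF this Q]
  have 2: "Re (mtrace (E \<omega> * Q)) \<le> c * Re (mtrace (E \<sigma> * Q))"
    using Es Ew q by (simp add: minus_mult_mat mtrace_minus smult_mult_mat mtrace_smult)
  have "mtrace (E N) = mtrace N"
    using E N by (simp add: quantum_channel_def trace_preserving_def)
  then have 3: "Re (mtrace (E N * Q)) \<le> Re (mtrace N)"
    using test_trace_le(1)[OF eN Q] by simp
  have 4: "0 \<le> Re (mtrace (E P * Q))" by (rule test_trace_le(2)[OF eP Q])
  \<comment> \<open>The full trace norm is used instead of half of it, hence
    \<open>2 * \<delta>\<close>.\<close>
  have 5: "Re (mtrace N) \<le> 2 * \<delta>"
    using tn dist psd_trace_nonneg[OF P] by (simp add: trace_dist_def)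
  show ?thesis using 1 2 3 4 5 by linarith
qed

section \<open>Achievability and converse\<close>

lemma trace_dist_self:
  assumes "A \<in> carrier_mat n n"
  shows "trace_dist A A = 0"
proof -
  have Z: "A - A = 0\<^sub>m n n" using assms by (intro eq_matI) auto
  obtain W where W: "contraction n W" "mtrace ((A - A) * W) = of_real (trace_norm (A - A))"
    using trace_norm_attained[of "A - A" n] assms by (metis minus_carrier_mat)
  have "mtrace ((A - A) * W) = 0"
    using W(1) unfolding Z by (simp add: mtrace_def)
  then show ?thesis using W(2) by (simp add: trace_dist_def)
qed

text \<open>The threshold is the one at which \<open>sqrt (2 * trace_dist \<alpha> \<beta>)\<close>
  reaches \<open>\<epsilon>\<close>; for \<open>\<epsilon> < 1\<close> it also lies below
  \<open>\<epsilon>\<close>, so it serves both distances.\<close>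

lemma dist_le_of_trace_dist:
  assumes "\<Delta> \<in> {trace_dist, purified_dist}" "0 < \<epsilon>" "\<epsilon> < 1" "density n \<alpha>" "density n \<beta>"
    "trace_dist \<alpha> \<beta> \<le> \<epsilon>\<^sup>2 / 2"
  shows "\<Delta> \<alpha> \<beta> \<le> \<epsilon>"
proof -
  have "\<epsilon>\<^sup>2 \<le> \<epsilon>" using assms(2,3) by (simp add: power2_eq_square mult_left_le)
  then have "trace_dist \<alpha> \<beta> \<le> \<epsilon>" using assms(2,6) by linarith
  moreover have "sqrt (2 * trace_dist \<alpha> \<beta>) \<le> \<epsilon>"
    using assms(2,6) by (intro real_le_lsqrt) auto
  then have "purified_dist \<alpha> \<beta> \<le> \<epsilon>"
    using purified_dist_le[OF assms(4,5)] by simp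
  ultimately show ?thesis using assms(1) by auto
qed

text \<open>The channel measures \<open>Q\<close> and prepares \<open>\<omega>\<close> on acceptance; on rejection it prepares the
  state \<open>\<omega>'\<close> with \<open>p \<omega> + (1 - p) \<omega>' = \<sigma>2\<close>, \<open>p\<close> being the acceptance probability of \<open>\<sigma>1\<close>.\<close>

lemma measure_prepare_conversion:
  assumes \<rho>1: "density a \<rho>1" and \<sigma>1: "density a \<sigma>1" and \<rho>2: "density b \<rho>2" and \<sigma>2: "density b \<sigma>2"
    and Q: "test a Q" and acc: "1 - \<delta> \<le> Re (mtrace (\<rho>1 * Q))"
    and \<omega>: "density b \<omega>" and dist: "trace_dist \<omega> \<rho>2 \<le> \<delta>"
    and le: "psd b (complex_of_real c \<cdot>\<^sub>m \<sigma>2 - \<omega>)"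
    and p: "c * Re (mtrace (\<sigma>1 * Q)) \<le> 1" "Re (mtrace (\<sigma>1 * Q)) < 1"
  obtains E where "quantum_channel a b E" "E \<sigma>1 = \<sigma>2" "trace_dist (E \<rho>1) \<rho>2 \<le> 2 * \<delta>"
proof -
  define p where "p = Re (mtrace (\<sigma>1 * Q))"
  define t where "t = Re (mtrace (\<rho>1 * Q))"
  note r1 = densityD[OF \<rho>1] and s1 = densityD[OF \<sigma>1] and r2 = densityD[OF \<rho>2] and s2 = densityD[OF \<sigma>2]
    and w = densityD[OF \<omega>] and q = testD[OF Q]
  have trQ: "mtrace (Q * \<rho>) = of_real (Re (mtrace (\<rho> * Q)))"
    "mtrace ((1\<^sub>m a - Q) * \<rho>) = of_real (1 - Re (mtrace (\<rho> * Q)))" if "density a \<rho>" for \<rho>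
  proof -
    note r = densityD[OF that]
    have "mtrace (Q * \<rho>) = mtrace (\<rho> * Q)" using q r by (intro mtrace_comm) auto
    also have "\<dots> = of_real (Re (mtrace (\<rho> * Q)))"
      by (rule hermitian_trace_mult_real[OF r(3) q(3) r(6) q(6)])
    finally show 1: "mtrace (Q * \<rho>) = of_real (Re (mtrace (\<rho> * Q)))" .
    have "mtrace ((1\<^sub>m a - Q) * \<rho>) = 1 - mtrace (Q * \<rho>)"
      using q r by (simp add: minus_mult_mat mtrace_minus)
    then show "mtrace ((1\<^sub>m a - Q) * \<rho>) = of_real (1 - Re (mtrace (\<rho> * Q)))" unfolding 1 by simp
  qed
  have p0: "0 \<le> p" "p < 1" "c * p \<le> 1"
    using test_trace_le(2)[OF s1(1) Q] p by (auto simp: p_def)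
  have t: "t \<le> 1" "1 - t \<le> \<delta>" using test_trace_le(1)[OF r1(1) Q] acc r1(2) by (auto simp: t_def)
  \<comment> \<open>Normalising the remainder requires \<open>p < 1\<close>; its positivity is
    domination together with \<open>c * p \<le> 1\<close>.\<close>
  define \<omega>' where "\<omega>' = complex_of_real (1 / (1 - p)) \<cdot>\<^sub>m (\<sigma>2 - complex_of_real p \<cdot>\<^sub>m \<omega>)"
  have \<omega>': "density b \<omega>'"
  proof -
    have "\<sigma>2 - complex_of_real p \<cdot>\<^sub>m \<omega> =
        complex_of_real p \<cdot>\<^sub>m (complex_of_real c \<cdot>\<^sub>m \<sigma>2 - \<omega>) + complex_of_real (1 - c * p) \<cdot>\<^sub>m \<sigma>2"
      using s2 w by (intro eq_matI) (auto simp: algebra_simps)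
    then have "psd b (\<sigma>2 - complex_of_real p \<cdot>\<^sub>m \<omega>)"
      using psd_add[OF psd_smult[OF le p0(1)] psd_smult[OF s2(1), of "1 - c * p"]] p0 by simp
    then have "psd b \<omega>'" unfolding \<omega>'_def using p0 by (intro psd_smult) auto
    moreover have "mtrace \<omega>' = complex_of_real (1 / (1 - p) * (1 - p))"
      unfolding \<omega>'_def using s2 w by (simp add: mtrace_smult mtrace_minus)
    ultimately show ?thesis using p0 by (simp add: density_def)
  qed
  note w' = densityD[OF \<omega>']
  define E where "E X = mtrace (Q * X) \<cdot>\<^sub>m \<omega> + mtrace ((1\<^sub>m a - Q) * X) \<cdot>\<^sub>m \<omega>'" for X
  have E: "quantum_channel a b E"
    unfolding E_def[abs_def] by (rule measure_prepare_channel[OF Q \<omega> \<omega>'])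
  have "E \<sigma>1 = complex_of_real p \<cdot>\<^sub>m \<omega> + complex_of_real (1 - p) \<cdot>\<^sub>m \<omega>'"
    unfolding E_def trQ[OF \<sigma>1] p_def ..
  also have "\<dots> = \<sigma>2"
  proof (rule eq_matI)
    fix i j assume ij: "i < dim_row \<sigma>2" "j < dim_col \<sigma>2"
    have "complex_of_real (1 - p) * complex_of_real (1 / (1 - p)) = 1"
      using p0 unfolding of_real_mult[symmetric] by simp
    then have "complex_of_real (1 - p) * \<omega>' $$ (i, j) = \<sigma>2 $$ (i, j) - complex_of_real p * \<omega> $$ (i, j)"
      using ij s2 w by (simp add: \<omega>'_def mult.assoc[symmetric] del: of_real_diff of_real_divide)
    then show "(complex_of_real p \<cdot>\<^sub>m \<omega> + complex_of_real (1 - p) \<cdot>\<^sub>m \<omega>') $$ (i, j) = \<sigma>2 $$ (i, j)"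
      using ij s2 w w' by (simp del: of_real_diff)
  qed (use s2 w w' in auto)
  finally have E\<sigma>: "E \<sigma>1 = \<sigma>2" .
  have E\<rho>: "E \<rho>1 = complex_of_real t \<cdot>\<^sub>m \<omega> + complex_of_real (1 - t) \<cdot>\<^sub>m \<omega>'"
    unfolding E_def trQ[OF \<rho>1] t_def ..
  have "trace_dist (E \<rho>1) \<rho>2 \<le> 2 * \<delta>"
  proof -
    have M: "E \<rho>1 - \<rho>2 \<in> carrier_mat b b" using r2 by (simp add: minus_carrier_mat)
    obtain W where W: "contraction b W" and tn: "mtrace ((E \<rho>1 - \<rho>2) * W) = of_real (trace_norm (E \<rho>1 - \<rho>2))"
      using trace_norm_attained[OF M] .
    note Wc = contraction_carrier[OF W]
    \<comment> \<open>The output is \<open>\<omega>\<close> up to the rejection weight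
      \<open>1 - t\<close>, at most \<open>\<delta>\<close>, times a difference of two
      states.\<close>
    have "E \<rho>1 - \<rho>2 = (\<omega> - \<rho>2) + complex_of_real (1 - t) \<cdot>\<^sub>m (\<omega>' - \<omega>)"
      unfolding E\<rho> using w w' r2 by (intro eq_matI) (auto simp: algebra_simps)
    then have "mtrace ((E \<rho>1 - \<rho>2) * W) = mtrace ((\<omega> - \<rho>2) * W) +
        of_real (1 - t) * (mtrace (\<omega>' * W) - mtrace (\<omega> * W))"
      using w w' r2 Wc
      by (simp add: add_mult_mat minus_mult_mat smult_mult_mat mtrace_add mtrace_minus mtrace_smult del: of_real_diff)
    then have "trace_norm (E \<rho>1 - \<rho>2) \<le>
        cmod (mtrace ((\<omega> - \<rho>2) * W)) + cmod (of_real (1 - t) * (mtrace (\<omega>' * W) - mtrace (\<omega> * W)))"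
      unfolding tn by (metis abs_ge_self norm_of_real norm_triangle_ineq order_trans)
    also have "\<dots> = cmod (mtrace ((\<omega> - \<rho>2) * W)) + (1 - t) * cmod (mtrace (\<omega>' * W) - mtrace (\<omega> * W))"
      using t by (simp add: norm_mult del: of_real_diff)
    also have "\<dots> \<le> 2 * \<delta> + \<delta> * 2"
    proof (intro add_mono mult_mono)
      have "\<omega> - \<rho>2 \<in> carrier_mat b b" using r2 by (simp add: minus_carrier_mat)
      from trace_norm_ge[OF this W] dist show "cmod (mtrace ((\<omega> - \<rho>2) * W)) \<le> 2 * \<delta>"
        by (simp add: trace_dist_def)
      show "cmod (mtrace (\<omega>' * W) - mtrace (\<omega> * W)) \<le> 2"
        using density_trace_contraction_le[OF \<omega> W] density_trace_contraction_le[OF \<omega>' W]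
          norm_triangle_ineq4[of "mtrace (\<omega>' * W)" "mtrace (\<omega> * W)"] by linarith
    qed (use t in auto)
    finally show ?thesis by (simp add: trace_dist_def)
  qed
  then show ?thesis using that E E\<sigma> by blast
qed

text \<open>The channel discards its input and prepares \<open>\<sigma>2\<close>, measuring the
  trivial test. It covers both equal target states and \<open>m = 0\<close>, where every tensor
  power is the one-by-one identity.\<close>

lemma achievable_discard:
  assumes "density d1 \<rho>1" "density d1 \<sigma>1" "density d2 \<rho>2" "density d2 \<sigma>2"
    and \<Delta>: "\<Delta> \<in> {trace_dist, purified_dist}" and \<epsilon>: "0 < \<epsilon>" "\<epsilon> < 1"
    and eq: "tpow \<rho>2 m = tpow \<sigma>2 m"
  shows "achievable d1 d2 \<Delta> \<rho>1 \<sigma>1 \<rho>2 \<sigma>2 n m \<epsilon>"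
proof -
  note r1 = densityD[OF density_tpow[OF assms(1), of n]]
    and s1 = densityD[OF density_tpow[OF assms(2), of n]]
    and s2 = densityD[OF density_tpow[OF assms(4), of m]]
  have "test (d1 ^ n) (1\<^sub>m (d1 ^ n))"
    using psd_udiag[OF unitary_one, of "d1 ^ n" "\<lambda>_. 0"] udiag_minus[OF unitary_one, of "d1 ^ n" "\<lambda>_. 1" "\<lambda>_. 1"]
    by (simp add: test_def psd_one udiag_one unitary_one)
  note ch = measure_prepare_channel[OF this density_tpow[OF assms(4), of m] density_tpow[OF assms(4), of m]]
  define E where "E X = mtrace (1\<^sub>m (d1 ^ n) * X) \<cdot>\<^sub>m tpow \<sigma>2 m + mtrace ((1\<^sub>m (d1 ^ n) - 1\<^sub>m (d1 ^ n)) * X) \<cdot>\<^sub>m tpow \<sigma>2 m" for X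
  have E: "quantum_channel (d1 ^ n) (d2 ^ m) E" using ch unfolding E_def[abs_def] .
  have val: "E X = tpow \<sigma>2 m" if "density (d1 ^ n) X" for X
  proof -
    note x = densityD[OF that]
    show ?thesis
      unfolding E_def using x s2
      by (intro eq_matI) (auto simp: minus_mult_mat mtrace_minus)
  qed
  have "trace_dist (tpow \<sigma>2 m) (tpow \<rho>2 m) \<le> \<epsilon>\<^sup>2 / 2"
    unfolding eq trace_dist_self[OF s2(3)] by simp
  then have "\<Delta> (tpow \<sigma>2 m) (tpow \<rho>2 m) \<le> \<epsilon>"
    by (rule dist_le_of_trace_dist[OF \<Delta> \<epsilon> density_tpow[OF assms(4)] density_tpow[OF assms(3)]])
  then show ?thesis
    unfolding achievable_def using E val density_tpow assms(1,2) by metis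
qed

text \<open>The test exponent \<open>n * a\<close> of the first pair must outweigh the domination
  exponent \<open>m * b\<close> of the second, so \<open>a\<close> and \<open>b\<close> are chosen
  close to the two relative entropies with \<open>r * b < a\<close>.\<close>

lemma achievable_of_rate:
  fixes r :: real
  assumes \<rho>1: "density d1 \<rho>1" and \<sigma>1: "density d1 \<sigma>1" "full_support d1 \<sigma>1"
    and \<rho>2: "density d2 \<rho>2" and \<sigma>2: "density d2 \<sigma>2" "full_support d2 \<sigma>2"
    and \<Delta>: "\<Delta> \<in> {trace_dist, purified_dist}" and \<epsilon>: "0 < \<epsilon>" "\<epsilon> < 1"
    and r: "0 < r" "r * rel_entropy \<rho>2 \<sigma>2 < rel_entropy \<rho>1 \<sigma>1"
  shows "\<forall>\<^sub>F n in sequentially. achievable d1 d2 \<Delta> \<rho>1 \<sigma>1 \<rho>2 \<sigma>2 n (nat \<lceil>r * n\<rceil>) \<epsilon>"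
proof -
  let ?D1 = "rel_entropy \<rho>1 \<sigma>1" and ?D2 = "rel_entropy \<rho>2 \<sigma>2"
  have D2: "0 \<le> ?D2" by (rule rel_entropy_nonneg[OF \<rho>2 \<sigma>2])
  \<comment> \<open>Shifting both exponents by \<open>\<gamma>\<close> changes
    \<open>a - r * b\<close> by \<open>\<gamma> * (1 + r)\<close>, which is half the available
    gap.\<close>
  define \<gamma> where "\<gamma> = (?D1 - r * ?D2) / (2 * (1 + r))"
  have \<gamma>: "0 < \<gamma>" using r by (simp add: \<gamma>_def)
  define a where "a = ?D1 - \<gamma>"
  define b where "b = ?D2 + \<gamma>"
  have ab: "0 < a - r * b"
  proof -
    have "\<gamma> * (1 + r) = (?D1 - r * ?D2) / 2" using r by (simp add: \<gamma>_def field_simps)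
    then have "a - r * b = (?D1 - r * ?D2) / 2" by (simp add: a_def b_def algebra_simps)
    then show ?thesis using r by simp
  qed
  have b: "0 < b" "?D2 < b" using D2 \<gamma> by (auto simp: b_def)
  have "0 < a" using ab mult_pos_pos[OF r(1) b(1)] by linarith
  then have a: "0 < a" "a < ?D1" using \<gamma> by (simp_all add: a_def)
  \<comment> \<open>The conversion error is \<open>2 * \<delta>\<close>, exactly the threshold of
    \<open>dist_le_of_trace_dist\<close>.\<close>
  define \<delta> where "\<delta> = \<epsilon>\<^sup>2 / 4"
  have \<delta>: "0 < \<delta>" using \<epsilon> by (simp add: \<delta>_def)
  obtain M where M: "\<And>m. M \<le> m \<Longrightarrow> \<exists>\<omega>. density (d2 ^ m) \<omega> \<and> trace_dist \<omega> (tpow \<rho>2 m) \<le> \<delta> \<and>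
      psd (d2 ^ m) (complex_of_real (2 powr (m * b)) \<cdot>\<^sub>m tpow \<sigma>2 m - \<omega>)"
    using stein_smoothing[OF \<rho>2 \<sigma>2 b(2) \<delta>] unfolding eventually_sequentially by blast
  show ?thesis
    \<comment> \<open>The thresholds make \<open>m\<close> large enough for smoothing, pay for the
      extra copy due to rounding up, and make \<open>n\<close> positive so that acceptance of
      \<open>\<sigma>1\<close> is below one.\<close>
    using stein_direct[OF \<rho>1 \<sigma>1 a(2) \<delta>] eventually_real_gt[of "M / r"] eventually_real_gt[of "b / (a - r * b)"]
      eventually_real_gt[of 0]
  proof eventually_elim
    case (elim n)
    define m where "m = nat \<lceil>r * n\<rceil>"
    have m: "r * n \<le> m" "m \<le> r * n + 1"
      using r by (auto simp: m_def of_nat_ceiling)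
    have "M < n * r" using elim(2) r by (simp add: field_simps)
    then have "M \<le> m" using m(1) by (simp add: mult.commute)
    then obtain \<omega> where \<omega>: "density (d2 ^ m) \<omega>" "trace_dist \<omega> (tpow \<rho>2 m) \<le> \<delta>"
      "psd (d2 ^ m) (complex_of_real (2 powr (m * b)) \<cdot>\<^sub>m tpow \<sigma>2 m - \<omega>)" using M by blast
    obtain Q where Q: "test (d1 ^ n) Q" "1 - \<delta> \<le> Re (mtrace (tpow \<rho>1 n * Q))"
      "Re (mtrace (tpow \<sigma>1 n * Q)) \<le> 2 powr - (n * a)" using elim(1) by blast
    have "b < n * (a - r * b)" using elim(3) ab by (simp add: field_simps)
    moreover have "m * b \<le> (r * n + 1) * b" using m b by (intro mult_right_mono) auto
    ultimately have mb: "m * b \<le> n * a" by (simp add: algebra_simps)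
    have "2 powr (m * b) * Re (mtrace (tpow \<sigma>1 n * Q)) \<le> 2 powr (m * b) * 2 powr - (n * a)"
      using Q(3) by (intro mult_left_mono) auto
    also have "\<dots> \<le> 2 powr 0"
      unfolding powr_add[symmetric] using mb by (intro powr_mono) auto
    finally have p1: "2 powr (m * b) * Re (mtrace (tpow \<sigma>1 n * Q)) \<le> 1" by simp
    have "2 powr - (n * a) < 2 powr 0"
      using elim(4) a by (intro powr_less_mono) auto
    then have p2: "Re (mtrace (tpow \<sigma>1 n * Q)) < 1" using Q(3) by simp
    obtain E where E: "quantum_channel (d1 ^ n) (d2 ^ m) E" "E (tpow \<sigma>1 n) = tpow \<sigma>2 m"
      "trace_dist (E (tpow \<rho>1 n)) (tpow \<rho>2 m) \<le> 2 * \<delta>"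
      using measure_prepare_conversion[OF density_tpow[OF \<rho>1] density_tpow[OF \<sigma>1(1)] density_tpow[OF \<rho>2]
          density_tpow[OF \<sigma>2(1)] Q(1,2) \<omega> p1 p2] .
    have "\<Delta> (E (tpow \<rho>1 n)) (tpow \<rho>2 m) \<le> \<epsilon>"
      by (rule dist_le_of_trace_dist[OF \<Delta> \<epsilon> channel_density[OF E(1) density_tpow[OF \<rho>1]] density_tpow[OF \<rho>2]])
        (use E(3) in \<open>simp add: \<delta>_def\<close>)
    then show ?case unfolding achievable_def m_def[symmetric] using E by blast
  qed
qed

text \<open>If \<open>m\<close> exceeded \<open>r * n\<close>, the output test would give
  \<open>4 * \<delta> \<le> 2 powr (n * (b - r * a)) + 2 * \<delta>\<close>, and the exponent is
  negative.\<close>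

lemma rate_le_of_achievable:
  fixes r :: real
  assumes \<rho>1: "density d1 \<rho>1" and \<sigma>1: "density d1 \<sigma>1" "full_support d1 \<sigma>1"
    and \<rho>2: "density d2 \<rho>2" and \<sigma>2: "density d2 \<sigma>2" "full_support d2 \<sigma>2"
    and \<Delta>: "\<Delta> \<in> {trace_dist, purified_dist}" and \<epsilon>: "\<epsilon> < 1"
    and r: "0 < r" "rel_entropy \<rho>1 \<sigma>1 < r * rel_entropy \<rho>2 \<sigma>2"
  shows "\<forall>\<^sub>F n in sequentially. \<forall>m. achievable d1 d2 \<Delta> \<rho>1 \<sigma>1 \<rho>2 \<sigma>2 n m \<epsilon> \<longrightarrow> m \<le> r * n"
proof -
  let ?D1 = "rel_entropy \<rho>1 \<sigma>1" and ?D2 = "rel_entropy \<rho>2 \<sigma>2"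
  have D1: "0 \<le> ?D1" by (rule rel_entropy_nonneg[OF \<rho>1 \<sigma>1])
  define \<gamma> where "\<gamma> = (r * ?D2 - ?D1) / (2 * (1 + r))"
  have \<gamma>: "0 < \<gamma>" using r by (simp add: \<gamma>_def)
  define b where "b = ?D1 + \<gamma>"
  define a where "a = ?D2 - \<gamma>"
  have ab: "b - r * a < 0"
  proof -
    have "\<gamma> * (1 + r) = (r * ?D2 - ?D1) / 2" using r by (simp add: \<gamma>_def field_simps)
    then have "b - r * a = - (r * ?D2 - ?D1) / 2" by (simp add: a_def b_def algebra_simps)
    then show ?thesis using r by simp
  qed
  have b: "0 < b" "?D1 < b" using D1 \<gamma> by (auto simp: b_def)
  \<comment> \<open>Positivity of \<open>a\<close> makes the test bound improve with
    \<open>m\<close>, so \<open>m\<close> near \<open>r * n\<close> is the worst case.\<close>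
  have "0 < r * a" using ab b by linarith
  then have a: "0 < a" "a < ?D2" using r \<gamma> by (auto simp: a_def zero_less_mult_iff)
  obtain \<delta> where \<delta>: "0 < \<delta>" and robust: "\<And>n \<alpha> \<beta> Q. density n \<alpha> \<Longrightarrow> density n \<beta> \<Longrightarrow> test n Q \<Longrightarrow>
    \<Delta> \<alpha> \<beta> \<le> \<epsilon> \<Longrightarrow> 1 - \<delta> \<le> Re (mtrace (\<beta> * Q)) \<Longrightarrow> 4 * \<delta> \<le> Re (mtrace (\<alpha> * Q))"
    by (rule dist_test_robust[OF \<Delta> \<epsilon>]) blast
  obtain M where M: "\<And>m. M \<le> m \<Longrightarrow> \<exists>Q. test (d2 ^ m) Q \<and> 1 - \<delta> \<le> Re (mtrace (tpow \<rho>2 m * Q)) \<and>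
    Re (mtrace (tpow \<sigma>2 m * Q)) \<le> 2 powr - (m * a)"
    using stein_direct[OF \<rho>2 \<sigma>2 a(2) \<delta>] unfolding eventually_sequentially by blast
  show ?thesis
    \<comment> \<open>Beyond \<open>M / r\<close>, every \<open>m\<close> above \<open>r * n\<close>
      exceeds \<open>M\<close>, so one threshold on \<open>n\<close> serves all \<open>m\<close>.
      The last one makes the exponential smaller than \<open>2 * \<delta>\<close>; its denominator
      is negative.\<close>
    using stein_smoothing[OF \<rho>1 \<sigma>1 b(2) \<delta>] eventually_real_gt[of "M / r"]
      eventually_real_gt[of "log 2 (2 * \<delta>) / (b - r * a)"]
  proof eventually_elim
    case (elim n)
    obtain \<omega> where \<omega>: "density (d1 ^ n) \<omega>" "trace_dist \<omega> (tpow \<rho>1 n) \<le> \<delta>"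
      "psd (d1 ^ n) (complex_of_real (2 powr (n * b)) \<cdot>\<^sub>m tpow \<sigma>1 n - \<omega>)" using elim(1) by blast
    show ?case
    proof (intro allI impI, rule ccontr)
      fix m assume ach: "achievable d1 d2 \<Delta> \<rho>1 \<sigma>1 \<rho>2 \<sigma>2 n m \<epsilon>" and "\<not> m \<le> r * n"
      then have m: "r * n < m" by simp
      obtain E where E: "quantum_channel (d1 ^ n) (d2 ^ m) E" "E (tpow \<sigma>1 n) = tpow \<sigma>2 m"
        "\<Delta> (E (tpow \<rho>1 n)) (tpow \<rho>2 m) \<le> \<epsilon>"
        using ach unfolding achievable_def by blast
      have "M < n * r" using elim(2) r by (simp add: field_simps)
      then have "M \<le> m" using m by (simp add: mult.commute)
      then obtain Q where Q: "test (d2 ^ m) Q" "1 - \<delta> \<le> Re (mtrace (tpow \<rho>2 m * Q))"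
        "Re (mtrace (tpow \<sigma>2 m * Q)) \<le> 2 powr - (m * a)" using M by blast
      have "4 * \<delta> \<le> Re (mtrace (E (tpow \<rho>1 n) * Q))"
        by (rule robust[OF channel_density[OF E(1) density_tpow[OF \<rho>1]] density_tpow[OF \<rho>2] Q(1) E(3) Q(2)])
      also have "\<dots> \<le> 2 powr (n * b) * Re (mtrace (tpow \<sigma>2 m * Q)) + 2 * \<delta>"
        using channel_test_bound[OF E(1) density_tpow[OF \<rho>1] density_tpow[OF \<sigma>1(1)] \<omega> Q(1)] unfolding E(2) .
      also have "2 powr (n * b) * Re (mtrace (tpow \<sigma>2 m * Q)) \<le> 2 powr (n * b) * 2 powr - (m * a)"
        using Q(3) by (intro mult_left_mono) auto
      also have "\<dots> \<le> 2 powr (n * (b - r * a))"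
      proof -
        have "r * n * a \<le> m * a" using m a by (intro mult_right_mono) auto
        then show ?thesis
          unfolding powr_add[symmetric] by (intro powr_mono) (auto simp: algebra_simps)
      qed
      also have "\<dots> < 2 * \<delta>"
      proof -
        have "n * (b - r * a) < log 2 (2 * \<delta>)" using elim(3) ab by (simp add: field_simps)
        then have "2 powr (n * (b - r * a)) < 2 powr (log 2 (2 * \<delta>))" by (intro powr_less_mono) auto
        then show ?thesis using \<delta> by simp
      qed
      finally show False by simp
    qed
  qed
qed

theorem theorem3:
  fixes d1 d2 :: nat and \<rho>1 \<sigma>1 \<rho>2 \<sigma>2 :: "complex mat"
    and \<Delta> :: "complex mat \<Rightarrow> complex mat \<Rightarrow> real" and \<epsilon> :: real
  assumes "density d1 \<rho>1" and "density d1 \<sigma>1" and "full_support d1 \<sigma>1"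
    and "density d2 \<rho>2" and "density d2 \<sigma>2" and "full_support d2 \<sigma>2"
    and "\<Delta> \<in> {trace_dist, purified_dist}"
    and "0 < \<epsilon>" and "\<epsilon> < 1"
  shows "(\<lambda>n. Rhat d1 d2 \<Delta> \<rho>1 \<sigma>1 \<rho>2 \<sigma>2 \<epsilon> n) \<longlonglongrightarrow>
           (if rel_entropy \<rho>2 \<sigma>2 = 0 then \<infinity>
            else ereal (rel_entropy \<rho>1 \<sigma>1 / rel_entropy \<rho>2 \<sigma>2))"
proof -
  let ?D1 = "rel_entropy \<rho>1 \<sigma>1" and ?D2 = "rel_entropy \<rho>2 \<sigma>2"
  let ?ach = "achievable d1 d2 \<Delta> \<rho>1 \<sigma>1 \<rho>2 \<sigma>2"
  let ?R = "Rhat d1 d2 \<Delta> \<rho>1 \<sigma>1 \<rho>2 \<sigma>2 \<epsilon>"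
  have R_ge: "ereal (real m / real n) \<le> ?R n" if "?ach n m \<epsilon>" for n m
    unfolding Rhat_def using that by (intro SUP_upper) auto
  show ?thesis
  proof (cases "?D2 = 0")
    case True
    then have "\<rho>2 = \<sigma>2" by (rule rel_entropy_eq_0D[OF assms(4-6)])
    then have ach: "?ach n m \<epsilon>" for n m
      by (intro achievable_discard assms) auto
    \<comment> \<open>At \<open>n = 0\<close> every quotient \<open>m / n\<close> is 0, so only
      positive \<open>n\<close> are considered.\<close>
    have "?R n = \<infinity>" if "0 < n" for n
    proof (rule ereal_top)
      fix B :: real
      obtain m :: nat where "B * n \<le> m" using real_arch_simple by blast
      then have "B \<le> m / n" using that by (simp add: field_simps)
      then show "ereal B \<le> ?R n" using R_ge[OF ach, of m n] by (meson ereal_less_eq(3) order_trans)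
    qed
    then have "\<forall>\<^sub>F n in sequentially. ?R n = \<infinity>"
      by (intro eventually_sequentiallyI[of 1]) auto
    then show ?thesis using True by (simp add: tendsto_eventually)
  next
    case False
    have D1: "0 \<le> ?D1" by (rule rel_entropy_nonneg[OF assms(1-3)])
    have D2: "0 < ?D2" using rel_entropy_nonneg[OF assms(4-6)] False by simp
    have "?R \<longlonglongrightarrow> ereal (?D1 / ?D2)"
    proof (rule order_tendstoI)
      fix x assume x: "x < ereal (?D1 / ?D2)"
      show "\<forall>\<^sub>F n in sequentially. x < ?R n"
      \<comment> \<open>The rate argument needs a positive \<open>r\<close>. Negative
        \<open>x\<close>, including minus infinity, are beaten by \<open>m = 0\<close>; this also
        settles a vanishing \<open>?D1\<close>.\<close>
      proof (cases "x < 0")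
        case True
        have "?ach n 0 \<epsilon>" for n by (intro achievable_discard assms) auto
        then have "0 \<le> ?R n" for n using R_ge[of n 0] by (simp add: zero_ereal_def)
        then show ?thesis using True by (auto intro!: always_eventually elim: order_less_le_trans)
      next
        case False
        then obtain y where y: "x = ereal y" "0 \<le> y" using x by (cases x) auto
        obtain r where r: "y < r" "r < ?D1 / ?D2" using dense[of y "?D1 / ?D2"] x y by auto
        have "r * ?D2 < ?D1" using r D2 by (simp add: field_simps)
        then have "\<forall>\<^sub>F n in sequentially. ?ach n (nat \<lceil>r * n\<rceil>) \<epsilon>"
          using r y by (intro achievable_of_rate assms) auto
        then show ?thesis using eventually_real_gt[of 0]
        proof eventually_elim
          case (elim n)
          have "r * n \<le> nat \<lceil>r * n\<rceil>" by (rule of_nat_ceiling)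
          then have "y < nat \<lceil>r * n\<rceil> / n" using r elim(2) by (simp add: pos_le_divide_eq order_less_le_trans)
          then show ?case using R_ge[OF elim(1)] unfolding y by (meson ereal_less(1) less_ereal.simps(1) order_less_le_trans)
        qed
      qed
    next
      fix x assume x: "ereal (?D1 / ?D2) < x"
      \<comment> \<open>A real number strictly in between exists also for infinite \<open>x\<close>,
        and it turns the weak bound on the supremum into a strict one.\<close>
      obtain r where r: "?D1 / ?D2 < r" "ereal r < x" using ereal_dense2[OF x] by auto
      have r0: "0 < r" using r D1 D2 by (meson divide_nonneg_pos order_le_less_trans)
      have "?D1 < r * ?D2" using r D2 by (simp add: field_simps)
      then have "\<forall>\<^sub>F n in sequentially. \<forall>m. ?ach n m \<epsilon> \<longrightarrow> m \<le> r * n"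
        using r0 by (intro rate_le_of_achievable assms) auto
      then show "\<forall>\<^sub>F n in sequentially. ?R n < x"
        using eventually_real_gt[of 0]
      proof eventually_elim
        case (elim n)
        have "?R n \<le> ereal r"
          unfolding Rhat_def using elim by (intro SUP_least) (auto simp: field_simps)
        then show ?case using r(2) by (rule order_le_less_trans)
      qed
    qed
    then show ?thesis using False by simp
  qed
qed

end
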